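(* Suppose that $\phi$ and $\psi$ are complex-valued functions on the unit circle $S^1$ that are restrictions of meromorphic functions (also denoted $\phi$ and $\psi$) defined in a neighborhood of the closed unit disk, such that neither $\phi$ nor $\psi$ has zeros or poles on the unit circle. Suppose also that $\phi$ and $\psi$, as functions on $S^1$, have winding number zero with respect to the origin. Then \[ \det(T_\phi T_\psi T_\phi^{-1} T_\psi^{-1}) = \prod_{z \in \mathbb{D}} (\phi, \psi)_z^{-1}. \]
   Context: $\mathbb{D}$ is the open unit disk. $H^2(S^1)\subset L^2(S^1)$ is the Hardy space (closed span of $z^k$, $k\ge 0$), $P$ is the orthogonal projection of $L^2(S^1)$ onto $H^2(S^1)$, and for $\phi$ continuous on $S^1$ the Toeplitz operator $T_\phi$ on $H^2(S^1)$ is $T_\phi f = P(\phi f)$. If $\phi$ is smooth, nowhere zero on $S^1$ and of winding number zero, then $T_\phi$ is invertible. For smooth $\phi,\psi$ the commutator $T_\phi T_\psi - T_\psi T_\phi$ is trace class, so $T_\phi T_\psi T_\phi^{-1}T_\psi^{-1}$ is the identity plus a trace class operator; $\det$ denotes the (Fredholm) determinant of such operators. For a meromorphic function $\phi$ as in the claim and $z\in\mathbb{D}$, let $v(\phi,z)=m$ if $\phi$ has a zero of order $m$ at $z$, $v(\phi,z)=-m$ if $\phi$ has a pole of order $m$ at $z$, and $v(\phi,z)=0$ if $\phi$ has neither a zero nor a pole at $z$. The tame symbol of $\phi$ and $\psi$ at $z$ is \[ (\phi,\psi)_z=\lim_{w\to z}(-1)^{v(\phi,z)v(\psi,z)}\frac{\psi(w)^{v(\phi,z)}}{\phi(w)^{v(\psi,z)}}.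 \] It equals $1$ for all but finitely many $z\in\mathbb{D}$, so the product is a finite product. *)

theory Defs
  imports "HOL-Complex_Analysis.Complex_Analysis"
begin

section \<open>The space \<open>L\<^sup>2(S\<^sup>1)\<close>\<close>

text \<open>Normalised arc length. The underlying space is the circle itself, so that measurability,
  integrals and almost-everywhere statements ignore the values of a function off the circle.\<close>

definition circle_measure :: "complex measure" where
  "circle_measure =
     distr (uniform_measure lborel {-pi..pi}) (restrict_space borel (sphere 0 1)) cis"

definition square_integrable :: "(complex \<Rightarrow> complex) \<Rightarrow> bool" where
  "square_integrable f \<longleftrightarrow>
     f \<in> borel_measurable circle_measure \<and> integrable circle_measure (\<lambda>z. (cmod (f z))\<^sup>2)"

definition L2_rel :: "(complex \<Rightarrow> complex) \<Rightarrow> (complex \<Rightarrow> complex) \<Rightarrow> bool" where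
  "L2_rel f g \<longleftrightarrow>
     square_integrable f \<and> square_integrable g \<and> (AE z in circle_measure. f z = g z)"

lemma square_integrable_zero: "square_integrable (\<lambda>_. 0)"
  by (simp add: square_integrable_def)

lemma square_integrable_cmult:
  assumes "square_integrable f"
  shows "square_integrable (\<lambda>z. c * f z)"
  using assms
  by (auto simp: square_integrable_def norm_mult power_mult_distrib intro!: borel_measurable_times)

lemma square_integrable_add:
  assumes "square_integrable f" "square_integrable g"
  shows "square_integrable (\<lambda>z. f z + g z)"
proof -
  have [measurable]: "f \<in> borel_measurable circle_measure" "g \<in> borel_measurable circle_measure"
    using assms by (auto simp: square_integrable_def)
  have "integrable circle_measure (\<lambda>z. (cmod (f z + g z))\<^sup>2)"
  proof (rule Bochner_Integration.integrable_bound)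
    show "integrable circle_measure (\<lambda>z. 2 * (cmod (f z))\<^sup>2 + 2 * (cmod (g z))\<^sup>2)"
      using assms by (auto simp: square_integrable_def)
    have "(cmod (a + b))\<^sup>2 \<le> 2 * (cmod a)\<^sup>2 + 2 * (cmod b)\<^sup>2" for a b
    proof -
      have "(cmod (a + b))\<^sup>2 \<le> (cmod a + cmod b)\<^sup>2"
        by (intro power_mono norm_triangle_ineq) auto
      also have "\<dots> \<le> 2 * (cmod a)\<^sup>2 + 2 * (cmod b)\<^sup>2"
        using zero_le_power2[of "cmod a - cmod b"] by (simp add: power2_eq_square algebra_simps)
      finally show ?thesis .
    qed
    then show "AE z in circle_measure. norm ((cmod (f z + g z))\<^sup>2)
                 \<le> norm (2 * (cmod (f z))\<^sup>2 + 2 * (cmod (g z))\<^sup>2)"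
      by auto
  qed measurable
  then show ?thesis
    by (simp add: square_integrable_def)
qed

lemma square_integrable_uminus: "square_integrable f \<Longrightarrow> square_integrable (\<lambda>z. - f z)"
  using square_integrable_cmult[of f "-1"] by simp

lemma square_integrable_diff:
  "square_integrable f \<Longrightarrow> square_integrable g \<Longrightarrow> square_integrable (\<lambda>z. f z - g z)"
  using square_integrable_add[of f "\<lambda>z. - g z"] square_integrable_uminus[of g] by simp

lemma borel_measurable_cnj [measurable]: "cnj \<in> borel_measurable borel"
  by (intro borel_measurable_continuous_onI continuous_intros)

lemma integrable_mult_cnj:
  assumes "square_integrable f" "square_integrable g"
  shows "integrable circle_measure (\<lambda>z. f z * cnj (g z))"
proof -
  have [measurable]: "f \<in> borel_measurable circle_measure" "g \<in> borel_measurable circle_measure"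
    using assms by (auto simp: square_integrable_def)
  show ?thesis
  proof (rule Bochner_Integration.integrable_bound)
    show "integrable circle_measure (\<lambda>z. (cmod (f z))\<^sup>2 + (cmod (g z))\<^sup>2)"
      using assms by (auto simp: square_integrable_def)
    show "AE z in circle_measure. norm (f z * cnj (g z))
            \<le> norm ((cmod (f z))\<^sup>2 + (cmod (g z))\<^sup>2)"
    proof (intro always_eventually allI)
      fix z
      have "2 * (cmod (f z) * cmod (g z)) \<le> (cmod (f z))\<^sup>2 + (cmod (g z))\<^sup>2"
        using zero_le_power2[of "cmod (f z) - cmod (g z)"] by (simp add: power2_diff)
      moreover have "0 \<le> cmod (f z) * cmod (g z)" by simp
      ultimately have "cmod (f z) * cmod (g z) \<le> (cmod (f z))\<^sup>2 + (cmod (g z))\<^sup>2"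
        by linarith
      then show "norm (f z * cnj (g z)) \<le> norm ((cmod (f z))\<^sup>2 + (cmod (g z))\<^sup>2)"
        by (simp add: norm_mult)
    qed
  qed measurable
qed

quotient_type L2 = "complex \<Rightarrow> complex" / partial: L2_rel
proof (rule part_equivpI)
  show "\<exists>f. L2_rel f f"
    using square_integrable_zero by (auto simp: L2_rel_def)
  show "symp L2_rel"
    by (auto simp: symp_def L2_rel_def elim: AE_mp)
  show "transp L2_rel"
    unfolding transp_def L2_rel_def by fastforce
qed

lift_definition scaleC :: "complex \<Rightarrow> L2 \<Rightarrow> L2" (infixr \<open>*\<^sub>C\<close> 75) is "\<lambda>c f z. c * f z"
  by (auto simp: L2_rel_def square_integrable_cmult)

lift_definition cinner :: "L2 \<Rightarrow> L2 \<Rightarrow> complex" is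
  "\<lambda>f g. LINT z|circle_measure. f z * cnj (g z)"
  by (rule integral_cong_AE)
    (auto simp: L2_rel_def square_integrable_def
      intro!: borel_measurable_times measurable_compose[OF _ borel_measurable_cnj])

instantiation L2 :: real_inner
begin

lift_definition zero_L2 :: L2 is "\<lambda>_. 0"
  by (simp add: L2_rel_def square_integrable_zero)

lift_definition plus_L2 :: "L2 \<Rightarrow> L2 \<Rightarrow> L2" is "\<lambda>f g z. f z + g z"
  by (auto simp: L2_rel_def square_integrable_add)

lift_definition uminus_L2 :: "L2 \<Rightarrow> L2" is "\<lambda>f z. - f z"
  by (auto simp: L2_rel_def square_integrable_uminus)

lift_definition minus_L2 :: "L2 \<Rightarrow> L2 \<Rightarrow> L2" is "\<lambda>f g z. f z - g z"
  by (auto simp: L2_rel_def square_integrable_diff)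

definition scaleR_L2 :: "real \<Rightarrow> L2 \<Rightarrow> L2" where
  "scaleR_L2 r f = complex_of_real r *\<^sub>C f"

definition inner_L2 :: "L2 \<Rightarrow> L2 \<Rightarrow> real" where
  "inner_L2 f g = Re (cinner f g)"

definition norm_L2 :: "L2 \<Rightarrow> real" where
  "norm_L2 f = sqrt (inner f f)"

definition dist_L2 :: "L2 \<Rightarrow> L2 \<Rightarrow> real" where
  "dist_L2 f g = norm (f - g)"

definition sgn_L2 :: "L2 \<Rightarrow> L2" where
  "sgn_L2 f = inverse (norm f) *\<^sub>R f"

definition uniformity_L2 :: "(L2 \<times> L2) filter" where
  "uniformity_L2 = (INF e\<in>{0 <..}. principal {(f, g). dist f g < e})"

definition open_L2 :: "L2 set \<Rightarrow> bool" where
  "open_L2 U \<longleftrightarrow> (\<forall>f\<in>U. eventually (\<lambda>(f', g). f' = f \<longrightarrow> g \<in> U) uniformity)"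

instance
proof
  fix f g h :: L2 and r s :: real and U :: "L2 set"
  show "f + g + h = f + (g + h)"
    by transfer (auto simp: L2_rel_def add.assoc intro!: square_integrable_add)
  show "f + g = g + f"
    by transfer (auto simp: L2_rel_def add.commute intro!: square_integrable_add)
  show "0 + f = f"
    by transfer (auto simp: L2_rel_def)
  show "- f + f = 0"
    by transfer (auto simp: L2_rel_def square_integrable_zero)
  show "f - g = f + - g"
    by transfer (auto simp: L2_rel_def square_integrable_diff)
  show "r *\<^sub>R (f + g) = r *\<^sub>R f + r *\<^sub>R g"
    unfolding scaleR_L2_def
    by transfer (auto simp: L2_rel_def distrib_left
        intro!: square_integrable_add square_integrable_cmult)
  show "(r + s) *\<^sub>R f = r *\<^sub>R f + s *\<^sub>R f"
    unfolding scaleR_L2_def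
    by transfer (auto simp: L2_rel_def distrib_right
        intro!: square_integrable_add square_integrable_cmult)
  show "r *\<^sub>R s *\<^sub>R f = (r * s) *\<^sub>R f"
    unfolding scaleR_L2_def
    by transfer (auto simp: L2_rel_def mult.assoc intro!: square_integrable_cmult)
  show "1 *\<^sub>R f = f"
    unfolding scaleR_L2_def by transfer (auto simp: L2_rel_def)
  show "dist f g = norm (f - g)"
    by (rule dist_L2_def)
  show "sgn f = inverse (norm f) *\<^sub>R f"
    by (rule sgn_L2_def)
  show "uniformity = (INF e\<in>{0 <..}. principal {(f, g :: L2). dist f g < e})"
    by (rule uniformity_L2_def)
  show "open U \<longleftrightarrow> (\<forall>f\<in>U. eventually (\<lambda>(f', g). f' = f \<longrightarrow> g \<in> U) uniformity)"
    by (rule open_L2_def)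
  have "cinner f g = cnj (cinner g f)"
    by transfer (simp flip: Bochner_Integration.integral_cnj add: mult.commute)
  then show "inner f g = inner g f"
    by (simp add: inner_L2_def)
  have "cinner (f + g) h = cinner f h + cinner g h"
    by transfer (auto simp: L2_rel_def distrib_right integrable_mult_cnj
        intro!: Bochner_Integration.integral_add)
  then show "inner (f + g) h = inner f h + inner g h"
    by (simp add: inner_L2_def)
  have "cinner (complex_of_real r *\<^sub>C f) g = complex_of_real r * cinner f g"
    by transfer (simp add: mult.assoc)
  then show "inner (r *\<^sub>R f) g = r * inner f g"
    by (simp add: inner_L2_def scaleR_L2_def)
  have norm_eq: "(LINT z|circle_measure. f z * cnj (f z))
      = complex_of_real (LINT z|circle_measure. (cmod (f z))\<^sup>2)" for f
    unfolding complex_norm_square[symmetric] by (rule integral_complex_of_real)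
  show "0 \<le> inner f f"
    unfolding inner_L2_def by transfer (simp add: norm_eq)
  show "inner f f = 0 \<longleftrightarrow> f = 0"
    unfolding inner_L2_def
  proof transfer
    fix f assume "L2_rel f f"
    then have "square_integrable f" by (simp add: L2_rel_def)
    then show "Re (LINT z|circle_measure. f z * cnj (f z)) = 0 \<longleftrightarrow> L2_rel f (\<lambda>_. 0)"
      by (simp add: norm_eq L2_rel_def square_integrable_zero)
        (subst integral_nonneg_eq_0_iff_AE, auto simp: square_integrable_def)
  qed
  show "norm f = sqrt (inner f f)"
    by (rule norm_L2_def)
qed

end


section \<open>Hardy space and Toeplitz operators\<close>

definition monomial_L2 :: "nat \<Rightarrow> L2" where
  "monomial_L2 k = abs_L2 (\<lambda>z. z ^ k)"

definition hardy :: "L2 set" where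
  "hardy = closure {\<Sum>k<n. c k *\<^sub>C monomial_L2 k | n c. True}"

definition orth_proj :: "L2 set \<Rightarrow> L2 \<Rightarrow> L2" where
  "orth_proj H f = (THE g. g \<in> H \<and> (\<forall>h\<in>H. cinner (f - g) h = 0))"

text \<open>Multiplication by a symbol. It is meaningful if the symbol is bounded and measurable on the
  circle, in particular if it is continuous there.\<close>

definition mult_L2 :: "(complex \<Rightarrow> complex) \<Rightarrow> L2 \<Rightarrow> L2" where
  "mult_L2 \<phi> f = abs_L2 (\<lambda>z. \<phi> z * rep_L2 f z)"

text \<open>Operators on the Hardy space are functions on \<open>L\<^sup>2\<close> of which only the values on
  \<^const>\<open>hardy\<close> matter.\<close>

definition toeplitz :: "(complex \<Rightarrow> complex) \<Rightarrow> L2 \<Rightarrow> L2" where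
  "toeplitz \<phi> f = orth_proj hardy (mult_L2 \<phi> f)"


section \<open>Trace class operators and the Fredholm determinant\<close>

text \<open>Trace class is taken in the form of nuclearity:
  \<open>A = \<Sum>\<^sub>n \<langle>-, x\<^sub>n\<rangle> y\<^sub>n\<close> with \<open>\<Sum>\<^sub>n \<parallel>x\<^sub>n\<parallel> \<parallel>y\<^sub>n\<parallel> < \<infinity>\<close>.\<close>

definition trace_class_on :: "L2 set \<Rightarrow> (L2 \<Rightarrow> L2) \<Rightarrow> bool" where
  "trace_class_on H A \<longleftrightarrow>
     (\<exists>x y. range x \<subseteq> H \<and> range y \<subseteq> H \<and> summable (\<lambda>n::nat. norm (x n) * norm (y n)) \<and>
        (\<forall>f\<in>H. (\<lambda>n. cinner f (x n) *\<^sub>C y n) sums A f))"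

text \<open>The determinant of the compression of \<open>A\<close> to the span of the \<open>e\<^sub>i\<close> with \<open>i \<in> S\<close>.\<close>

definition principal_minor :: "(nat \<Rightarrow> L2) \<Rightarrow> (L2 \<Rightarrow> L2) \<Rightarrow> nat set \<Rightarrow> complex" where
  "principal_minor e A S =
     (\<Sum>p | p permutes S. of_int (sign p) * (\<Prod>i\<in>S. cinner (A (e (p i))) (e i)))"

text \<open>The trace of the exterior power \<open>\<Lambda>\<^sup>k A\<close>, computed in the orthonormal basis
  \<open>e\<^sub>i\<^sub>1 \<and> \<dots> \<and> e\<^sub>i\<^sub>k\<close> with \<open>i\<^sub>1 < \<dots> < i\<^sub>k\<close>.\<close>

definition exterior_trace :: "(nat \<Rightarrow> L2) \<Rightarrow> nat \<Rightarrow> (L2 \<Rightarrow> L2) \<Rightarrow> complex" where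
  "exterior_trace e k A = (\<Sum>\<^sub>\<infinity>S\<in>{S. finite S \<and> card S = k}. principal_minor e A S)"

text \<open>\<open>det (1 + A) = \<Sum>\<^sub>k tr (\<Lambda>\<^sup>k A)\<close> for an operator \<open>T = 1 + A\<close> on the Hardy space with
  \<open>A\<close> of trace class. Such traces do not depend on the orthonormal basis; the one used here is
  \<open>1, z, z\<^sup>2, \<dots>\<close>.\<close>

definition fredholm_det :: "(L2 \<Rightarrow> L2) \<Rightarrow> complex" where
  "fredholm_det T = (\<Sum>k. exterior_trace monomial_L2 k (\<lambda>f. T f - f))"


section \<open>The tame symbol\<close>

definition tame_symbol :: "(complex \<Rightarrow> complex) \<Rightarrow> (complex \<Rightarrow> complex) \<Rightarrow> complex \<Rightarrow> complex" where
  "tame_symbol \<phi> \<psi> z =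
     Lim (at z) (\<lambda>w. (-1) powi (zorder \<phi> z * zorder \<psi> z) *
                     (\<psi> w powi zorder \<phi> z / \<phi> w powi zorder \<psi> z))"

end

theory Submission
  imports Defs "Jordan_Normal_Form.Determinant"
begin

text \<open>
  Write \<open>\<phi>\<close> near the closed disc as \<open>g(z) \<Prod>(z - a)\<^sup>m\<^sup>(\<^sup>a\<^sup>)\<close> with \<open>g\<close> analytic and without zeros, the product running over the
  zeros and poles in the disc. The argument principle turns the condition on the winding number into
  \<open>\<Sum>m(a) = 0\<close>. Hence on the circle \<open>\<phi> = u g\<close> with \<open>u = \<Prod>(1 - a/z)\<^sup>m\<^sup>(\<^sup>a\<^sup>)\<close>, which is the complex
  conjugate of an analytic function, as is its inverse. So \<open>T\<^sub>\<phi> = T\<^sub>u T\<^sub>g\<close> has the inverse \<open>T\<^sub>1\<^sub>/\<^sub>g T\<^sub>1\<^sub>/\<^sub>u\<close> (\<open>meromorphic_factorization\<close>, \<open>toeplitz_bij_betw\<close>).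
  Similarly \<open>\<psi> = v h\<close> with orders \<open>n(a)\<close>.

  Analytic Toeplitz operators commute with each other, and so do coanalytic ones. Therefore the commutator of \<open>T\<^sub>\<phi>\<close> and
  \<open>T\<^sub>\<psi>\<close> is a product of conjugates of the mixed commutators \<open>[T\<^sub>g, T\<^sub>v]\<close> and \<open>[T\<^sub>u, T\<^sub>h]\<close>
  (\<open>toeplitz_commutator_det\<close>). Mixed commutators are multiplicative up to conjugation in the coanalytic symbol, which reduces them to a single
  factor \<open>1 - a/z\<close>. There the commutator with \<open>T\<^sub>h\<close> is the identity plus a rank one operator with determinant
  \<open>h(0) / h(a)\<close> (\<open>comm_det_factor\<close>). Altogether the determinant is
  \<open>\<Prod> h(a)\<^sup>-\<^sup>m\<^sup>(\<^sup>a\<^sup>) g(a)\<^sup>n\<^sup>(\<^sup>a\<^sup>)\<close>; the values at \<open>0\<close> cancel.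

  These commutators are finite rank perturbations of the identity. For these the Fredholm determinant, defined by
  principal minors in the monomial basis, is the determinant of a finite matrix of inner products
  (\<open>sum_index_minor_finite_rank\<close>, \<open>fredholm_det_eqI\<close>). In this form it is multiplicative and invariant under conjugation
  (\<open>has_det_compose\<close>, \<open>has_det_conjugate\<close>).

  Finally, the tame symbol at \<open>a\<close> is \<open>h(a)\<^sup>m\<^sup>(\<^sup>a\<^sup>) / g(a)\<^sup>n\<^sup>(\<^sup>a\<^sup>)\<close> times the tame symbol of the two rational parts, and the product of the
  latter over all \<open>a\<close> is \<open>1\<close> by reciprocity (\<open>tame_symbol_eq\<close>, \<open>prod_reciprocity_factor\<close>).
\<close>

section \<open>Determinants of finite rank perturbations of the identity\<close>

text \<open>The order of the arguments of \<open>a\<close>, column before row, is that in which the operator enters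
  \<^const>\<open>principal_minor\<close>.\<close>

definition index_minor :: "(nat \<Rightarrow> nat \<Rightarrow> complex) \<Rightarrow> nat set \<Rightarrow> complex" where
  "index_minor a S = (\<Sum>p | p permutes S. of_int (sign p) * (\<Prod>i\<in>S. a (p i) i))"

lemma principal_minor_eq_index_minor:
  "principal_minor e A S = index_minor (\<lambda>j i. cinner (A (e j)) (e i)) S"
  by (simp add: principal_minor_def index_minor_def)

lemma permutes_less: "p permutes {..<n} \<Longrightarrow> i < n \<Longrightarrow> p i < (n :: nat)"
  using permutes_in_image[of p "{..<n}" i] by simp

text \<open>Expanding each factor \<open>\<delta> + a\<close> in the Leibniz formula selects the set \<open>S\<close> on which \<open>a\<close> is taken.
  Off \<open>S\<close> only permutations fixing every point contribute, and these are the permutations of \<open>S\<close>.\<close>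

lemma det_one_plus_eq_sum_index_minor:
  "Determinant.det (mat n n (\<lambda>(i,j). (if i = j then 1 else 0) + a i j))
     = (\<Sum>S\<in>Pow {..<n}. index_minor a S)"
proof -
  let ?I = "{..<n}"
  let ?d = "\<lambda>p i. if p i = i then 1 else (0::complex)"
  have perm: "sum f {p. p permutes ?I \<and> (\<forall>i\<in>?I - S. p i = i)} = sum f {p. p permutes S}"
    if "S \<subseteq> ?I" for S and f :: "(nat \<Rightarrow> nat) \<Rightarrow> complex"
  proof (rule sum.cong[OF _ refl], intro Collect_eqI iffI)
    fix p assume "p permutes ?I \<and> (\<forall>i\<in>?I - S. p i = i)"
    then show "p permutes S" by (auto intro: permutes_superset)
  next
    fix p assume "p permutes S"
    then show "p permutes ?I \<and> (\<forall>i\<in>?I - S. p i = i)"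
      using that by (auto intro: permutes_subset simp: permutes_not_in)
  qed
  have "Determinant.det (mat n n (\<lambda>(i,j). (if i = j then 1 else 0) + a i j))
      = (\<Sum>p | p permutes ?I. of_int (sign p) * (\<Prod>i\<in>?I. a (p i) i + ?d p i))"
    by (subst det_col[of _ n]) 
       (auto simp: lessThan_atLeast0 permutes_less intro!: sum.cong prod.cong)
  also have "\<dots> = (\<Sum>p | p permutes ?I. \<Sum>S\<in>Pow ?I.
        of_int (sign p) * ((\<Prod>i\<in>S. a (p i) i) * (\<Prod>i\<in>?I - S. ?d p i)))"
    by (subst prod_add) (auto simp: sum_distrib_left)
  also have "\<dots> = (\<Sum>S\<in>Pow ?I. \<Sum>p | p permutes ?I.
        of_int (sign p) * ((\<Prod>i\<in>S. a (p i) i) * (\<Prod>i\<in>?I - S. ?d p i)))"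
    by (rule sum.swap)
  also have "\<dots> = (\<Sum>S\<in>Pow ?I. index_minor a S)"
  proof (rule sum.cong[OF refl])
    fix S assume S: "S \<in> Pow ?I"
    have fin: "finite {p. p permutes ?I}" by (rule finite_permutations) simp
    have "(\<Sum>p | p permutes ?I. 
        of_int (sign p) * ((\<Prod>i\<in>S. a (p i) i) * (\<Prod>i\<in>?I - S. ?d p i)))
      = (\<Sum>p | p permutes ?I \<and> (\<forall>i\<in>?I - S. p i = i). of_int (sign p) * (\<Prod>i\<in>S. a (p i) i))"
      using fin by (intro sum.mono_neutral_cong_right) auto
    also have "\<dots> = index_minor a S"
      unfolding index_minor_def using S by (intro perm) auto
    finally show "(\<Sum>p | p permutes ?I. 
        of_int (sign p) * ((\<Prod>i\<in>S. a (p i) i) * (\<Prod>i\<in>?I - S. ?d p i))) = index_minor a S" .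
  qed
  finally show ?thesis .
qed

text \<open>A determinant with two equal rows, over an arbitrary finite index set: composition with the
  transposition of the two rows reverses every sign.\<close>

lemma sum_permutations_eq_zero_if_repeated:
  assumes S: "finite S" and ij: "i \<in> S" "j \<in> S" "i \<noteq> j" "c i = c j"
  shows "(\<Sum>p | p permutes S. of_int (sign p) * (\<Prod>k\<in>S. b (c k) (p k))) = (0::complex)"
    (is "?s = 0")
proof -
  let ?t = "Transposition.transpose i j"
  have t: "?t permutes S" using ij by (intro permutes_swap_id)
  have "?s = (\<Sum>p | p permutes S. of_int (sign (p \<circ> ?t)) * (\<Prod>k\<in>S. b (c k) ((p \<circ> ?t) k)))"
    by (rule sum_permutations_compose_right[OF t])
  also have "\<dots> = (\<Sum>p | p permutes S. - (of_int (sign p) * (\<Prod>k\<in>S. b (c k) (p k))))"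
  proof (rule sum.cong[OF refl])
    fix p assume "p \<in> {p. p permutes S}"
    then have p: "permutation p" using S permutation_permutes by blast
    have c: "c (?t k) = c k" for k
      using ij by (auto simp: Transposition.transpose_def)
    have "sign (p \<circ> ?t) = - sign p"
      using p ij by (subst sign_compose) (auto simp: sign_swap_id permutation_swap_id)
    moreover have "(\<Prod>k\<in>S. b (c k) ((p \<circ> ?t) k)) = (\<Prod>k\<in>S. b (c (?t k)) (p (?t k)))"
      by (simp add: c)
    moreover have "\<dots> = (\<Prod>k\<in>S. b (c k) (p k))"
      by (rule prod.permute[OF t, symmetric, unfolded o_def])
    ultimately show "of_int (sign (p \<circ> ?t)) * (\<Prod>k\<in>S. b (c k) ((p \<circ> ?t) k))
        = - (of_int (sign p) * (\<Prod>k\<in>S. b (c k) (p k)) :: complex)"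
      by simp
  qed
  also have "\<dots> = - ?s" by (simp add: sum_negf)
  finally show ?thesis by simp
qed

text \<open>By multilinearity the minor is a sum over maps from \<open>S\<close> to the \<open>N\<close> rank one terms. No such map is
  injective, so each summand is a determinant with a repeated row.\<close>

lemma index_minor_finite_rank_eq_zero:
  assumes S: "finite S" and "card S > N"
  shows "index_minor (\<lambda>j i. \<Sum>n<N. x n j * y n i) S = 0"
proof -
  let ?F = "S \<rightarrow>\<^sub>E {..<N}"
  have "index_minor (\<lambda>j i. \<Sum>n<N. x n j * y n i) S
      = (\<Sum>p | p permutes S. \<Sum>c\<in>?F. of_int (sign p) * (\<Prod>i\<in>S. x (c i) (p i) * y (c i) i))"
    unfolding index_minor_def using S
    by (subst prod_sum_PiE) (auto simp: sum_distrib_left)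
  also have "\<dots> = (\<Sum>c\<in>?F. \<Sum>p | p permutes S. of_int (sign p) * (\<Prod>i\<in>S. x (c i) (p i) * y (c i) i))"
    by (rule sum.swap)
  also have "\<dots> = (\<Sum>c\<in>?F. 0)"
  proof (rule sum.cong[OF refl])
    fix c assume c: "c \<in> ?F"
    have "\<not> inj_on c S"
    proof
      assume "inj_on c S"
      then have "card S \<le> card {..<N}"
        using c by (intro card_inj_on_le[of c]) auto
      then show False using assms by simp
    qed
    then obtain i j where ij: "i \<in> S" "j \<in> S" "i \<noteq> j" "c i = c j"
      by (auto simp: inj_on_def)
    have "(\<Sum>p | p permutes S. of_int (sign p) * (\<Prod>i\<in>S. x (c i) (p i) * y (c i) i))
       = (\<Sum>p | p permutes S. of_int (sign p) * (\<Prod>i\<in>S. x (c i) (p i))) * (\<Prod>i\<in>S. y (c i) i)"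
      by (simp add: prod.distrib sum_distrib_right mult.assoc)
    also have "\<dots> = 0"
      using sum_permutations_eq_zero_if_repeated[OF S ij, of x] by simp
    finally show "(\<Sum>p | p permutes S. of_int (sign p) * (\<Prod>i\<in>S. x (c i) (p i) * y (c i) i)) = 0" .
  qed
  finally show ?thesis by simp
qed

text \<open>The factorial is harmless, because for finite rank the minors of large sets vanish. What matters is
  that the other factor is a product over \<open>S\<close>, which is summable over all finite \<open>S\<close>.\<close>

lemma norm_index_minor_le:
  assumes S: "finite S" and a: "\<And>j i. cmod (a j i) \<le> \<xi> j * \<eta> i" 
  shows "cmod (index_minor a S) \<le> fact (card S) * (\<Prod>i\<in>S. \<xi> i * \<eta> i)"
proof -
  have "cmod (index_minor a S) \<le> (\<Sum>p | p permutes S. (\<Prod>i\<in>S. \<xi> i * \<eta> i))"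
    unfolding index_minor_def
  proof (rule sum_norm_le)
    fix p assume "p \<in> {p. p permutes S}"
    then have p: "p permutes S" by simp
    have "cmod (of_int (sign p) * (\<Prod>i\<in>S. a (p i) i)) = (\<Prod>i\<in>S. cmod (a (p i) i))"
      by (simp add: norm_mult prod_norm sign_def)
    also have "\<dots> \<le> (\<Prod>i\<in>S. \<xi> (p i) * \<eta> i)"
      by (intro prod_mono) (auto simp: a)
    also have "\<dots> = (\<Prod>i\<in>S. \<xi> i) * (\<Prod>i\<in>S. \<eta> i)"
      by (subst (2) prod.permute[OF p]) (simp add: prod.distrib)
    finally show "cmod (of_int (sign p) * (\<Prod>i\<in>S. a (p i) i)) \<le> (\<Prod>i\<in>S. \<xi> i * \<eta> i)"
      by (simp add: prod.distrib)
  qed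
  also have "\<dots> = fact (card S) * (\<Prod>i\<in>S. \<xi> i * \<eta> i)"
    using card_permutations[OF refl S] by simp
  finally show ?thesis .
qed

text \<open>The partial sums are bounded by products \<open>\<Prod>(1 + w\<^sub>i) \<le> exp (\<Sum>w\<^sub>i)\<close>.\<close>

lemma summable_on_prod_finite_sets:
  fixes w :: "nat \<Rightarrow> real"
  assumes w: "\<And>i. 0 \<le> w i" "summable w"
  shows "(\<lambda>S. \<Prod>i\<in>S. w i) summable_on {S. finite S}"
proof (rule nonneg_bdd_above_summable_on)
  show "bdd_above (sum (\<lambda>S. \<Prod>i\<in>S. w i) ` {F. F \<subseteq> {S. finite S} \<and> finite F})"
  proof (rule bdd_aboveI2)
    fix F :: "nat set set" assume "F \<in> {F. F \<subseteq> {S. finite S} \<and> finite F}"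
    then have F: "finite F" "finite (\<Union>F)" by auto
    then obtain n where n: "\<Union>F \<subseteq> {..<n}" using finite_nat_iff_bounded by blast
    have "(\<Sum>S\<in>F. \<Prod>i\<in>S. w i) \<le> (\<Sum>S\<in>Pow {..<n}. \<Prod>i\<in>S. w i)"
      using n by (intro sum_mono2) (auto intro: prod_nonneg w)
    also have "\<dots> = (\<Prod>i<n. w i + 1)"
      by (subst prod_add) auto
    also have "\<dots> \<le> exp (\<Sum>i<n. w i)"
      using prod_le_exp_sum[of "{..<n}" w] w by (simp add: add.commute)
    also have "\<dots> \<le> exp (suminf w)"
      using w by (simp add: sum_le_suminf)
    finally show "(\<Sum>S\<in>F. \<Prod>i\<in>S. w i) \<le> exp (suminf w)" .
  qed
qed (auto intro: prod_nonneg w)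

lemma summable_norm_mult:
  fixes f g :: "nat \<Rightarrow> complex"
  assumes "summable (\<lambda>j. (cmod (f j))\<^sup>2)" "summable (\<lambda>j. (cmod (g j))\<^sup>2)"
  shows "summable (\<lambda>j. cmod (f j) * cmod (g j))"
proof (rule summable_comparison_test)
  show "\<exists>N. \<forall>j\<ge>N. norm (cmod (f j) * cmod (g j)) \<le> (cmod (f j))\<^sup>2 + (cmod (g j))\<^sup>2"
  proof (intro exI allI impI)
    fix j
    have "2 * (cmod (f j) * cmod (g j)) \<le> (cmod (f j))\<^sup>2 + (cmod (g j))\<^sup>2"
      using zero_le_power2[of "cmod (f j) - cmod (g j)"] by (simp add: power2_diff)
    moreover have "0 \<le> cmod (f j) * cmod (g j)" by simp
    ultimately show "norm (cmod (f j) * cmod (g j)) \<le> (cmod (f j))\<^sup>2 + (cmod (g j))\<^sup>2"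
      unfolding real_norm_def abs_of_nonneg[OF \<open>0 \<le> cmod (f j) * cmod (g j)\<close>] by linarith
  qed
qed (intro summable_add assms)

text \<open>Sylvester's identity. It turns the \<open>n \<times> n\<close> truncations of a finite rank operator, with \<open>n\<close>
  growing, into matrices of fixed size whose entries converge.\<close>

lemma det_one_plus_mult_commute:
  fixes B C :: "'a :: idom mat"
  assumes B: "B \<in> carrier_mat n m" and C: "C \<in> carrier_mat m n"
  shows "Determinant.det (1\<^sub>m n + B * C) = Determinant.det (1\<^sub>m m + C * B)"
proof -
  have I: "(1\<^sub>m n :: 'a mat) \<in> carrier_mat n n" "(1\<^sub>m m :: 'a mat) \<in> carrier_mat m m"
    and Z: "(0\<^sub>m m n :: 'a mat) \<in> carrier_mat m n"
    and mC: "- C \<in> carrier_mat m n" and BC: "1\<^sub>m n + B * C \<in> carrier_mat n n"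
    and CB: "1\<^sub>m m + C * B \<in> carrier_mat m m"
    using B C by auto
  let ?L = "four_block_mat (1\<^sub>m n) (0\<^sub>m n m) C (1\<^sub>m m)"
  let ?M = "four_block_mat (1\<^sub>m n) B (- C) (1\<^sub>m m)"
  have Lc: "?L \<in> carrier_mat (n + m) (n + m)" and Mc: "?M \<in> carrier_mat (n + m) (n + m)"
    using B C by auto
  have L: "Determinant.det ?L = 1"
    using det_four_block_mat_upper_right_zero[OF I(1) _ C I(2), of "0\<^sub>m n m"] by simp
  have "?L * ?M = four_block_mat (1\<^sub>m n) B (0\<^sub>m m n) (1\<^sub>m m + C * B)"
    using B C
    by (subst mult_four_block_mat[OF I(1) _ C I(2) I(1) B mC I(2)])
      (auto intro!: cong_four_block_mat simp: comm_add_mat[of "C * B" m m])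
  then have 1: "Determinant.det (?L * ?M) = Determinant.det (1\<^sub>m m + C * B)"
    using det_four_block_mat_lower_left_zero[OF I(1) B refl CB] by simp
  have "?M * ?L = four_block_mat (1\<^sub>m n + B * C) B (0\<^sub>m m n) (1\<^sub>m m)"
    using B C
    by (subst mult_four_block_mat[OF I(1) B mC I(2) I(1) _ C I(2)])
      (auto intro!: cong_four_block_mat)
  then have 2: "Determinant.det (?M * ?L) = Determinant.det (1\<^sub>m n + B * C)"
    using det_four_block_mat_lower_left_zero[OF BC B refl I(2)] by simp
  show ?thesis
    using 1 2 det_mult[OF Lc Mc] det_mult[OF Mc Lc] by (simp add: mult.commute)
qed

text \<open>The matrix is a lower triangular times an upper unitriangular block matrix.
  It is the Gram matrix that arises for a product of two finite rank perturbations.\<close>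

lemma det_one_plus_block:
  fixes A B C D :: "'a :: idom mat"
  assumes A: "A \<in> carrier_mat n n" and B: "B \<in> carrier_mat n m"
    and C: "C \<in> carrier_mat m n" and D: "D \<in> carrier_mat m m"
  shows "Determinant.det (four_block_mat A (A * B) C (D + C * B)) 
     = Determinant.det A * Determinant.det D"
proof -
  have I: "(1\<^sub>m n :: 'a mat) \<in> carrier_mat n n" "(1\<^sub>m m :: 'a mat) \<in> carrier_mat m m"
    by auto
  let ?L = "four_block_mat A (0\<^sub>m n m) C D"
  let ?U = "four_block_mat (1\<^sub>m n) B (0\<^sub>m m n) (1\<^sub>m m)"
  have Lc: "?L \<in> carrier_mat (n + m) (n + m)" and Uc: "?U \<in> carrier_mat (n + m) (n + m)"
    using A B C D by auto
  have "?L * ?U = four_block_mat A (A * B) C (D + C * B)"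
    using A B C D
    by (subst mult_four_block_mat[OF A _ C D I(1) B _ I(2)])
      (auto intro!: cong_four_block_mat simp: comm_add_mat[of "C * B" m m])
  moreover have "Determinant.det ?L = Determinant.det A * Determinant.det D"
    by (rule det_four_block_mat_upper_right_zero[OF A refl C D])
  moreover have "Determinant.det ?U = 1"
    using det_four_block_mat_lower_left_zero[OF I(1) B refl I(2)] by simp
  ultimately show ?thesis using det_mult[OF Lc Uc] by simp
qed

text \<open>For the matrix \<open>a j i = \<Sum>\<^sub>n x\<^sub>n(j) y\<^sub>n(i)\<close> with square summable \<open>x\<^sub>n, y\<^sub>n\<close> the principal minors are absolutely
  summable over all finite sets. Their sum can therefore be grouped by cardinality, as in the
  Fredholm determinant, or taken along the sets \<open>Pow {..<n}\<close>. The latter partial sums are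
  determinants of truncations, which Sylvester's identity rewrites as determinants of size \<open>N\<close>.\<close>

theorem sum_index_minor_finite_rank:
  fixes x y :: "nat \<Rightarrow> nat \<Rightarrow> complex"
  assumes x: "\<And>n. n < N \<Longrightarrow> summable (\<lambda>j. (cmod (x n j))\<^sup>2)"
    and y: "\<And>n. n < N \<Longrightarrow> summable (\<lambda>j. (cmod (y n j))\<^sup>2)"
    and G: "\<And>n m. n < N \<Longrightarrow> m < N \<Longrightarrow> (\<lambda>j. x n j * y m j) sums G n m"
  defines "a \<equiv> \<lambda>j i. \<Sum>n<N. x n j * y n i"
  shows "(\<Sum>k. \<Sum>\<^sub>\<infinity>S\<in>{S. finite S \<and> card S = k}. index_minor a S)
     = Determinant.det (mat N N (\<lambda>(n,m). (if n = m then 1 else 0) + G n m))"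
proof -
  define \<xi> where "\<xi> j = (\<Sum>n<N. cmod (x n j))" for j
  define \<eta> where "\<eta> j = (\<Sum>n<N. cmod (y n j))" for j
  define w where "w i = \<xi> i * \<eta> i" for i
  have pos: "0 \<le> \<xi> i" "0 \<le> \<eta> i" "0 \<le> w i" for i
    by (auto simp: \<xi>_def \<eta>_def w_def intro!: sum_nonneg mult_nonneg_nonneg)
  have w: "summable w"
    unfolding w_def \<xi>_def \<eta>_def sum_product
    by (intro summable_sum summable_norm_mult x y) auto
  have a: "cmod (a j i) \<le> \<xi> j * \<eta> i" for j i
  proof -
    have "cmod (a j i) \<le> (\<Sum>n<N. cmod (x n j) * cmod (y n i))"
      unfolding a_def by (rule sum_norm_le) (simp add: norm_mult)
    also have "\<dots> \<le> (\<Sum>n<N. cmod (x n j) * \<eta> i)"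
      unfolding \<eta>_def by (intro sum_mono mult_left_mono member_le_sum) auto
    finally show ?thesis by (simp add: \<xi>_def sum_distrib_right)
  qed
  have abs: "(\<lambda>S. norm (index_minor a S)) summable_on {S. finite S}"
  proof (rule Infinite_Sum.abs_summable_on_comparison_test')
    show "(\<lambda>S. fact N * (\<Prod>i\<in>S. w i)) summable_on {S. finite S}"
      using summable_on_prod_finite_sets[OF pos(3) w] by (rule summable_on_cmult_right)
    fix S :: "nat set" assume "S \<in> {S. finite S}"
    then have S: "finite S" by simp
    have nn: "0 \<le> (\<Prod>i\<in>S. w i)" by (intro prod_nonneg pos ballI)
    show "cmod (index_minor a S) \<le> fact N * (\<Prod>i\<in>S. w i)"
    proof (cases "card S \<le> N")
      case True
      have "cmod (index_minor a S) \<le> fact (card S) * (\<Prod>i\<in>S. w i)"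
        unfolding w_def by (rule norm_index_minor_le[OF S a])
      also have "\<dots> \<le> fact N * (\<Prod>i\<in>S. w i)"
        using nn True by (intro mult_right_mono fact_mono) auto
      finally show ?thesis .
    next
      case False
      then show ?thesis
        using index_minor_finite_rank_eq_zero[OF S, of N x y] nn by (simp add: a_def)
    qed
  qed
  then have sm: "index_minor a summable_on {S. finite S}"
    by (rule abs_summable_summable)
  define L where "L = infsum (index_minor a) {S. finite S}"
  have hs: "(index_minor a has_sum L) {S. finite S}"
    using sm by (simp add: L_def)
  \<comment> \<open>grouping by cardinality\<close>
  have "((\<lambda>k. \<Sum>\<^sub>\<infinity>S\<in>{S. finite S \<and> card S = k}. index_minor a S) has_sum L) UNIV"
  proof (rule has_sum_SigmaD)
    let ?B = "\<lambda>k. {S :: nat set. finite S \<and> card S = k}"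
    have "bij_betw snd (Sigma UNIV ?B) {S :: nat set. finite S}"
      by (rule bij_betwI[where g = "\<lambda>S. (card S, S)"]) auto
    from has_sum_reindex_bij_betw[OF this, of "index_minor a" L]
    show "((\<lambda>kS. index_minor a (snd kS)) has_sum L) (Sigma UNIV ?B)" using hs by simp
    fix k
    have "index_minor a summable_on ?B k"
      using sm by (rule summable_on_subset) auto
    then show "((\<lambda>S. index_minor a (snd (k, S))) has_sum (\<Sum>\<^sub>\<infinity>S\<in>?B k. index_minor a S)) (?B k)"
      by simp
  qed
  then have 1: "(\<Sum>k. \<Sum>\<^sub>\<infinity>S\<in>{S. finite S \<and> card S = k}. index_minor a S) = L"
    by (rule sums_unique[OF has_sum_imp_sums, symmetric])
  \<comment> \<open>summing along initial segments\<close>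
  have "filterlim (\<lambda>n. Pow {..<n}) (finite_subsets_at_top {S :: nat set. finite S}) sequentially"
    unfolding filterlim_finite_subsets_at_top
  proof (intro allI impI)
    fix F :: "nat set set" assume "finite F \<and> F \<subseteq> {S. finite S}"
    then have "finite (\<Union>F)" by auto
    then obtain n where n: "\<Union>F \<subseteq> {..<n}" using finite_nat_iff_bounded by blast
    show "\<forall>\<^sub>F m in sequentially. finite (Pow {..<m}) \<and> F \<subseteq> Pow {..<m} \<and> Pow {..<m} \<subseteq> {S. finite S}"
      using eventually_ge_at_top[of n]
    proof eventually_elim
      case (elim m)
      then have "{..<n} \<subseteq> {..<m}" by auto
      then show ?case using n by (auto intro: finite_subset)
    qed
  qed
  then have lim1: "(\<lambda>n. \<Sum>S\<in>Pow {..<n}. index_minor a S) \<longlonglongrightarrow> L"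
    using hs unfolding has_sum_def by (rule filterlim_compose[rotated])
  have fin: "(\<Sum>S\<in>Pow {..<n}. index_minor a S)
     = Determinant.det (mat N N (\<lambda>(i,j). (if i = j then 1 else 0) + (\<Sum>k<n. x i k * y j k)))" for n
  proof -
    define B where "B = mat n N (\<lambda>(j,k). x k j)"
    define C where "C = mat N n (\<lambda>(k,i). y k i)"
    have "(\<Sum>S\<in>Pow {..<n}. index_minor a S) = Determinant.det (1\<^sub>m n + B * C)"
      unfolding det_one_plus_eq_sum_index_minor[symmetric]
      by (intro arg_cong[where f = Determinant.det] eq_matI)
        (auto simp: B_def C_def a_def scalar_prod_def lessThan_atLeast0)
    also have "\<dots> = Determinant.det (1\<^sub>m N + C * B)"
      by (rule det_one_plus_mult_commute) (auto simp: B_def C_def)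
    also have "\<dots> = Determinant.det (transpose_mat (1\<^sub>m N + C * B))"
      by (rule det_transpose[symmetric, of _ N]) (auto simp: B_def C_def)
    also have "transpose_mat (1\<^sub>m N + C * B)
       = mat N N (\<lambda>(i,j). (if i = j then 1 else 0) + (\<Sum>k<n. x i k * y j k))"
      by (intro eq_matI)
        (auto simp: B_def C_def scalar_prod_def lessThan_atLeast0 mult.commute)
    finally show ?thesis .
  qed
  have lim2: "(\<lambda>n. Determinant.det (mat N N (\<lambda>(i,j). (if i = j then 1 else 0) + (\<Sum>k<n. x i k * y j k))))
    \<longlonglongrightarrow> Determinant.det (mat N N (\<lambda>(i,j). (if i = j then 1 else 0) + G i j))"
  proof -
    have "(\<lambda>n. \<Sum>p | p permutes {0..<N}. of_int (sign p) * 
             (\<Prod>i<N. (if p i = i then 1 else 0) + (\<Sum>k<n. x (p i) k * y i k)))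
      \<longlonglongrightarrow> (\<Sum>p | p permutes {0..<N}. of_int (sign p) * 
             (\<Prod>i<N. (if p i = i then 1 else 0) + G (p i) i))"
      using G unfolding sums_def
      by (intro tendsto_intros) (auto simp: permutes_less)
    moreover have "Determinant.det (mat N N (\<lambda>(i,j). (if i = j then 1 else 0) + H i j))
        = (\<Sum>p | p permutes {0..<N}. of_int (sign p) * (\<Prod>i<N. (if p i = i then 1 else 0) + H (p i) i))"
      for H :: "nat \<Rightarrow> nat \<Rightarrow> complex"
      by (subst det_col[of _ N]) (auto simp: permutes_less intro!: sum.cong prod.cong)
    ultimately show ?thesis by simp
  qed
  show ?thesis
    using LIMSEQ_unique[OF lim1[unfolded fin] lim2] 1 by (rule trans[rotated])
qed

section \<open>The Hilbert space \<open>L\<^sup>2(S\<^sup>1)\<close>\<close>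

lemma space_circle_measure: "space circle_measure = sphere 0 1"
  by (simp add: circle_measure_def space_restrict_space)

lemma sets_circle_measure: "sets circle_measure = sets (restrict_space borel (sphere 0 1))"
  by (simp add: circle_measure_def)

lemma measurable_cis_circle:
  "cis \<in> measurable (uniform_measure lborel {-pi..pi}) (restrict_space borel (sphere 0 1))"
proof (rule measurable_restrict_space2)
  show "cis \<in> borel_measurable (uniform_measure lborel {-pi..pi})"
    unfolding measurable_cong_sets[OF trans[OF sets_uniform_measure sets_lborel] refl]
    by (intro borel_measurable_continuous_onI continuous_intros)
qed auto

lemma emeasure_circle_measure: "emeasure circle_measure (space circle_measure) = 1"
proof -
  let ?M = "uniform_measure lborel {-pi..pi}" and ?N = "restrict_space borel (sphere 0 (1::real)) :: complex measure"
  have "cis -` space ?N \<inter> space ?M = space ?M"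
    using measurable_space[OF measurable_cis_circle] by auto
  then have "emeasure circle_measure (space circle_measure) = emeasure ?M (space ?M)"
    unfolding circle_measure_def space_distr emeasure_distr[OF measurable_cis_circle sets.top] by simp
  also have "\<dots> = ennreal (2 * pi) / ennreal (2 * pi)"
    by (subst emeasure_uniform_measure) auto
  also have "\<dots> = 1"
    by (subst divide_ennreal) auto
  finally show ?thesis .
qed

lemma borel_measurable_circle:
  "continuous_on (sphere 0 1) f \<Longrightarrow> f \<in> borel_measurable circle_measure" for f :: "complex \<Rightarrow> complex"
  using borel_measurable_continuous_on_restrict measurable_cong_sets[OF sets_circle_measure refl] by blast

text \<open>The normalised arc length is a push-forward; in the angle it has density \<open>1 / 2\<pi>\<close>.\<close>

lemma integral_circle_measure:
  fixes f :: "complex \<Rightarrow> complex"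
  assumes "f \<in> borel_measurable circle_measure"
  shows "(LINT z|circle_measure. f z) = (LINT t|lborel. indicator {-pi..pi} t *\<^sub>R (f (cis t) / (2 * pi)))"
proof -
  have f: "f \<in> borel_measurable (restrict_space borel (sphere 0 1))"
    using assms measurable_cong_sets[OF sets_circle_measure refl] by blast
  have fc: "(\<lambda>t. f (cis t)) \<in> borel_measurable lborel"
    using measurable_compose[OF measurable_cis_circle f] by simp
  have "uniform_measure lborel {-pi..pi} = density lborel (\<lambda>t. ennreal (indicator {-pi..pi} t / (2 * pi)))"
    unfolding uniform_measure_def
  proof (rule arg_cong[where f = "density lborel"], rule ext)
    fix t :: real
    have "emeasure lborel {-pi..pi} = ennreal (2 * pi)" by simp
    then show "indicator {-pi..pi} t / emeasure lborel {-pi..pi} = ennreal (indicator {-pi..pi} t / (2 * pi))"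
      by (auto simp: indicator_def divide_ennreal[of 1 "2*pi", simplified])
  qed
  then have "(LINT z|circle_measure. f z) 
     = (LINT t|density lborel (\<lambda>t. ennreal (indicator {-pi..pi} t / (2 * pi))). f (cis t))"
    using integral_distr[OF measurable_cis_circle f] unfolding circle_measure_def by simp
  also have "\<dots> = (LINT t|lborel. (indicator {-pi..pi} t / (2 * pi)) *\<^sub>R f (cis t))"
    using fc by (intro integral_density) auto
  also have "\<dots> = (LINT t|lborel. indicator {-pi..pi} t *\<^sub>R (f (cis t) / (2 * pi)))"
    by (rule Bochner_Integration.integral_cong) (auto simp: indicator_def scaleR_conv_of_real)
  finally show ?thesis .
qed

lemma integral_circle_power:
  "(LINT z|circle_measure. z ^ n) = (if n = 0 then 1 else 0)"
proof (cases "n = 0")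
  case True
  then show ?thesis using emeasure_circle_measure by (simp add: measure_def)
next
  case False
  have "(LINT z|circle_measure. z ^ n) = (LINT t|lborel. indicator {-pi..pi} t *\<^sub>R (cis (n * t) / (2 * pi)))"
    unfolding Complex.DeMoivre[symmetric]
    by (subst integral_circle_measure) (auto intro!: borel_measurable_circle continuous_intros)
  also have "\<dots> = cis (n * pi) / (2 * pi * (\<i> * n)) - cis (n * - pi) / (2 * pi * (\<i> * n))"
  proof (rule integral_FTC_Icc)
    fix t :: real
    show "((\<lambda>t. cis (n * t) / (2 * pi * (\<i> * n))) has_vector_derivative cis (n * t) / (2 * pi)) (at t within {-pi..pi})"
    proof -
      have "((\<lambda>z. exp (\<i> * (n * z)) / (2 * pi * (\<i> * n))) has_field_derivative
             exp (\<i> * (n * t)) / (2 * pi)) (at (of_real t))"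
        using False by (auto intro!: derivative_eq_intros simp: field_simps)
      from has_vector_derivative_real_field[OF this] show ?thesis
        by (simp add: cis_conv_exp)
    qed
  next
    show "continuous_on {-pi..pi} (\<lambda>t. cis (n * t) / (2 * pi))"
      by (intro continuous_intros) auto
  qed simp
  also have "cis (n * pi) = cis (n * - pi)"
  proof -
    have "cis pi = cis (- pi)" by (simp add: complex_eq_iff)
    then show ?thesis unfolding Complex.DeMoivre[symmetric] by (rule arg_cong)
  qed
  finally show ?thesis using False by simp
qed

lemma square_integrable_continuous:
  assumes "continuous_on (sphere 0 1) f"
  shows "square_integrable f"
  unfolding square_integrable_def
proof
  interpret finite_measure circle_measure
    by (rule finite_measureI) (simp add: emeasure_circle_measure)
  show f: "f \<in> borel_measurable circle_measure" by (rule borel_measurable_circle[OF assms])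
  have "bounded (f ` sphere 0 1)"
    by (intro compact_imp_bounded compact_continuous_image assms) auto
  then obtain B where "\<forall>z\<in>sphere 0 1. cmod (f z) \<le> B"
    by (auto simp: bounded_iff)
  then have B: "\<And>z. cmod z = 1 \<Longrightarrow> cmod (f z) \<le> B" by auto
  show "integrable circle_measure (\<lambda>z. (cmod (f z))\<^sup>2)"
  proof (rule integrable_const_bound[where B = "B\<^sup>2"])
    show "AE z in circle_measure. norm ((cmod (f z))\<^sup>2) \<le> B\<^sup>2"
      using B by (intro AE_I2) (auto simp: space_circle_measure intro!: power_mono)
  qed (use f in measurable)
qed

lemma square_integrable_mult_continuous:
  assumes \<phi>: "continuous_on (sphere 0 1) \<phi>" and f: "square_integrable f"
  shows "square_integrable (\<lambda>z. \<phi> z * f z)"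
  unfolding square_integrable_def
proof
  have [measurable]: "f \<in> borel_measurable circle_measure" "\<phi> \<in> borel_measurable circle_measure"
    using f borel_measurable_circle[OF \<phi>] by (auto simp: square_integrable_def)
  show "(\<lambda>z. \<phi> z * f z) \<in> borel_measurable circle_measure" by measurable
  have "bounded (\<phi> ` sphere 0 1)"
    by (intro compact_imp_bounded compact_continuous_image assms) auto
  then obtain B where "\<forall>z\<in>sphere 0 1. cmod (\<phi> z) \<le> B"
    by (auto simp: bounded_iff)
  then have B: "\<And>z. cmod z = 1 \<Longrightarrow> cmod (\<phi> z) \<le> B" by auto
  show "integrable circle_measure (\<lambda>z. (cmod (\<phi> z * f z))\<^sup>2)"
  proof (rule Bochner_Integration.integrable_bound)
    show "integrable circle_measure (\<lambda>z. B\<^sup>2 * (cmod (f z))\<^sup>2)"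
      using f by (auto simp: square_integrable_def)
    show "AE z in circle_measure. norm ((cmod (\<phi> z * f z))\<^sup>2) \<le> norm (B\<^sup>2 * (cmod (f z))\<^sup>2)"
      using B by (intro AE_I2)
       (auto simp: space_circle_measure norm_mult power_mult_distrib intro!: mult_right_mono power_mono)
  qed measurable
qed

lemma square_integrable_rep: "square_integrable (rep_L2 f)"
  using Quotient3_rep_reflp[OF Quotient3_L2, of f] by (simp add: L2_rel_def)

lemma abs_rep_L2: "abs_L2 (rep_L2 f) = f"
  by (rule Quotient3_abs_rep[OF Quotient3_L2])

lemma abs_L2_eqI:
  "square_integrable f \<Longrightarrow> square_integrable g \<Longrightarrow> AE z in circle_measure. f z = g z \<Longrightarrow> abs_L2 f = abs_L2 g"
  by (rule Quotient3_rel_abs[OF Quotient3_L2]) (simp add: L2_rel_def)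

lemma AE_rep_abs:
  assumes "square_integrable f"
  shows "AE z in circle_measure. rep_L2 (abs_L2 f) z = f z"
proof -
  have "L2_rel (rep_L2 (abs_L2 f)) f"
    by (rule rep_abs_rsp_left[OF Quotient3_L2]) (simp add: L2_rel_def assms)
  then show ?thesis by (simp add: L2_rel_def)
qed

lemma L2_cases: obtains f where "square_integrable f" "x = abs_L2 f"
  using square_integrable_rep abs_rep_L2 by metis

lemma abs_L2_cong:
  "square_integrable f \<Longrightarrow> (\<And>z. cmod z = 1 \<Longrightarrow> f z = g z) \<Longrightarrow> abs_L2 f = abs_L2 g"
proof -
  assume f: "square_integrable f" and fg: "\<And>z. cmod z = 1 \<Longrightarrow> f z = g z"
  have "g \<in> borel_measurable circle_measure \<longleftrightarrow> f \<in> borel_measurable circle_measure"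
    by (rule measurable_cong) (auto simp: space_circle_measure fg)
  moreover have "integrable circle_measure (\<lambda>z. (cmod (g z))\<^sup>2) \<longleftrightarrow> integrable circle_measure (\<lambda>z. (cmod (f z))\<^sup>2)"
    by (rule Bochner_Integration.integrable_cong) (auto simp: space_circle_measure fg)
  ultimately have "square_integrable g"
    using f by (simp add: square_integrable_def)
  with f fg show "abs_L2 f = abs_L2 g"
    by (intro abs_L2_eqI AE_I2) (auto simp: space_circle_measure)
qed

lemma plus_abs_L2: 
  "square_integrable f \<Longrightarrow> square_integrable g \<Longrightarrow> abs_L2 f + abs_L2 g = abs_L2 (\<lambda>z. f z + g z)"
  by (rule plus_L2.abs_eq) (auto simp: L2_rel_def)

lemma minus_abs_L2: 
  "square_integrable f \<Longrightarrow> square_integrable g \<Longrightarrow> abs_L2 f - abs_L2 g = abs_L2 (\<lambda>z. f z - g z)"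
  by (rule minus_L2.abs_eq) (auto simp: L2_rel_def)

lemma scaleC_abs_L2: "square_integrable f \<Longrightarrow> c *\<^sub>C abs_L2 f = abs_L2 (\<lambda>z. c * f z)"
  by (rule scaleC.abs_eq) (auto simp: L2_rel_def)

lemma cinner_abs_L2: 
  "square_integrable f \<Longrightarrow> square_integrable g \<Longrightarrow> 
   cinner (abs_L2 f) (abs_L2 g) = (LINT z|circle_measure. f z * cnj (g z))"
  by (rule cinner.abs_eq) (auto simp: L2_rel_def)

lemma mult_abs_L2:
  assumes "continuous_on (sphere 0 1) \<phi>" "square_integrable f"
  shows "mult_L2 \<phi> (abs_L2 f) = abs_L2 (\<lambda>z. \<phi> z * f z)"
  unfolding mult_L2_def
  by (rule abs_L2_eqI) 
    (use AE_rep_abs[OF assms(2)] assms in \<open>auto intro!: square_integrable_mult_continuous square_integrable_rep\<close>)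

lemma scaleC_add_right: "c *\<^sub>C (x + y) = c *\<^sub>C x + c *\<^sub>C y"
  by transfer (auto simp: L2_rel_def distrib_left intro!: square_integrable_add square_integrable_cmult)

lemma scaleC_add_left: "(c + d) *\<^sub>C x = c *\<^sub>C x + d *\<^sub>C x"
  by transfer (auto simp: L2_rel_def distrib_right intro!: square_integrable_add square_integrable_cmult)

lemma scaleC_scaleC [simp]: "c *\<^sub>C d *\<^sub>C x = (c * d) *\<^sub>C x"
  by transfer (auto simp: L2_rel_def mult.assoc intro!: square_integrable_cmult)

lemma scaleC_one [simp]: "1 *\<^sub>C x = x"
  by transfer (auto simp: L2_rel_def)

lemma scaleC_zero_left [simp]: "0 *\<^sub>C x = 0"
  by transfer (auto simp: L2_rel_def square_integrable_zero)

lemma scaleC_zero_right [simp]: "c *\<^sub>C 0 = 0"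
  by transfer (auto simp: L2_rel_def square_integrable_zero)

lemma scaleC_minus_one: "(-1) *\<^sub>C x = - x"
  by transfer (auto simp: L2_rel_def square_integrable_uminus)

lemma scaleC_minus_left: "(- c) *\<^sub>C x = - (c *\<^sub>C x)"
  using scaleC_minus_one[of "c *\<^sub>C x"] by simp

lemma scaleC_diff_left: "(c - d) *\<^sub>C x = c *\<^sub>C x - d *\<^sub>C x"
  using scaleC_add_left[of c "- d" x] by (simp add: scaleC_minus_left)

lemma cinner_commute: "cinner f g = cnj (cinner g f)"
  by transfer (simp flip: Bochner_Integration.integral_cnj add: mult.commute)

lemma cinner_add_left: "cinner (f + g) h = cinner f h + cinner g h"
  by transfer (auto simp: L2_rel_def distrib_right integrable_mult_cnj
      intro!: Bochner_Integration.integral_add)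

lemma cinner_scaleC_left: "cinner (c *\<^sub>C f) g = c * cinner f g"
  by transfer (simp add: mult.assoc)

lemma cinner_add_right: "cinner h (f + g) = cinner h f + cinner h g"
  by (metis cinner_commute cinner_add_left complex_cnj_add)

lemma cinner_scaleC_right: "cinner f (c *\<^sub>C g) = cnj c * cinner f g"
  by (metis cinner_commute cinner_scaleC_left complex_cnj_mult)

lemma cinner_zero_left [simp]: "cinner 0 f = 0"
  using cinner_scaleC_left[of 0 0 f] by simp

lemma cinner_zero_right [simp]: "cinner f 0 = 0"
  using cinner_scaleC_right[of f 0 0] by simp

lemma cinner_minus_left: "cinner (- f) g = - cinner f g"
  using cinner_scaleC_left[of "-1" f g] by (simp add: scaleC_minus_one)

lemma cinner_minus_right: "cinner g (- f) = - cinner g f"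
  using cinner_scaleC_right[of g "-1" f] by (simp add: scaleC_minus_one)

lemma cinner_diff_left: "cinner (f - g) h = cinner f h - cinner g h"
  using cinner_add_left[of f "- g" h] by (simp add: cinner_minus_left)

lemma cinner_sum_left: "cinner (sum f A) g = (\<Sum>i\<in>A. cinner (f i) g)"
  by (induction A rule: infinite_finite_induct) (auto simp: cinner_add_left)

lemma scaleC_sum_right: "c *\<^sub>C sum f A = (\<Sum>i\<in>A. c *\<^sub>C f i)"
  by (induction A rule: infinite_finite_induct) (auto simp: scaleC_add_right)

lemma cinner_self: "cinner f f = of_real ((norm f)\<^sup>2)"
proof -
  have "Im (cinner f f) = 0"
    using cinner_commute[of f f] by (simp add: complex_eq_iff)
  moreover have "Re (cinner f f) = (norm f)\<^sup>2"
    by (simp add: norm_L2_def inner_L2_def[symmetric])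
  ultimately show ?thesis by (simp add: complex_eq_iff)
qed

lemma cinner_self_eq_0: "cinner f f = 0 \<Longrightarrow> f = 0"
  by (simp add: cinner_self)

lemma norm_scaleC [simp]: "norm (c *\<^sub>C f) = cmod c * norm f"
proof -
  have "complex_of_real ((norm (c *\<^sub>C f))\<^sup>2) = (c * cnj c) * of_real ((norm f)\<^sup>2)"
    unfolding cinner_self[symmetric] cinner_scaleC_left cinner_scaleC_right by simp
  also have "\<dots> = of_real ((cmod c * norm f)\<^sup>2)"
    unfolding complex_norm_square[symmetric] power_mult_distrib of_real_mult ..
  finally have "complex_of_real ((norm (c *\<^sub>C f))\<^sup>2) = of_real ((cmod c * norm f)\<^sup>2)" .
  then have "(norm (c *\<^sub>C f))\<^sup>2 = (cmod c * norm f)\<^sup>2"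
    unfolding of_real_eq_iff .
  then show ?thesis by simp
qed

lemma cinner_Cauchy_Schwarz: "cmod (cinner f g) \<le> norm f * norm g"
proof (cases "cinner f g = 0")
  case False
  define c where "c = cnj (sgn (cinner f g))"
  have c: "cmod c = 1" using False by (simp add: c_def norm_sgn)
  have "cinner (c *\<^sub>C f) g = cmod (cinner f g)"
    using complex_norm_square[of "cinner f g"] False
    by (simp add: c_def cinner_scaleC_left sgn_div_norm scaleR_conv_of_real power2_eq_square field_simps)
  then have "cmod (cinner f g) = inner (c *\<^sub>C f) g"
    by (simp add: inner_L2_def)
  also have "\<dots> \<le> norm (c *\<^sub>C f) * norm g" by (rule norm_cauchy_schwarz)
  finally show ?thesis by (simp add: c)
qed auto

lemma scaleR_L2_conv: "r *\<^sub>R f = complex_of_real r *\<^sub>C (f :: L2)"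
  by (simp add: scaleR_L2_def)

lemma bounded_linear_cinner_left: "bounded_linear (\<lambda>f. cinner f g)"
  by (rule bounded_linear_intro[where K = "norm g"])
    (auto simp: cinner_add_left scaleR_L2_conv cinner_scaleC_left scaleR_conv_of_real cinner_Cauchy_Schwarz)

lemma bounded_linear_cinner_right: "bounded_linear (\<lambda>f. cinner g f)"
  using cinner_Cauchy_Schwarz[of g] by (intro bounded_linear_intro[where K = "norm g"])
    (auto simp: cinner_add_right scaleR_L2_conv cinner_scaleC_right scaleR_conv_of_real mult.commute)

lemma bounded_linear_scaleC: "bounded_linear (\<lambda>f. c *\<^sub>C f)"
  by (rule bounded_linear_intro[where K = "cmod c"])
    (auto simp: scaleC_add_right scaleR_L2_conv mult.commute)

lemma bounded_linear_scaleC_left: "bounded_linear (\<lambda>c. c *\<^sub>C f)"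
  by (rule bounded_linear_intro[where K = "norm f"])
    (auto simp: scaleC_add_left scaleR_L2_conv scaleR_conv_of_real)

lemma mult_L2_add: 
  assumes \<phi>: "continuous_on (sphere 0 1) \<phi>"
  shows "mult_L2 \<phi> (x + y) = mult_L2 \<phi> x + mult_L2 \<phi> y"
proof -
  obtain f where [simp]: "square_integrable f" "x = abs_L2 f" by (rule L2_cases)
  obtain g where [simp]: "square_integrable g" "y = abs_L2 g" by (rule L2_cases)
  show ?thesis
    by (simp add: \<phi> mult_abs_L2 plus_abs_L2 square_integrable_mult_continuous square_integrable_add distrib_left)
qed

lemma mult_L2_scaleC: 
  assumes \<phi>: "continuous_on (sphere 0 1) \<phi>"
  shows "mult_L2 \<phi> (c *\<^sub>C x) = c *\<^sub>C mult_L2 \<phi> x"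
proof -
  obtain f where [simp]: "square_integrable f" "x = abs_L2 f" by (rule L2_cases)
  show ?thesis
    by (simp add: \<phi> mult_abs_L2 scaleC_abs_L2 square_integrable_mult_continuous square_integrable_cmult mult_ac)
qed

lemma mult_L2_mult: 
  assumes \<phi>: "continuous_on (sphere 0 1) \<phi>" and \<psi>: "continuous_on (sphere 0 1) \<psi>"
  shows "mult_L2 \<phi> (mult_L2 \<psi> x) = mult_L2 (\<lambda>z. \<phi> z * \<psi> z) x"
proof -
  obtain f where [simp]: "square_integrable f" "x = abs_L2 f" by (rule L2_cases)
  show ?thesis
    by (simp add: \<phi> \<psi> mult_abs_L2 square_integrable_mult_continuous mult_ac continuous_on_mult)
qed

lemma mult_L2_cong:
  assumes \<phi>: "continuous_on (sphere 0 1) \<phi>" and eq: "\<And>z. cmod z = 1 \<Longrightarrow> \<phi> z = \<psi> z"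
  shows "mult_L2 \<phi> = mult_L2 \<psi>"
proof
  fix x
  show "mult_L2 \<phi> x = mult_L2 \<psi> x"
    unfolding mult_L2_def
    by (rule abs_L2_cong) (auto simp: eq intro!: square_integrable_mult_continuous \<phi> square_integrable_rep)
qed

lemma mult_L2_one: "(\<And>z. cmod z = 1 \<Longrightarrow> \<phi> z = 1) \<Longrightarrow> mult_L2 \<phi> x = x"
proof -
  assume 1: "\<And>z. cmod z = 1 \<Longrightarrow> \<phi> z = 1"
  have "mult_L2 \<phi> = mult_L2 (\<lambda>_. 1)"
    by (rule mult_L2_cong[symmetric]) (auto simp: 1)
  then show "mult_L2 \<phi> x = x" by (simp add: mult_L2_def abs_rep_L2)
qed

lemma cinner_mult_L2:
  assumes \<phi>: "continuous_on (sphere 0 1) \<phi>"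
  shows "cinner (mult_L2 \<phi> x) y = cinner x (mult_L2 (\<lambda>z. cnj (\<phi> z)) y)"
proof -
  obtain f where [simp]: "square_integrable f" "x = abs_L2 f" by (rule L2_cases)
  obtain g where [simp]: "square_integrable g" "y = abs_L2 g" by (rule L2_cases)
  have "continuous_on (sphere 0 1) (\<lambda>z. cnj (\<phi> z))" by (intro continuous_intros \<phi>)
  then have "cinner x (mult_L2 (\<lambda>z. cnj (\<phi> z)) y) = (LINT z|circle_measure. f z * cnj (cnj (\<phi> z) * g z))"
    by (simp add: mult_abs_L2 cinner_abs_L2 square_integrable_mult_continuous)
  moreover have "cinner (mult_L2 \<phi> x) y = (LINT z|circle_measure. \<phi> z * f z * cnj (g z))"
    by (simp add: \<phi> mult_abs_L2 cinner_abs_L2 square_integrable_mult_continuous)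
  ultimately show ?thesis by (simp add: mult_ac)
qed

lemma norm_mult_L2_le:
  assumes \<phi>: "continuous_on (sphere 0 1) \<phi>" and B: "\<And>z. cmod z = 1 \<Longrightarrow> cmod (\<phi> z) \<le> B"
  shows "norm (mult_L2 \<phi> x) \<le> norm x * B"
proof -
  have B0: "0 \<le> B" using B[of 1] norm_ge_zero[of "\<phi> 1"] by (simp del: norm_ge_zero)
  have normsq: "(norm (abs_L2 f))\<^sup>2 = (LINT z|circle_measure. (cmod (f z))\<^sup>2)" if "square_integrable f" for f
  proof -
    have "complex_of_real ((norm (abs_L2 f))\<^sup>2) = (LINT z|circle_measure. of_real ((cmod (f z))\<^sup>2))"
      unfolding cinner_self[symmetric] cinner_abs_L2[OF that that] complex_norm_square ..
    then show ?thesis unfolding integral_complex_of_real of_real_eq_iff .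
  qed
  obtain f where f [simp]: "square_integrable f" "x = abs_L2 f" by (rule L2_cases)
  have "(norm (mult_L2 \<phi> x))\<^sup>2 = (LINT z|circle_measure. (cmod (\<phi> z * f z))\<^sup>2)"
    by (simp add: \<phi> mult_abs_L2 normsq square_integrable_mult_continuous)
  also have "\<dots> \<le> (LINT z|circle_measure. B\<^sup>2 * (cmod (f z))\<^sup>2)"
    using B f(1) square_integrable_mult_continuous[OF \<phi> f(1)]
    by (intro integral_mono) 
      (auto simp: space_circle_measure square_integrable_def norm_mult power_mult_distrib
        intro!: mult_right_mono power_mono)
  also have "\<dots> = (norm x * B)\<^sup>2"
    by (simp add: normsq power_mult_distrib)
  finally show ?thesis
    by (rule power2_le_imp_le) (simp add: B0)
qed

lemma bounded_linear_mult_L2: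
  assumes \<phi>: "continuous_on (sphere 0 1) \<phi>"
  shows "bounded_linear (mult_L2 \<phi>)"
proof -
  have "bounded (\<phi> ` sphere 0 1)"
    by (intro compact_imp_bounded compact_continuous_image assms) auto
  then obtain B where "\<forall>z\<in>sphere 0 1. cmod (\<phi> z) \<le> B"
    by (auto simp: bounded_iff)
  then show ?thesis
    by (intro bounded_linear_intro[where K = B])
      (auto simp: mult_L2_add \<phi> mult_L2_scaleC scaleR_L2_conv intro!: norm_mult_L2_le)
qed

lemma mult_L2_diff: 
  "continuous_on (sphere 0 1) \<phi> \<Longrightarrow> mult_L2 \<phi> (x - y) = mult_L2 \<phi> x - mult_L2 \<phi> y"
  by (rule linear_diff[OF bounded_linear.linear[OF bounded_linear_mult_L2]])

lemma mult_monomial: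
  "continuous_on (sphere 0 1) \<phi> \<Longrightarrow> mult_L2 \<phi> (monomial_L2 k) = abs_L2 (\<lambda>z. \<phi> z * z ^ k)"
  unfolding monomial_L2_def by (intro mult_abs_L2 square_integrable_continuous continuous_intros)

text \<open>On the circle \<open>cnj (z\<^sup>k)\<close> is the inverse of \<open>z\<^sup>k\<close>, so everything reduces to the integrals of
  powers of \<open>z\<close>.\<close>

lemma cinner_monomial: "cinner (monomial_L2 j) (monomial_L2 k) = (if j = k then 1 else 0)"
proof -
  have *: "cinner (monomial_L2 j) (monomial_L2 k) = (if j = k then 1 else 0)" if "k \<le> j" for j k
  proof -
    have "cinner (monomial_L2 j) (monomial_L2 k) = (LINT z|circle_measure. z ^ j * cnj (z ^ k))"
      unfolding monomial_L2_def
      by (intro cinner_abs_L2 square_integrable_continuous continuous_intros)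
    also have "\<dots> = (LINT z|circle_measure. z ^ (j - k))"
    proof (rule Bochner_Integration.integral_cong[OF refl])
      fix z assume "z \<in> space circle_measure"
      then have "cmod (z ^ k) = 1" by (simp add: space_circle_measure norm_power)
      then have "z ^ k * cnj (z ^ k) = 1" using complex_norm_square[of "z ^ k"] by simp
      then show "z ^ j * cnj (z ^ k) = z ^ (j - k)"
        using that by (metis le_add_diff_inverse2 mult.assoc mult.right_neutral power_add)
    qed
    finally show ?thesis using that by (simp add: integral_circle_power)
  qed
  show ?thesis
  proof (cases "k \<le> j")
    case False
    then show ?thesis using *[of j k] by (subst cinner_commute) simp
  qed (rule *)
qed

section \<open>The Hardy space\<close>

definition polys :: "L2 set" where
  "polys = {\<Sum>k<n. c k *\<^sub>C monomial_L2 k | n c. True}"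

lemma polysI: "(\<Sum>k<n. c k *\<^sub>C monomial_L2 k) \<in> polys"
  unfolding polys_def by blast

lemma hardy_eq: "hardy = closure polys"
  by (simp add: hardy_def polys_def)

lemma closed_hardy: "closed hardy"
  by (simp add: hardy_eq)

lemma polys_add: "f \<in> polys \<Longrightarrow> g \<in> polys \<Longrightarrow> f + g \<in> polys"
proof -
  assume "f \<in> polys" "g \<in> polys"
  then obtain n c m d where f: "f = (\<Sum>k<n. c k *\<^sub>C monomial_L2 k)" and g: "g = (\<Sum>k<m. d k *\<^sub>C monomial_L2 k)"
    by (auto simp: polys_def)
  have pad: "(\<Sum>k<n. c k *\<^sub>C monomial_L2 k) = (\<Sum>k<max n m. (if k < n then c k else 0) *\<^sub>C monomial_L2 k)"
    for n m c
    by (rule sum.mono_neutral_cong_left) auto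
  have h: "f + g = (\<Sum>k<max n m. ((if k < n then c k else 0) + (if k < m then d k else 0)) *\<^sub>C monomial_L2 k)"
    unfolding f g pad[of c n m] pad[of d m n] max.commute[of m n]
    by (simp add: scaleC_add_left sum.distrib)
  show "f + g \<in> polys" unfolding h by (rule polysI)
qed

lemma polys_scaleC: "f \<in> polys \<Longrightarrow> a *\<^sub>C f \<in> polys"
proof -
  assume "f \<in> polys"
  then obtain n c where f: "f = (\<Sum>k<n. c k *\<^sub>C monomial_L2 k)" by (auto simp: polys_def)
  have h: "a *\<^sub>C f = (\<Sum>k<n. (a * c k) *\<^sub>C monomial_L2 k)"
    by (simp add: f scaleC_sum_right)
  show "a *\<^sub>C f \<in> polys" unfolding h by (rule polysI)
qed

lemma polys_subset_hardy: "polys \<subseteq> hardy"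
  by (simp add: hardy_eq closure_subset)

lemma monomial_in_polys: "monomial_L2 k \<in> polys"
proof -
  have h: "monomial_L2 k = (\<Sum>j<Suc k. (if j = k then 1 else 0) *\<^sub>C monomial_L2 j)"
    by (simp add: if_distrib[of "\<lambda>c. c *\<^sub>C _"] cong: if_cong)
  show ?thesis by (subst h) (rule polysI)
qed

lemma monomial_in_hardy [simp]: "monomial_L2 k \<in> hardy"
  using monomial_in_polys polys_subset_hardy by blast

lemma hardy_add:
  assumes "f \<in> hardy" "g \<in> hardy"
  shows "f + g \<in> hardy"
proof -
  obtain a b where "\<And>n::nat. a n \<in> polys" "a \<longlonglongrightarrow> f" "\<And>n. b n \<in> polys" "b \<longlonglongrightarrow> g"
    using assms unfolding hardy_eq closure_sequential by auto
  then have "(\<forall>n. a n + b n \<in> polys) \<and> (\<lambda>n. a n + b n) \<longlonglongrightarrow> f + g"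
    by (auto intro: polys_add tendsto_add)
  then show ?thesis unfolding hardy_eq closure_sequential by (intro exI)
qed

lemma hardy_scaleC:
  assumes "f \<in> hardy"
  shows "c *\<^sub>C f \<in> hardy"
proof -
  obtain a where "\<And>n::nat. a n \<in> polys" "a \<longlonglongrightarrow> f"
    using assms unfolding hardy_eq closure_sequential by auto
  then have "(\<forall>n. c *\<^sub>C a n \<in> polys) \<and> (\<lambda>n. c *\<^sub>C a n) \<longlonglongrightarrow> c *\<^sub>C f"
    by (auto intro: polys_scaleC bounded_linear.tendsto[OF bounded_linear_scaleC])
  then show ?thesis unfolding hardy_eq closure_sequential by (intro exI)
qed

lemma hardy_zero [simp]: "0 \<in> hardy"
  using hardy_scaleC[of "monomial_L2 0" 0] by simp

lemma hardy_uminus: "f \<in> hardy \<Longrightarrow> - f \<in> hardy"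
  using hardy_scaleC[of f "-1"] by (simp add: scaleC_minus_one)

lemma hardy_diff: "f \<in> hardy \<Longrightarrow> g \<in> hardy \<Longrightarrow> f - g \<in> hardy"
  using hardy_add[of f "- g"] hardy_uminus by simp

lemma hardy_sum: "(\<And>i. i \<in> A \<Longrightarrow> f i \<in> hardy) \<Longrightarrow> sum f A \<in> hardy"
  by (induction A rule: infinite_finite_induct) (auto intro: hardy_add)

text \<open>The working principle for the Hardy space: closed linear properties need only be checked on the
  monomials.\<close>

lemma hardy_induct [consumes 1, case_names closed zero add scaleC monomial]:
  assumes f: "f \<in> hardy"
    and closed: "closed {f. P f}" and zero: "P 0"
    and add: "\<And>f g. P f \<Longrightarrow> P g \<Longrightarrow> P (f + g)"
    and scaleC: "\<And>c f. P f \<Longrightarrow> P (c *\<^sub>C f)"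
    and monomial: "\<And>k. P (monomial_L2 k)"
  shows "P f"
proof -
  have "polys \<subseteq> {f. P f}"
  proof
    fix g assume "g \<in> polys"
    then obtain n c where g: "g = (\<Sum>k<n. c k *\<^sub>C monomial_L2 k)" by (auto simp: polys_def)
    have "P (\<Sum>k<n. c k *\<^sub>C monomial_L2 k)"
      by (induction n) (auto intro: zero add scaleC monomial)
    then show "g \<in> {f. P f}" by (simp add: g)
  qed
  then have "hardy \<subseteq> {f. P f}" unfolding hardy_eq by (rule closure_minimal[OF _ closed])
  then show ?thesis using f by blast
qed

lemma orthogonal_hardyI:
  assumes "\<And>k. cinner d (monomial_L2 k) = 0" and "h \<in> hardy"
  shows "cinner d h = 0"
  using assms(2)
proof (induction rule: hardy_induct)
  case closed
  show ?case
    by (intro closed_Collect_eq continuous_on_const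
        linear_continuous_on[OF bounded_linear_cinner_right])
qed (auto simp: cinner_add_right cinner_scaleC_right assms(1))

lemma cinner_partial_sum:
  "cinner (\<Sum>j<n. c j *\<^sub>C monomial_L2 j) (monomial_L2 k) = (if k < n then c k else 0)"
  by (simp add: cinner_sum_left cinner_scaleC_left cinner_monomial if_distrib cong: if_cong)

lemma norm_partial_sum_le:
  "norm (\<Sum>j<n. cinner y (monomial_L2 j) *\<^sub>C monomial_L2 j) \<le> norm y"
proof -
  let ?s = "\<Sum>j<n. cinner y (monomial_L2 j) *\<^sub>C monomial_L2 j"
  have 1: "cinner ?s ?s = (\<Sum>j<n. cinner y (monomial_L2 j) * cnj (cinner y (monomial_L2 j)))"
    by (subst cinner_sum_left, rule sum.cong)
       (auto simp: cinner_scaleC_left cinner_partial_sum cinner_commute[of "monomial_L2 _" ?s])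
  have 2: "cinner ?s y = (\<Sum>j<n. cinner y (monomial_L2 j) * cnj (cinner y (monomial_L2 j)))"
    by (subst cinner_sum_left, rule sum.cong)
       (auto simp: cinner_scaleC_left cinner_commute[of "monomial_L2 _" y])
  have "complex_of_real ((norm ?s)\<^sup>2) = cinner ?s y"
    unfolding cinner_self[symmetric] 1 2 ..
  then have "(norm ?s)\<^sup>2 = cmod (cinner ?s y)"
    by (metis abs_power2 norm_of_real)
  also have "\<dots> \<le> norm ?s * norm y" by (rule cinner_Cauchy_Schwarz)
  finally show ?thesis
    by (cases "norm ?s = 0") (auto simp: power2_eq_square)
qed

text \<open>Polynomials are reproduced by their partial sums, polynomials are dense, and partial sums do not
  increase the norm.\<close>

lemma hardy_monomial_sums:
  assumes "y \<in> hardy"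
  shows "(\<lambda>j. cinner y (monomial_L2 j) *\<^sub>C monomial_L2 j) sums y"
  unfolding sums_def
proof (rule LIMSEQ_I)
  fix e :: real assume e: "0 < e"
  let ?s = "\<lambda>y n. \<Sum>j<n. cinner y (monomial_L2 j) *\<^sub>C monomial_L2 j"
  from assms e obtain p where p: "p \<in> polys" "dist p y < e / 2"
    unfolding hardy_eq closure_approachable by (auto dest!: spec[of _ "e / 2"])
  then obtain m c where pc: "p = (\<Sum>k<m. c k *\<^sub>C monomial_L2 k)" by (auto simp: polys_def)
  have "norm (?s y n - y) < e" if "n \<ge> m" for n
  proof -
    have "?s p n = p"
      unfolding pc cinner_partial_sum using that
      by (intro sum.mono_neutral_cong_right) auto
    then have "?s y n - y = ?s (y - p) n + (p - y)"
      by (simp add: cinner_diff_left scaleC_diff_left sum_subtractf)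
    also have "norm \<dots> \<le> norm (y - p) + norm (p - y)"
      by (rule norm_triangle_mono[OF norm_partial_sum_le order_refl])
    also have "\<dots> < e" using p(2) by (simp add: dist_norm norm_minus_commute)
    finally show ?thesis .
  qed
  then show "\<exists>N. \<forall>n\<ge>N. norm (?s y n - y) < e" by blast
qed

lemma Parseval_hardy:
  assumes "y \<in> hardy"
  shows "(\<lambda>j. cinner (monomial_L2 j) x * cinner y (monomial_L2 j)) sums cinner y x"
  using bounded_linear.sums[OF bounded_linear_cinner_left hardy_monomial_sums[OF assms], of x]
  by (simp add: cinner_scaleC_left mult.commute)

lemma summable_coeffs_hardy:
  assumes "y \<in> hardy"
  shows "summable (\<lambda>j. (cmod (cinner y (monomial_L2 j)))\<^sup>2)"
proof -
  have "(\<lambda>j. complex_of_real ((cmod (cinner y (monomial_L2 j)))\<^sup>2)) sums of_real ((norm y)\<^sup>2)"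
    using Parseval_hardy[OF assms, of y]
    unfolding complex_norm_square cinner_self[symmetric]
    by (simp add: cinner_commute[of "monomial_L2 _" y] mult.commute)
  then show ?thesis
    unfolding sums_of_real_iff by (rule sums_summable)
qed

text \<open>As a relation, so that the existence of a projection is a separate
  question. For the symbols that occur it is answered by explicit formulas.\<close>

definition is_proj :: "L2 \<Rightarrow> L2 \<Rightarrow> bool" where
  "is_proj f g \<longleftrightarrow> g \<in> hardy \<and> (\<forall>h\<in>hardy. cinner (f - g) h = 0)"

lemma orth_proj_eqI:
  assumes "is_proj f g"
  shows "orth_proj hardy f = g"
  unfolding orth_proj_def
proof (rule the_equality)
  fix g' assume g': "g' \<in> hardy \<and> (\<forall>h\<in>hardy. cinner (f - g') h = 0)"
  have "g' - g \<in> hardy" using g' assms by (auto simp: is_proj_def intro: hardy_diff)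
  then have "cinner (f - g) (g' - g) - cinner (f - g') (g' - g) = 0"
    using g' assms by (simp add: is_proj_def)
  then have "cinner (g' - g) (g' - g) = 0"
    by (simp add: cinner_diff_left)
  then show "g' = g" using cinner_self_eq_0 by fastforce
qed (use assms in \<open>simp add: is_proj_def\<close>)

section \<open>The Fredholm determinant on the Hardy space\<close>

text \<open>\<open>T\<close> is the identity plus a finite rank operator \<open>\<Sum>\<^sub>n \<langle>-, x\<^sub>n\<rangle> y\<^sub>n\<close>, and \<open>d\<close> is the determinant of the identity plus
  the matrix of inner products. The representation is far from unique, but \<open>d\<close> is determined by \<open>T\<close> since it is
  the Fredholm determinant. This form makes multiplicativity and conjugation invariance statements about
  finite matrices.\<close>

definition has_det :: "(L2 \<Rightarrow> L2) \<Rightarrow> complex \<Rightarrow> bool" where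
  "has_det T d \<longleftrightarrow> (\<exists>N x y. (\<forall>n<N. x n \<in> hardy \<and> y n \<in> hardy) \<and>
     (\<forall>f\<in>hardy. T f = f + (\<Sum>n<N. cinner f (x n) *\<^sub>C y n)) \<and>
     d = Determinant.det (mat N N (\<lambda>(i,j). (if i = j then 1 else 0) + cinner (y j) (x i))))"

lemma has_detI:
  assumes "\<And>n. n < N \<Longrightarrow> x n \<in> hardy" "\<And>n. n < N \<Longrightarrow> y n \<in> hardy"
    and "\<And>f. f \<in> hardy \<Longrightarrow> T f = f + (\<Sum>n<N. cinner f (x n) *\<^sub>C y n)"
    and "d = Determinant.det (mat N N (\<lambda>(i,j). (if i = j then 1 else 0) + cinner (y j) (x i)))"
  shows "has_det T d"
  unfolding has_det_def using assms by blast

text \<open>In the monomial basis the matrix of \<open>T - 1\<close> has finite rank with square summable coefficient vectors,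
  and Parseval's identity evaluates the limit matrix.\<close>

lemma fredholm_det_eqI:
  assumes "has_det T d"
  shows "fredholm_det T = d"
proof -
  obtain N :: nat and x y where x: "\<And>n. n < N \<Longrightarrow> x n \<in> hardy" and y: "\<And>n. n < N \<Longrightarrow> y n \<in> hardy"
    and T: "\<And>f. f \<in> hardy \<Longrightarrow> T f = f + (\<Sum>n<N. cinner f (x n) *\<^sub>C y n)"
    and d: "d = Determinant.det (mat N N (\<lambda>(i,j). (if i = j then 1 else 0) + cinner (y j) (x i)))"
    using assms unfolding has_det_def by blast
  let ?x = "\<lambda>n j. cinner (monomial_L2 j) (x n)"
  let ?y = "\<lambda>n i. cinner (y n) (monomial_L2 i)"
  have "fredholm_det T = (\<Sum>k. \<Sum>\<^sub>\<infinity>S\<in>{S. finite S \<and> card S = k}. 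
      index_minor (\<lambda>j i. \<Sum>n<N. ?x n j * ?y n i) S)"
    unfolding fredholm_det_def exterior_trace_def principal_minor_eq_index_minor
    by (simp add: T cinner_sum_left cinner_scaleC_left)
  also have "\<dots> = d"
    unfolding d
  proof (rule sum_index_minor_finite_rank)
    fix n m assume nm: "n < N" "m < N"
    show "(\<lambda>j. ?x n j * ?y m j) sums cinner (y m) (x n)"
      by (rule Parseval_hardy[OF y[OF nm(2)]])
  next
    fix n assume n: "n < N"
    have "cmod (?x n j) = cmod (cinner (x n) (monomial_L2 j))" for j
      by (subst cinner_commute) simp
    then show "summable (\<lambda>j. (cmod (?x n j))\<^sup>2)"
      using summable_coeffs_hardy[OF x[OF n]] by simp
    show "summable (\<lambda>j. (cmod (?y n j))\<^sup>2)"
      by (rule summable_coeffs_hardy[OF y[OF n]])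
  qed
  finally show ?thesis .
qed

lemma has_det_imp_trace_class:
  assumes "has_det T d"
  shows "trace_class_on hardy (\<lambda>f. T f - f)"
proof -
  obtain N :: nat and x y where x: "\<And>n. n < N \<Longrightarrow> x n \<in> hardy" and y: "\<And>n. n < N \<Longrightarrow> y n \<in> hardy"
    and T: "\<And>f. f \<in> hardy \<Longrightarrow> T f = f + (\<Sum>n<N. cinner f (x n) *\<^sub>C y n)"
    using assms unfolding has_det_def by blast
  let ?x = "\<lambda>n. if n < N then x n else 0" and ?y = "\<lambda>n. if n < N then y n else 0"
  have "summable (\<lambda>n. norm (?x n) * norm (?y n))"
    by (rule summable_finite[of "{..<N}"]) auto
  moreover have "(\<lambda>n. cinner f (?x n) *\<^sub>C ?y n) sums (T f - f)" if "f \<in> hardy" for f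
  proof -
    have "(\<lambda>n. cinner f (?x n) *\<^sub>C ?y n) sums (\<Sum>n<N. cinner f (?x n) *\<^sub>C ?y n)"
      by (rule sums_finite) auto
    then show ?thesis using T[OF that] by simp
  qed
  moreover have "range ?x \<subseteq> hardy" "range ?y \<subseteq> hardy" using x y by auto
  ultimately show ?thesis unfolding trace_class_on_def by blast
qed

lemma has_det_cong:
  assumes "has_det T d" "\<And>f. f \<in> hardy \<Longrightarrow> T' f = T f"
  shows "has_det T' d"
  using assms unfolding has_det_def by simp

lemma has_det_rank_one:
  assumes "x \<in> hardy" "y \<in> hardy" and "\<And>f. f \<in> hardy \<Longrightarrow> T f = f + cinner f x *\<^sub>C y"
  shows "has_det T (1 + cinner y x)"
  by (rule has_detI[of "1" "\<lambda>_. x" "\<lambda>_. y"]) (use assms in \<open>auto simp: det_single\<close>)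

lemma has_det_id: "has_det (\<lambda>f. f) 1"
  using has_det_rank_one[of 0 0 "\<lambda>f. f"] by simp

lemma sum_lessThan_add: "(\<Sum>n<N + M. g n) = (\<Sum>n<N. g n) + (\<Sum>n<M. g (N + n))"
  for g :: "nat \<Rightarrow> 'a :: comm_monoid_add"
  by (induction M) (auto simp: add.assoc)

text \<open>\<open>(1 + A)(1 + A') = 1 + A + (1 + A)A'\<close>: the rank one terms of \<open>A\<close> are followed by those of \<open>A'\<close>, with vectors
  transformed by \<open>1 + A\<close>. The matrix of inner products is then a product of block triangular matrices.\<close>

lemma has_det_compose:
  assumes "has_det T d" "has_det T' d'"
  shows "has_det (\<lambda>f. T (T' f)) (d * d')"
proof -
  obtain N :: nat and x y where x: "\<And>n. n < N \<Longrightarrow> x n \<in> hardy" and y: "\<And>n. n < N \<Longrightarrow> y n \<in> hardy"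
    and T: "\<And>f. f \<in> hardy \<Longrightarrow> T f = f + (\<Sum>n<N. cinner f (x n) *\<^sub>C y n)"
    and d: "d = Determinant.det (mat N N (\<lambda>(i,j). (if i = j then 1 else 0) + cinner (y j) (x i)))"
    using assms(1) unfolding has_det_def by blast
  obtain M :: nat and x' y' where x': "\<And>n. n < M \<Longrightarrow> x' n \<in> hardy" and y': "\<And>n. n < M \<Longrightarrow> y' n \<in> hardy"
    and T': "\<And>f. f \<in> hardy \<Longrightarrow> T' f = f + (\<Sum>n<M. cinner f (x' n) *\<^sub>C y' n)"
    and d': "d' = Determinant.det (mat M M (\<lambda>(i,j). (if i = j then 1 else 0) + cinner (y' j) (x' i)))"
    using assms(2) unfolding has_det_def by blast
  have TH: "T f \<in> hardy" if "f \<in> hardy" for f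
    unfolding T[OF that] using that y by (intro hardy_add hardy_sum hardy_scaleC) auto
  define X where "X n = (if n < N then x n else x' (n - N))" for n
  define Y where "Y n = (if n < N then y n else T (y' (n - N)))" for n
  show ?thesis
  proof (rule has_detI[of "N + M" X Y])
    show "X n \<in> hardy" "Y n \<in> hardy" if "n < N + M" for n
      using that x y x' y' TH by (auto simp: X_def Y_def)
  next
    fix f assume f: "f \<in> hardy"
    let ?s = "\<Sum>m<M. cinner f (x' m) *\<^sub>C y' m"
    have s: "?s \<in> hardy" using y' by (intro hardy_sum hardy_scaleC) auto
    have "T (T' f) = T (f + ?s)" by (simp add: T'[OF f])
    also have "\<dots> = f + ?s + (\<Sum>n<N. cinner (f + ?s) (x n) *\<^sub>C y n)"
      by (rule T[OF hardy_add[OF f s]])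
    also have "\<dots> = f + (\<Sum>n<N. cinner f (x n) *\<^sub>C y n)
        + (?s + (\<Sum>n<N. cinner ?s (x n) *\<^sub>C y n))"
      by (simp add: cinner_add_left scaleC_add_left sum.distrib)
    also have "?s + (\<Sum>n<N. cinner ?s (x n) *\<^sub>C y n)
        = (\<Sum>m<M. cinner f (x' m) *\<^sub>C y' m + (\<Sum>n<N. (cinner f (x' m) * cinner (y' m) (x n)) *\<^sub>C y n))"
    proof -
      have "(\<Sum>n<N. cinner ?s (x n) *\<^sub>C y n) 
          = (\<Sum>n<N. \<Sum>m<M. (cinner f (x' m) * cinner (y' m) (x n)) *\<^sub>C y n)"
      proof (rule sum.cong[OF refl])
        fix n
        have "(\<Sum>m<M. c m) *\<^sub>C y n = (\<Sum>m<M. c m *\<^sub>C y n)" for c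
          by (induction M) (auto simp: scaleC_add_left)
        then show "cinner ?s (x n) *\<^sub>C y n 
            = (\<Sum>m<M. (cinner f (x' m) * cinner (y' m) (x n)) *\<^sub>C y n)"
          by (simp add: cinner_sum_left cinner_scaleC_left)
      qed
      then show ?thesis
        by (simp add: sum.distrib sum.swap[of _ "{..<M}"])
    qed
    also have "\<dots> = (\<Sum>m<M. cinner f (x' m) *\<^sub>C T (y' m))"
      by (intro sum.cong refl) (simp add: T y' scaleC_add_right scaleC_sum_right)
    finally show "T (T' f) = f + (\<Sum>n<N + M. cinner f (X n) *\<^sub>C Y n)"
      by (simp add: sum_lessThan_add X_def Y_def add.assoc)
  next
    define A where "A = mat N N (\<lambda>(i,j). (if i = j then 1 else 0) + cinner (y j) (x i))"
    define D where "D = mat M M (\<lambda>(i,j). (if i = j then 1 else 0) + cinner (y' j) (x' i))"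
    define B where "B = mat N M (\<lambda>(i,j). cinner (y' j) (x i))"
    define C where "C = mat M N (\<lambda>(i,j). cinner (y j) (x' i))"
    have [simp]: "A \<in> carrier_mat N N" "B \<in> carrier_mat N M" "C \<in> carrier_mat M N" "D \<in> carrier_mat M M"
      by (auto simp: A_def B_def C_def D_def)
    have Ty: "cinner (T (y' j)) w = cinner (y' j) w + (\<Sum>n<N. cinner (y' j) (x n) * cinner (y n) w)"
      if "j < M" for j w
      using T[OF y'[OF that]] by (simp add: cinner_add_left cinner_sum_left cinner_scaleC_left)
    have AB: "(A * B) $$ (i, j) = cinner (T (y' j)) (x i)" if "i < N" "j < M" for i j
    proof -
      have "(A * B) $$ (i, j) = (\<Sum>n<N. (if i = n then cinner (y' j) (x n) else 0)
          + cinner (y' j) (x n) * cinner (y n) (x i))"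
        using that
        by (auto simp: A_def B_def scalar_prod_def lessThan_atLeast0 algebra_simps intro!: sum.cong)
      then show ?thesis using that by (simp add: sum.distrib Ty)
    qed
    have CB: "(D + C * B) $$ (i, j) = (if i = j then 1 else 0) + cinner (T (y' j)) (x' i)"
      if "i < M" "j < M" for i j
      using that
      by (simp add: D_def C_def B_def scalar_prod_def Ty lessThan_atLeast0 mult.commute)
    have "mat (N + M) (N + M) (\<lambda>(i,j). (if i = j then 1 else 0) + cinner (Y j) (X i))
        = four_block_mat A (A * B) C (D + C * B)"
    proof (rule eq_matI)
      fix i j assume "i < dim_row (four_block_mat A (A * B) C (D + C * B))" 
        "j < dim_col (four_block_mat A (A * B) C (D + C * B))"
      then have ij: "i < N + M" "j < N + M" by (auto simp: A_def C_def B_def)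
      have dims: "dim_row A = N" "dim_col A = N" "dim_row (D + C * B) = M" "dim_col (D + C * B) = M"
        by (auto simp: A_def B_def C_def)
      show "mat (N + M) (N + M) (\<lambda>(i,j). (if i = j then 1 else 0) + cinner (Y j) (X i)) $$ (i, j)
        = four_block_mat A (A * B) C (D + C * B) $$ (i, j)"
        unfolding four_block_mat_def Let_def dims using ij AB[of i "j - N"] CB[of "i - N" "j - N"]
        by (auto simp del: index_mult_mat index_add_mat simp: X_def Y_def A_def[symmetric])
          (auto simp: A_def C_def)
    qed (auto simp: A_def B_def C_def)
    then show "d * d' = Determinant.det (mat (N + M) (N + M) (\<lambda>(i,j). (if i = j then 1 else 0) + cinner (Y j) (X i)))"
      using det_one_plus_block[of A N B M C D] by (simp add: d d' A_def[symmetric] D_def[symmetric])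
  qed
qed

text \<open>The operators by which finite rank perturbations may be conjugated. Only an adjoint on the Hardy space
  is asked for: it moves \<open>B\<close> off the functionals, and it forces \<open>B\<close> to be linear.\<close>

definition hardy_op :: "(L2 \<Rightarrow> L2) \<Rightarrow> bool" where
  "hardy_op B \<longleftrightarrow> (\<forall>f\<in>hardy. B f \<in> hardy) \<and>
     (\<exists>B'. \<forall>g\<in>hardy. B' g \<in> hardy \<and> (\<forall>f\<in>hardy. cinner (B f) g = cinner f (B' g)))"

lemma hardy_op_in_hardy: "hardy_op B \<Longrightarrow> f \<in> hardy \<Longrightarrow> B f \<in> hardy"
  by (simp add: hardy_op_def)

lemma hardy_eqI:
  assumes "f \<in> hardy" "g \<in> hardy" "\<And>h. h \<in> hardy \<Longrightarrow> cinner f h = cinner g h"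
  shows "f = g"
  using assms cinner_self_eq_0[of "f - g"] hardy_diff[of f g]
  by (simp add: cinner_diff_left)

lemma hardy_op_add:
  assumes "hardy_op B" "f \<in> hardy" "g \<in> hardy"
  shows "B (f + g) = B f + B g"
  using assms unfolding hardy_op_def
  by (intro hardy_eqI) (auto simp: hardy_add cinner_add_left)

lemma hardy_op_scaleC:
  assumes "hardy_op B" "f \<in> hardy"
  shows "B (c *\<^sub>C f) = c *\<^sub>C B f"
  using assms unfolding hardy_op_def
  by (intro hardy_eqI) (auto simp: hardy_scaleC cinner_scaleC_left)

lemma hardy_op_sum:
  assumes "hardy_op B" "\<And>i. i \<in> A \<Longrightarrow> f i \<in> hardy"
  shows "B (sum f A) = (\<Sum>i\<in>A. B (f i))"
  using assms(2)
proof (induction A rule: infinite_finite_induct)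
  case (insert a A)
  then show ?case by (simp add: hardy_op_add[OF assms(1)] hardy_sum)
qed (use hardy_op_scaleC[OF assms(1) hardy_zero, of 0] in auto)

text \<open>Conjugation replaces \<open>x\<^sub>n\<close> by \<open>B'\<^sup>* x\<^sub>n\<close> and \<open>y\<^sub>n\<close> by \<open>B y\<^sub>n\<close>, which leaves all inner products unchanged.\<close>

lemma has_det_conjugate:
  assumes "has_det T d" and B: "hardy_op B" "hardy_op B'"
    and inv: "\<And>f. f \<in> hardy \<Longrightarrow> B (B' f) = f" "\<And>f. f \<in> hardy \<Longrightarrow> B' (B f) = f"
  shows "has_det (\<lambda>f. B (T (B' f))) d"
proof -
  obtain N :: nat and x y where x: "\<And>n. n < N \<Longrightarrow> x n \<in> hardy" and y: "\<And>n. n < N \<Longrightarrow> y n \<in> hardy"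
    and T: "\<And>f. f \<in> hardy \<Longrightarrow> T f = f + (\<Sum>n<N. cinner f (x n) *\<^sub>C y n)"
    and d: "d = Determinant.det (mat N N (\<lambda>(i,j). (if i = j then 1 else 0) + cinner (y j) (x i)))"
    using assms(1) unfolding has_det_def by blast
  obtain B'' where B'': "\<And>g. g \<in> hardy \<Longrightarrow> B'' g \<in> hardy" 
    "\<And>f g. f \<in> hardy \<Longrightarrow> g \<in> hardy \<Longrightarrow> cinner (B' f) g = cinner f (B'' g)"
    using B(2) unfolding hardy_op_def by blast
  note H = hardy_op_in_hardy[OF B(1)] hardy_op_in_hardy[OF B(2)]
  show ?thesis
  proof (rule has_detI[of N "\<lambda>n. B'' (x n)" "\<lambda>n. B (y n)"])
    fix f assume f: "f \<in> hardy"
    have "B (T (B' f)) = B (B' f + (\<Sum>n<N. cinner (B' f) (x n) *\<^sub>C y n))"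
      by (simp add: T H f)
    also have "\<dots> = B (B' f) + (\<Sum>n<N. cinner (B' f) (x n) *\<^sub>C B (y n))"
    proof -
      have "B (B' f + (\<Sum>n<N. cinner (B' f) (x n) *\<^sub>C y n)) 
          = B (B' f) + B (\<Sum>n<N. cinner (B' f) (x n) *\<^sub>C y n)"
        using y H f by (intro hardy_op_add[OF B(1)] hardy_sum hardy_scaleC) auto
      also have "B (\<Sum>n<N. cinner (B' f) (x n) *\<^sub>C y n) = (\<Sum>n<N. B (cinner (B' f) (x n) *\<^sub>C y n))"
        using y by (intro hardy_op_sum[OF B(1)] hardy_scaleC) auto
      also have "\<dots> = (\<Sum>n<N. cinner (B' f) (x n) *\<^sub>C B (y n))"
        using y by (intro sum.cong hardy_op_scaleC[OF B(1)]) auto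
      finally show ?thesis .
    qed
    also have "\<dots> = f + (\<Sum>n<N. cinner f (B'' (x n)) *\<^sub>C B (y n))"
      using f x by (simp add: inv B'')
    finally show "B (T (B' f)) = f + (\<Sum>n<N. cinner f (B'' (x n)) *\<^sub>C B (y n))" .
  next
    show "d = Determinant.det (mat N N (\<lambda>(i,j). (if i = j then 1 else 0) + cinner (B (y j)) (B'' (x i))))"
      unfolding d using x y H
      by (intro arg_cong[where f = Determinant.det] eq_matI) (auto simp: B''(2)[symmetric] inv)
  qed (use x y B'' H in auto)
qed

section \<open>Analytic functions in the Hardy space\<close>

lemma continuous_on_sphere_analytic: "g analytic_on cball 0 1 \<Longrightarrow> continuous_on (sphere 0 1) g"
  using holomorphic_on_imp_continuous_on[OF analytic_imp_holomorphic] 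
  by (rule continuous_on_subset) auto

text \<open>Absolutely convergent power series converge uniformly on the circle, hence in \<open>L\<^sup>2\<close>.\<close>

lemma power_series_sums_L2:
  assumes g: "continuous_on (sphere 0 1) g" and c: "summable (\<lambda>k. cmod (c k))"
    and s: "\<And>z. cmod z = 1 \<Longrightarrow> (\<lambda>k. c k * z ^ k) sums g z"
  shows "(\<lambda>k. c k *\<^sub>C monomial_L2 k) sums abs_L2 g"
  unfolding sums_def
proof (rule LIMSEQ_I)
  fix e :: real assume e: "0 < e"
  let ?p = "\<lambda>n z. \<Sum>k<n. c k * z ^ k"
  have "uniform_limit (sphere 0 1) ?p (\<lambda>z. \<Sum>k. c k * z ^ k) sequentially"
    by (rule Weierstrass_m_test[OF _ c]) (auto simp: norm_mult norm_power)
  from this[unfolded uniform_limit_iff, rule_format, of "e / 2"] e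
  have "\<forall>\<^sub>F n in sequentially. \<forall>z\<in>sphere 0 1. dist (?p n z) (\<Sum>k. c k * z ^ k) < e / 2"
    by simp
  then obtain N where N': "\<forall>n\<ge>N. \<forall>z\<in>sphere 0 1. dist (?p n z) (\<Sum>k. c k * z ^ k) < e / 2"
    unfolding eventually_sequentially by blast
  have N: "cmod (?p n z - g z) < e / 2" if "n \<ge> N" "cmod z = 1" for n z
    using N'[rule_format, of n z] that sums_unique[OF s[OF that(2)]] by (simp add: dist_norm)
  have p: "(\<Sum>k<n. c k *\<^sub>C monomial_L2 k) = abs_L2 (?p n)" for n
  proof (induction n)
    case 0
    then show ?case by (simp add: zero_L2_def)
  next
    case (Suc n)
    have "square_integrable (?p n)" "square_integrable (\<lambda>z. c n * z ^ n)" "square_integrable (\<lambda>z. z ^ n)"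
      by (intro square_integrable_continuous continuous_intros)+
    moreover from this have "c n *\<^sub>C monomial_L2 n = abs_L2 (\<lambda>z. c n * z ^ n)"
      by (simp add: monomial_L2_def scaleC_abs_L2)
    ultimately show ?case by (simp add: Suc plus_abs_L2)
  qed
  have "norm ((\<Sum>k<n. c k *\<^sub>C monomial_L2 k) - abs_L2 g) < e" if n: "n \<ge> N" for n
  proof -
    have cont: "continuous_on (sphere 0 1) (\<lambda>z. ?p n z - g z)" by (intro continuous_intros g)
    have "(\<Sum>k<n. c k *\<^sub>C monomial_L2 k) - abs_L2 g = abs_L2 (\<lambda>z. ?p n z - g z)"
      unfolding p by (intro minus_abs_L2 square_integrable_continuous continuous_intros g)
    also have "\<dots> = mult_L2 (\<lambda>z. ?p n z - g z) (monomial_L2 0)"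
      by (simp add: mult_monomial[OF cont])
    also have "norm \<dots> \<le> norm (monomial_L2 0) * (e / 2)"
      using N[OF n] by (intro norm_mult_L2_le[OF cont]) (auto intro: less_imp_le)
    also have "norm (monomial_L2 0) = 1"
      using cinner_self[of "monomial_L2 0"] 
      by (simp add: cinner_monomial) (metis norm_ge_zero of_real_eq_1_iff of_real_power power2_eq_1_iff not_one_le_zero le_minus_one_simps(3))
    finally show ?thesis using e by simp
  qed
  then show "\<exists>N. \<forall>n\<ge>N. norm ((\<Sum>k<n. c k *\<^sub>C monomial_L2 k) - abs_L2 g) < e" by blast
qed

lemma hardy_suminf:
  assumes "(\<lambda>k. c k *\<^sub>C monomial_L2 k) sums f"
  shows "f \<in> hardy"
  using assms unfolding sums_def
  by (rule closed_sequentially[OF closed_hardy, rotated]) (auto intro!: hardy_sum hardy_scaleC)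

lemma open_contains_larger_disc:
  fixes S :: "complex set"
  assumes "open S" "cball 0 1 \<subseteq> S"
  obtains R where "R > 1" "ball 0 R \<subseteq> S"
proof -
  obtain e where e: "e > 0" "(\<Union>z\<in>cball 0 1. ball z e) \<subseteq> S"
    using compact_subset_open_imp_ball_epsilon_subset[OF compact_cball assms] by auto
  define R where "R = 1 + e"
  have sub: "ball 0 R \<subseteq> S"
  proof
    fix z :: complex assume z: "z \<in> ball 0 R"
    show "z \<in> S"
    proof (cases "cmod z \<le> 1")
      case True
      then show ?thesis using assms(2) by auto
    next
      case False
      have "z / cmod z - z = of_real (1 / cmod z - 1) * z" by (simp add: field_simps)
      then have "cmod (z / cmod z - z) = \<bar>1 / cmod z - 1\<bar> * cmod z"
        by (simp only: norm_mult norm_of_real)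
      also have "\<bar>1 / cmod z - 1\<bar> = 1 - 1 / cmod z"
      proof -
        have "1 / cmod z \<le> 1" using False by (subst divide_le_eq_1_pos) linarith+
        then show ?thesis by simp
      qed
      also have "(1 - 1 / cmod z) * cmod z = cmod z - 1"
        using False by (cases "z = 0") (auto simp: field_simps)
      finally have "dist (z / cmod z) z < e"
        using z by (simp add: dist_norm R_def)
      moreover have "z / cmod z \<in> cball 0 1" using False by (simp add: norm_divide)
      ultimately show ?thesis using e(2) by fastforce
    qed
  qed
  show ?thesis using that[of R] e sub by (simp add: R_def)
qed

lemma analytic_power_series:
  assumes "g analytic_on cball 0 1"
  obtains c where "summable (\<lambda>k. cmod (c k))" "\<And>z. cmod z \<le> 1 \<Longrightarrow> (\<lambda>k. c k * z ^ k) sums g z"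
proof -
  obtain S where S: "open S" "cball 0 1 \<subseteq> S" "g holomorphic_on S"
    using assms by (auto simp: analytic_on_holomorphic)
  obtain R where R: "R > 1" and sub: "ball 0 R \<subseteq> S"
    by (rule open_contains_larger_disc[OF S(1,2)])
  define c where "c k = (deriv ^^ k) g 0 / fact k" for k
  have s: "(\<lambda>k. c k * z ^ k) sums g z" if "z \<in> ball 0 R" for z
    using holomorphic_power_series[of g 0 R z] holomorphic_on_subset[OF S(3) sub] that
    by (simp add: c_def)
  define r where "r = (1 + R) / 2"
  have "1 < r" "r < R" using R by (auto simp: r_def)
  then have r: "cmod (of_real r) = r" "1 < r" "r < R" by auto
  have "summable (\<lambda>k. cmod (c k * 1 ^ k))"
  proof (rule powser_insidea)
    show "summable (\<lambda>k. c k * (of_real r) ^ k)"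
      using r by (intro sums_summable[OF s]) simp
    show "cmod 1 < cmod (of_real r)" using r by simp
  qed
  moreover have "(\<lambda>k. c k * z ^ k) sums g z" if "cmod z \<le> 1" for z
    using s[of z] that R by simp
  ultimately show ?thesis using that[of c] by simp
qed

lemma analytic_in_hardy:
  assumes "g analytic_on cball 0 1"
  shows "abs_L2 g \<in> hardy"
proof -
  obtain c where "summable (\<lambda>k. cmod (c k))" "\<And>z. cmod z \<le> 1 \<Longrightarrow> (\<lambda>k. c k * z ^ k) sums g z"
    using analytic_power_series[OF assms] by blast
  then show ?thesis
    by (intro hardy_suminf[of c] power_series_sums_L2 continuous_on_sphere_analytic assms) auto
qed

text \<open>The Szego kernel, the reproducing kernel of the Hardy space: the inner product with it is evaluation
  at \<open>a\<close>. All functionals in the rank one operators below are multiples of such evaluations.\<close>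

definition szego_kernel :: "complex \<Rightarrow> L2" where
  "szego_kernel a = abs_L2 (\<lambda>z. 1 / (1 - cnj a * z))"

lemma one_minus_cnj_mult_nonzero:
  assumes "cmod a < 1" "cmod z \<le> 1"
  shows "1 - cnj a * z \<noteq> 0"
proof
  assume "1 - cnj a * z = 0"
  then have "cmod a * cmod z = 1" by (metis complex_mod_cnj eq_iff_diff_eq_0 norm_mult norm_one)
  moreover have "cmod a * cmod z \<le> cmod a * 1" using assms by (intro mult_left_mono) auto
  ultimately show False using assms by simp
qed

lemma analytic_kernel: "cmod a < 1 \<Longrightarrow> (\<lambda>z. 1 / (1 - cnj a * z)) analytic_on cball 0 1"
  by (intro analytic_intros) (auto dest: one_minus_cnj_mult_nonzero)

lemma szego_kernel_in_hardy [simp]: "cmod a < 1 \<Longrightarrow> szego_kernel a \<in> hardy"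
  unfolding szego_kernel_def by (intro analytic_in_hardy analytic_kernel)

lemma szego_kernel_0: "szego_kernel 0 = monomial_L2 0"
  by (simp add: szego_kernel_def monomial_L2_def)

lemma cinner_monomial_kernel:
  assumes a: "cmod a < 1"
  shows "cinner (monomial_L2 k) (szego_kernel a) = a ^ k"
proof -
  have "(\<lambda>j. cnj a ^ j *\<^sub>C monomial_L2 j) sums szego_kernel a"
    unfolding szego_kernel_def
  proof (rule power_series_sums_L2)
    show "summable (\<lambda>k. cmod (cnj a ^ k))" using a by (simp add: norm_power)
    show "(\<lambda>k. cnj a ^ k * z ^ k) sums (1 / (1 - cnj a * z))" if "cmod z = 1" for z
      using geometric_sums[of "cnj a * z"] a that by (simp add: norm_mult power_mult_distrib)
  qed (rule continuous_on_sphere_analytic[OF analytic_kernel[OF a]])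
  from bounded_linear.sums[OF bounded_linear_cinner_right this, of "monomial_L2 k"]
  have "(\<lambda>j. if j = k then a ^ k else 0) sums cinner (monomial_L2 k) (szego_kernel a)"
    by (simp add: cinner_scaleC_right cinner_monomial if_distrib eq_commute[of k] cong: if_cong)
  moreover have "(\<lambda>j. if j = k then a ^ k else 0) sums a ^ k"
    using sums_single[of k "\<lambda>_. a ^ k"] by simp
  ultimately show ?thesis by (rule sums_unique2)
qed

lemma cinner_kernel:
  assumes g: "g analytic_on cball 0 1" and a: "cmod a < 1"
  shows "cinner (abs_L2 g) (szego_kernel a) = g a"
proof -
  obtain c where c: "summable (\<lambda>k. cmod (c k))" "\<And>z. cmod z \<le> 1 \<Longrightarrow> (\<lambda>k. c k * z ^ k) sums g z"
    using analytic_power_series[OF g] by blast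
  have "(\<lambda>k. c k *\<^sub>C monomial_L2 k) sums abs_L2 g"
    by (rule power_series_sums_L2[OF continuous_on_sphere_analytic[OF g] c]) simp
  from bounded_linear.sums[OF bounded_linear_cinner_left this, of "szego_kernel a"]
  have "(\<lambda>k. c k * a ^ k) sums cinner (abs_L2 g) (szego_kernel a)"
    by (simp add: cinner_scaleC_left cinner_monomial_kernel[OF a])
  then show ?thesis using c(2)[of a] a sums_unique2 by fastforce
qed

lemma mult_analytic_in_hardy:
  assumes g: "g analytic_on cball 0 1" and f: "f \<in> hardy"
  shows "mult_L2 g f \<in> hardy"
  using f
proof (induction rule: hardy_induct)
  case closed
  show ?case
    using continuous_closed_vimage[OF closed_hardy] linear_continuous_at[OF bounded_linear_mult_L2[OF continuous_on_sphere_analytic[OF g]]]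
    by (auto simp: vimage_def)
next
  case (monomial k)
  show ?case
    unfolding mult_monomial[OF continuous_on_sphere_analytic[OF g]]
    by (intro analytic_in_hardy analytic_intros g)
next
  case zero
  show ?case using mult_L2_scaleC[OF continuous_on_sphere_analytic[OF g], of 0 0] by simp
qed (auto simp: mult_L2_add mult_L2_scaleC continuous_on_sphere_analytic[OF g] intro: hardy_add hardy_scaleC)

text \<open>Evaluation at a point of the disc is multiplicative.\<close>

lemma cinner_mult_kernel:
  assumes g: "g analytic_on cball 0 1" and f: "f \<in> hardy" and a: "cmod a < 1"
  shows "cinner (mult_L2 g f) (szego_kernel a) = g a * cinner f (szego_kernel a)"
  using f
proof (induction rule: hardy_induct)
  case closed
  have 1: "continuous_on UNIV (\<lambda>f. cinner (mult_L2 g f) (szego_kernel a))"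
    by (rule linear_continuous_on[OF bounded_linear_compose[OF bounded_linear_cinner_left 
          bounded_linear_mult_L2[OF continuous_on_sphere_analytic[OF g]]]])
  have 2: "continuous_on UNIV (\<lambda>f. g a * cinner f (szego_kernel a))"
    by (intro continuous_intros linear_continuous_on[OF bounded_linear_cinner_left])
  show ?case by (rule closed_Collect_eq[OF 1 2])
next
  case (monomial k)
  have "(\<lambda>z. g z * z ^ k) analytic_on cball 0 1" by (intro analytic_intros g)
  from cinner_kernel[OF this a] show ?case
    by (simp add: mult_monomial[OF continuous_on_sphere_analytic[OF g]] cinner_monomial_kernel[OF a])
next
  case zero
  show ?case using mult_L2_scaleC[OF continuous_on_sphere_analytic[OF g], of 0 0] by simp
qed (auto simp: mult_L2_add mult_L2_scaleC continuous_on_sphere_analytic[OF g] 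
      cinner_add_left cinner_scaleC_left distrib_left)

section \<open>Toeplitz operators with coanalytic symbols\<close>

lemma toeplitz_eqI: "is_proj (mult_L2 \<phi> f) g \<Longrightarrow> toeplitz \<phi> f = g"
  unfolding toeplitz_def by (rule orth_proj_eqI)

text \<open>On the circle \<open>u\<close> is the complex conjugate of a function analytic on the closed disc, so multiplication by \<open>u\<close>
  preserves the orthogonal complement of the Hardy space. The last conjunct is the existence of
  projections.\<close>

definition coanalytic :: "(complex \<Rightarrow> complex) \<Rightarrow> bool" where
  "coanalytic u \<longleftrightarrow> continuous_on (sphere 0 1) u \<and>
     (\<exists>v. v analytic_on cball 0 1 \<and> (\<forall>z\<in>sphere 0 1. cnj (u z) = v z)) \<and>
     (\<forall>f\<in>hardy. \<exists>g. is_proj (mult_L2 u f) g)"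

lemma is_proj_toeplitz: "coanalytic u \<Longrightarrow> f \<in> hardy \<Longrightarrow> is_proj (mult_L2 u f) (toeplitz u f)"
  unfolding coanalytic_def using toeplitz_eqI by blast

lemma toeplitz_in_hardy: "coanalytic u \<Longrightarrow> f \<in> hardy \<Longrightarrow> toeplitz u f \<in> hardy"
  using is_proj_toeplitz unfolding is_proj_def by blast

lemma mult_cnj_coanalytic_in_hardy:
  assumes "coanalytic u" "f \<in> hardy"
  shows "mult_L2 (\<lambda>z. cnj (u z)) f \<in> hardy"
proof -
  obtain v where v: "v analytic_on cball 0 1" "\<forall>z\<in>sphere 0 1. cnj (u z) = v z"
    using assms(1) by (auto simp: coanalytic_def)
  have "mult_L2 v = mult_L2 (\<lambda>z. cnj (u z))"
    by (rule mult_L2_cong[OF continuous_on_sphere_analytic[OF v(1)]]) (use v(2) in auto)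
  with mult_analytic_in_hardy[OF v(1) assms(2)] show ?thesis by simp
qed

lemma hardy_op_toeplitz:
  assumes u: "coanalytic u"
  shows "hardy_op (toeplitz u)"
proof -
  have "cinner (toeplitz u f) g = cinner f (mult_L2 (\<lambda>z. cnj (u z)) g)"
    if "f \<in> hardy" "g \<in> hardy" for f g
  proof -
    have "cinner (mult_L2 u f - toeplitz u f) g = 0"
      using is_proj_toeplitz[OF u that(1)] that(2) by (simp add: is_proj_def)
    then show ?thesis
      using u by (simp add: cinner_diff_left cinner_mult_L2 coanalytic_def)
  qed
  then show ?thesis
    unfolding hardy_op_def using mult_cnj_coanalytic_in_hardy[OF u] toeplitz_in_hardy[OF u] by blast
qed

text \<open>The error \<open>w f - g\<close> is orthogonal to the Hardy space, and multiplication by \<open>u\<close> keeps it so. Hence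
  Toeplitz operators are multiplicative when a coanalytic factor stands on the left.\<close>

lemma is_proj_mult:
  assumes u: "coanalytic u" and w: "continuous_on (sphere 0 1) w" and g: "is_proj (mult_L2 w f) g"
  shows "is_proj (mult_L2 (\<lambda>z. u z * w z) f) (toeplitz u g)"
  unfolding is_proj_def
proof (intro conjI ballI)
  have gH: "g \<in> hardy" using g by (simp add: is_proj_def)
  show "toeplitz u g \<in> hardy" by (rule toeplitz_in_hardy[OF u gH])
  fix h assume h: "h \<in> hardy"
  have uc: "continuous_on (sphere 0 1) u" using u by (simp add: coanalytic_def)
  have 1: "mult_L2 (\<lambda>z. u z * w z) f - toeplitz u g 
      = mult_L2 u (mult_L2 w f - g) + (mult_L2 u g - toeplitz u g)"
    by (simp add: mult_L2_diff[OF uc] mult_L2_mult[OF uc w])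
  have 2: "cinner (mult_L2 u (mult_L2 w f - g)) h = 0"
    using g mult_cnj_coanalytic_in_hardy[OF u h] by (simp add: cinner_mult_L2[OF uc] is_proj_def)
  have 3: "cinner (mult_L2 u g - toeplitz u g) h = 0"
    using is_proj_toeplitz[OF u gH] h by (simp add: is_proj_def)
  show "cinner (mult_L2 (\<lambda>z. u z * w z) f - toeplitz u g) h = 0"
    unfolding 1 cinner_add_left 2 3 by simp
qed

lemma coanalytic_mult:
  assumes u: "coanalytic u" and v: "coanalytic v"
  shows "coanalytic (\<lambda>z. u z * v z)"
  unfolding coanalytic_def
proof (intro conjI)
  have uv: "continuous_on (sphere 0 1) u" "continuous_on (sphere 0 1) v"
    using u v by (auto simp: coanalytic_def)
  show "continuous_on (sphere 0 1) (\<lambda>z. u z * v z)" by (intro continuous_intros uv)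
  obtain a b where ab: "a analytic_on cball 0 1" "\<forall>z\<in>sphere 0 1. cnj (u z) = a z"
     "b analytic_on cball 0 1" "\<forall>z\<in>sphere 0 1. cnj (v z) = b z"
    using u v by (auto simp: coanalytic_def)
  show "\<exists>a. a analytic_on cball 0 1 \<and> (\<forall>z\<in>sphere 0 1. cnj (u z * v z) = a z)"
    by (rule exI[of _ "\<lambda>z. a z * b z"]) (use ab in \<open>auto intro: analytic_on_mult\<close>)
  show "\<forall>f\<in>hardy. \<exists>g. is_proj (mult_L2 (\<lambda>z. u z * v z) f) g"
    using is_proj_mult[OF u uv(2) is_proj_toeplitz[OF v]] by blast
qed

lemma toeplitz_mult:
  assumes "coanalytic u" "coanalytic v" "f \<in> hardy"
  shows "toeplitz (\<lambda>z. u z * v z) f = toeplitz u (toeplitz v f)"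
  using is_proj_mult[OF assms(1) _ is_proj_toeplitz[OF assms(2,3)]] assms(2)
  by (intro toeplitz_eqI) (simp add: coanalytic_def)

lemma is_proj_hardy: "f \<in> hardy \<Longrightarrow> is_proj f f"
  by (simp add: is_proj_def)

lemma toeplitz_mult_analytic:
  assumes "coanalytic u" "g analytic_on cball 0 1" "f \<in> hardy"
  shows "toeplitz (\<lambda>z. u z * g z) f = toeplitz u (mult_L2 g f)"
  using assms
  by (intro toeplitz_eqI is_proj_mult is_proj_hardy mult_analytic_in_hardy continuous_on_sphere_analytic)

lemma toeplitz_one: "(\<And>z. cmod z = 1 \<Longrightarrow> u z = 1) \<Longrightarrow> f \<in> hardy \<Longrightarrow> toeplitz u f = f"
  by (rule toeplitz_eqI) (simp add: mult_L2_one is_proj_hardy)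

lemma coanalytic_one: "coanalytic (\<lambda>_. 1)"
  unfolding coanalytic_def using is_proj_hardy by (auto simp: mult_L2_one intro!: exI[of _ "\<lambda>_. 1"])

lemma toeplitz_cong:
  "continuous_on (sphere 0 1) u \<Longrightarrow> (\<And>z. cmod z = 1 \<Longrightarrow> u z = v z) \<Longrightarrow> toeplitz u f = toeplitz v f"
  unfolding toeplitz_def using mult_L2_cong[of u v] by simp

lemma continuous_cauchy_kernel: "cmod a < 1 \<Longrightarrow> continuous_on (sphere 0 1) (\<lambda>z. 1 / (z - a))"
  by (intro continuous_intros) auto

lemma cnj_inverse_sphere: 
  assumes "cmod z = 1" 
  shows "cnj z = 1 / z"
proof (rule eq_divide_imp)
  show "z \<noteq> 0" using assms by auto
  show "cnj z * z = 1" using complex_norm_square[of z] assms by (simp add: mult.commute)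
qed

text \<open>On the circle \<open>cnj (1 / (z - a)) = z / (1 - cnj a * z)\<close> is analytic in the disc and vanishes at \<open>0\<close>.\<close>

lemma cauchy_kernel_orthogonal:
  assumes a: "cmod a < 1" and h: "h \<in> hardy"
  shows "cinner (abs_L2 (\<lambda>z. 1 / (z - a))) h = 0"
  using h
proof (rule orthogonal_hardyI[rotated])
  fix k
  let ?g = "\<lambda>z. (1 / (1 - cnj a * z)) * z ^ Suc k"
  have g: "?g analytic_on cball 0 1"
    by (intro analytic_on_mult analytic_kernel a analytic_intros)
  have "cinner (monomial_L2 k) (abs_L2 (\<lambda>z. 1 / (z - a))) = (LINT z|circle_measure. z ^ k * cnj (1 / (z - a)))"
    unfolding monomial_L2_def
    by (intro cinner_abs_L2 square_integrable_continuous continuous_cauchy_kernel a continuous_intros)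
  also have "\<dots> = (LINT z|circle_measure. ?g z * cnj (z ^ 0))"
  proof (rule Bochner_Integration.integral_cong[OF refl])
    fix z assume "z \<in> space circle_measure"
    then have z: "cmod z = 1" by (simp add: space_circle_measure)
    then have "z \<noteq> 0" by auto
    have "cnj (1 / (z - a)) = 1 / (1 / z - cnj a)" using cnj_inverse_sphere[OF z] by simp
    also have "\<dots> = z / (1 - cnj a * z)"
      using \<open>z \<noteq> 0\<close> one_minus_cnj_mult_nonzero[OF a, of z] z by (simp add: field_simps)
    finally show "z ^ k * cnj (1 / (z - a)) = ?g z * cnj (z ^ 0)" by simp
  qed
  also have "\<dots> = cinner (abs_L2 ?g) (monomial_L2 0)"
    unfolding monomial_L2_def
    by (intro cinner_abs_L2[symmetric] square_integrable_continuous continuous_on_sphere_analytic[OF g] continuous_intros)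
  also have "\<dots> = 0"
    using cinner_kernel[OF g, of 0] by (simp add: szego_kernel_0)
  finally show "cinner (abs_L2 (\<lambda>z. 1 / (z - a))) (monomial_L2 k) = 0"
    by (subst cinner_commute) simp
qed

lemma closed_rank_one_correction:
  assumes "continuous_on (sphere 0 1) w"
  shows "closed {f. mult_L2 w f + (a * cinner f k) *\<^sub>C q \<in> hardy}"
proof -
  have "bounded_linear (\<lambda>f. mult_L2 w f + (a * cinner f k) *\<^sub>C q)"
    by (intro bounded_linear_add bounded_linear_mult_L2 assms
        bounded_linear_compose[OF bounded_linear_scaleC_left[of q] 
          bounded_linear_compose[OF bounded_linear_mult_right[of a] bounded_linear_cinner_left[of k]]]) 
  from continuous_closed_vimage[OF closed_hardy linear_continuous_at[OF this]]
  show ?thesis by (simp add: vimage_def)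
qed

text \<open>The projections of \<open>(1 - a/z) f\<close> and \<open>f / (1 - a/z)\<close> both subtract a multiple of a Cauchy kernel, the multiple
  being a point evaluation of \<open>f\<close>. That the result lies in the Hardy space need only be seen for
  monomials.\<close>

lemma correction_in_hardy:
  assumes w: "continuous_on (sphere 0 1) w" and f: "f \<in> hardy"
    and monomial: "\<And>k. mult_L2 w (monomial_L2 k) + (a * cinner (monomial_L2 k) h) *\<^sub>C q \<in> hardy"
  shows "mult_L2 w f + (a * cinner f h) *\<^sub>C q \<in> hardy"
  using f
proof (induction rule: hardy_induct)
  case closed
  show ?case by (rule closed_rank_one_correction[OF w])
next
  case zero
  show ?case using mult_L2_scaleC[OF w, of 0 0] by simp
next
  case (add f g)
  from hardy_add[OF this] show ?case
    by (simp add: mult_L2_add[OF w] cinner_add_left distrib_left scaleC_add_left algebra_simps)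
next
  case (scaleC c f)
  from hardy_scaleC[OF this, of c] show ?case
    by (simp add: mult_L2_scaleC[OF w] cinner_scaleC_left scaleC_add_right mult_ac)
qed (rule monomial)

lemma is_proj_factor:
  assumes a: "cmod a < 1" and f: "f \<in> hardy"
  shows "is_proj (mult_L2 (\<lambda>z. 1 - a / z) f) 
           (mult_L2 (\<lambda>z. 1 - a / z) f + (a * cinner f (szego_kernel 0)) *\<^sub>C abs_L2 (\<lambda>z. 1 / z))"
  unfolding is_proj_def
proof (intro conjI ballI)
  have c: "continuous_on (sphere 0 1) (\<lambda>z. 1 - a / z)" by (intro continuous_intros) auto
  have d: "continuous_on (sphere 0 1) (\<lambda>z. 1 / z :: complex)" by (intro continuous_intros) auto
  show "mult_L2 (\<lambda>z. 1 - a / z) f + (a * cinner f (szego_kernel 0)) *\<^sub>C abs_L2 (\<lambda>z. 1 / z) \<in> hardy"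
  proof (rule correction_in_hardy[OF c f])
    fix k
    let ?g = "\<lambda>z. if k = 0 then 1 else (z - a) * z ^ (k - 1)"
    have "mult_L2 (\<lambda>z. 1 - a / z) (monomial_L2 k) + (a * cinner (monomial_L2 k) (szego_kernel 0)) *\<^sub>C abs_L2 (\<lambda>z. 1 / z)
       = abs_L2 (\<lambda>z. (1 - a / z) * z ^ k + (a * 0 ^ k) * (1 / z))"
    proof -
      have "cmod 0 < 1" by simp
      show ?thesis
        unfolding mult_monomial[OF c] cinner_monomial_kernel[OF \<open>cmod 0 < 1\<close>] 
          scaleC_abs_L2[OF square_integrable_continuous[OF d]]
        by (intro plus_abs_L2 square_integrable_continuous continuous_on_mult c d continuous_intros)
    qed
    also have "\<dots> = abs_L2 ?g"
    proof (rule abs_L2_cong)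
      show "square_integrable (\<lambda>z. (1 - a / z) * z ^ k + (a * 0 ^ k) * (1 / z))"
        by (intro square_integrable_continuous continuous_intros) auto
      fix z :: complex assume "cmod z = 1"
      then have "z \<noteq> 0" by auto
      then show "(1 - a / z) * z ^ k + (a * 0 ^ k) * (1 / z) = ?g z"
        by (cases k) (auto simp: field_simps)
    qed
    also have "\<dots> \<in> hardy"
      by (cases "k = 0") (auto intro!: analytic_in_hardy analytic_intros)
    finally show "mult_L2 (\<lambda>z. 1 - a / z) (monomial_L2 k) + (a * cinner (monomial_L2 k) (szego_kernel 0)) *\<^sub>C abs_L2 (\<lambda>z. 1 / z) \<in> hardy" .
  qed
  fix h assume "h \<in> hardy"
  then show "cinner (mult_L2 (\<lambda>z. 1 - a / z) f - 
     (mult_L2 (\<lambda>z. 1 - a / z) f + (a * cinner f (szego_kernel 0)) *\<^sub>C abs_L2 (\<lambda>z. 1 / z))) h = 0"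
    using cauchy_kernel_orthogonal[of 0 h] by (simp add: cinner_minus_left cinner_scaleC_left)
qed

lemma inverse_factor_eq:
  assumes "cmod a < 1" "cmod z = 1"
  shows "1 / (1 - a / z) = z / (z - a)"
proof -
  have "z \<noteq> 0" "z \<noteq> a" using assms by auto
  then show ?thesis by (simp add: field_simps)
qed

lemma factor_nonzero: "cmod a < 1 \<Longrightarrow> cmod z = 1 \<Longrightarrow> 1 - a / z \<noteq> 0"
  by (auto simp: field_simps)

lemma continuous_inverse_factor: 
  "cmod a < 1 \<Longrightarrow> continuous_on (sphere 0 1) (\<lambda>z. 1 / (1 - a / z))"
  by (intro continuous_intros) (auto dest: factor_nonzero)

text \<open>\<open>1 / (1 - a/z) = z / (z - a)\<close> has a pole at \<open>a\<close>, which is removed by subtracting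
  \<open>a f(a) / (z - a)\<close>; for monomials the quotient is the geometric sum for
  \<open>(z\<^sup>k\<^sup>+\<^sup>1 - a\<^sup>k\<^sup>+\<^sup>1) / (z - a)\<close>.\<close>

lemma is_proj_inverse_factor:
  assumes a: "cmod a < 1" and f: "f \<in> hardy"
  shows "is_proj (mult_L2 (\<lambda>z. 1 / (1 - a / z)) f) 
           (mult_L2 (\<lambda>z. 1 / (1 - a / z)) f + (- a * cinner f (szego_kernel a)) *\<^sub>C abs_L2 (\<lambda>z. 1 / (z - a)))"
  unfolding is_proj_def
proof (intro conjI ballI)
  note c = continuous_inverse_factor[OF a]
  note d = continuous_cauchy_kernel[OF a]
  show "mult_L2 (\<lambda>z. 1 / (1 - a / z)) f + (- a * cinner f (szego_kernel a)) *\<^sub>C abs_L2 (\<lambda>z. 1 / (z - a)) \<in> hardy"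
  proof (rule correction_in_hardy[OF c f])
    fix k
    let ?g = "\<lambda>z. \<Sum>p<Suc k. z ^ p * a ^ (k - p)"
    let ?h = "\<lambda>z. 1 / (1 - a / z) * z ^ k + (- a * a ^ k) * (1 / (z - a))"
    have "mult_L2 (\<lambda>z. 1 / (1 - a / z)) (monomial_L2 k) + (- a * cinner (monomial_L2 k) (szego_kernel a)) *\<^sub>C abs_L2 (\<lambda>z. 1 / (z - a))
       = abs_L2 (\<lambda>z. 1 / (1 - a / z) * z ^ k) + abs_L2 (\<lambda>z. (- a * a ^ k) * (1 / (z - a)))"
      unfolding mult_monomial[OF c] cinner_monomial_kernel[OF a] 
        scaleC_abs_L2[OF square_integrable_continuous[OF d]] ..
    also have "\<dots> = abs_L2 ?h"
      by (intro plus_abs_L2 square_integrable_continuous continuous_on_mult c d continuous_intros)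
    also have "\<dots> = abs_L2 ?g"
    proof (rule abs_L2_cong)
      show "square_integrable ?h"
        by (intro square_integrable_continuous continuous_on_add continuous_on_mult c d continuous_intros)
      fix z :: complex assume z: "cmod z = 1"
      then have "z \<noteq> a" using a by auto
      have "?h z = (z ^ Suc k - a ^ Suc k) / (z - a)"
        unfolding inverse_factor_eq[OF a z] by (simp add: diff_divide_distrib)
      also have "\<dots> = ?g z"
        using \<open>z \<noteq> a\<close> by (subst diff_power_eq_sum) simp
      finally show "?h z = ?g z" .
    qed
    also have "\<dots> \<in> hardy"
      by (intro analytic_in_hardy analytic_intros)
    finally show "mult_L2 (\<lambda>z. 1 / (1 - a / z)) (monomial_L2 k) + (- a * cinner (monomial_L2 k) (szego_kernel a)) *\<^sub>C abs_L2 (\<lambda>z. 1 / (z - a)) \<in> hardy" .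
  qed
  fix h assume "h \<in> hardy"
  then show "cinner (mult_L2 (\<lambda>z. 1 / (1 - a / z)) f - 
     (mult_L2 (\<lambda>z. 1 / (1 - a / z)) f + (- a * cinner f (szego_kernel a)) *\<^sub>C abs_L2 (\<lambda>z. 1 / (z - a)))) h = 0"
    using cauchy_kernel_orthogonal[OF a, of h] 
    by (simp add: cinner_minus_left cinner_scaleC_left)
qed

lemma cnj_factor: "cmod z = 1 \<Longrightarrow> cnj (1 - a / z) = 1 - cnj a * z"
  by (simp add: cnj_inverse_sphere)

lemma coanalytic_factor:
  assumes a: "cmod a < 1"
  shows "coanalytic (\<lambda>z. 1 - a / z)"
  unfolding coanalytic_def
proof (intro conjI)
  show "continuous_on (sphere 0 1) (\<lambda>z. 1 - a / z)" by (intro continuous_intros) auto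
  show "\<exists>v. v analytic_on cball 0 1 \<and> (\<forall>z\<in>sphere 0 1. cnj (1 - a / z) = v z)"
  proof (intro exI[of _ "\<lambda>z. 1 - cnj a * z"] conjI ballI)
    fix z :: complex assume "z \<in> sphere 0 1"
    then show "cnj (1 - a / z) = 1 - cnj a * z" by (intro cnj_factor) simp
  qed (intro analytic_intros)
qed (use is_proj_factor[OF a] in blast)

lemma coanalytic_inverse_factor:
  assumes a: "cmod a < 1"
  shows "coanalytic (\<lambda>z. 1 / (1 - a / z))"
  unfolding coanalytic_def
proof (intro conjI)
  show "continuous_on (sphere 0 1) (\<lambda>z. 1 / (1 - a / z))" by (rule continuous_inverse_factor[OF a])
  show "\<exists>v. v analytic_on cball 0 1 \<and> (\<forall>z\<in>sphere 0 1. cnj (1 / (1 - a / z)) = v z)"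
  proof (intro exI[of _ "\<lambda>z. 1 / (1 - cnj a * z)"] conjI ballI)
    fix z :: complex assume "z \<in> sphere 0 1"
    then have "cmod z = 1" by simp
    then show "cnj (1 / (1 - a / z)) = 1 / (1 - cnj a * z)" 
      by (simp only: complex_cnj_divide complex_cnj_one cnj_factor)
  qed (rule analytic_kernel[OF a])
qed (use is_proj_inverse_factor[OF a] in blast)

section \<open>Commutators of analytic and coanalytic Toeplitz operators\<close>

definition difference_quotient :: "(complex \<Rightarrow> complex) \<Rightarrow> complex \<Rightarrow> complex" where
  "difference_quotient g z = (if z = 0 then deriv g 0 else (g z - g 0) / z)"

lemma analytic_difference_quotient:
  assumes "g analytic_on cball 0 1"
  shows "difference_quotient g analytic_on cball 0 1"
proof -
  obtain S where S: "open S" "cball 0 1 \<subseteq> S" "g holomorphic_on S"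
    using assms by (auto simp: analytic_on_holomorphic)
  have "(\<lambda>z. if z = 0 then deriv g 0 else (g z - g 0) / (z - 0)) holomorphic_on S"
    using S by (intro pole_lemma) (auto simp: interior_open)
  moreover have "difference_quotient g = (\<lambda>z. if z = 0 then deriv g 0 else (g z - g 0) / (z - 0))"
    by (rule ext) (simp add: difference_quotient_def)
  ultimately have "difference_quotient g holomorphic_on S" by simp
  then show ?thesis using S by (auto simp: analytic_on_holomorphic)
qed

text \<open>The source of the rank one operators. With \<open>c = 1 - a/z\<close>, the projection of \<open>f / c\<close> differs from \<open>f / c\<close> by
  \<open>a f(a) / (z - a)\<close>. Multiplication by \<open>c g\<close> turns this difference into \<open>a f(a) g / z\<close>, whose
  analytic part is \<open>a f(a) (g - g(0)) / z\<close>.\<close>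

lemma conjugate_mult_by_factor:
  assumes a: "cmod a < 1" and g: "g analytic_on cball 0 1" and f: "f \<in> hardy"
  shows "toeplitz (\<lambda>z. 1 - a / z) (mult_L2 g (toeplitz (\<lambda>z. 1 / (1 - a / z)) f))
    = mult_L2 g f - (a * cinner f (szego_kernel a)) *\<^sub>C abs_L2 (difference_quotient g)"
proof (rule toeplitz_eqI)
  let ?c = "\<lambda>z. 1 - a / z" and ?s = "a * cinner f (szego_kernel a)" and ?Q = "difference_quotient g"
  have c: "continuous_on (sphere 0 1) ?c" by (intro continuous_intros) auto
  note c' = continuous_inverse_factor[OF a]
  note d = continuous_cauchy_kernel[OF a]
  note gc = continuous_on_sphere_analytic[OF g]
  note Q = analytic_difference_quotient[OF g]
  have d0: "continuous_on (sphere 0 1) (\<lambda>z. 1 / z :: complex)" by (intro continuous_intros) auto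
  have cg: "continuous_on (sphere 0 1) (\<lambda>z. ?c z * g z)" by (intro continuous_on_mult c gc)
  have T: "toeplitz (\<lambda>z. 1 / ?c z) f = mult_L2 (\<lambda>z. 1 / ?c z) f - ?s *\<^sub>C abs_L2 (\<lambda>z. 1 / (z - a))"
    using toeplitz_eqI[OF is_proj_inverse_factor[OF a f]] by (simp add: scaleC_minus_left)
  have "mult_L2 ?c (mult_L2 g (toeplitz (\<lambda>z. 1 / ?c z) f)) 
      = mult_L2 (\<lambda>z. ?c z * g z) (toeplitz (\<lambda>z. 1 / ?c z) f)"
    by (rule mult_L2_mult[OF c gc])
  also have "\<dots> = mult_L2 (\<lambda>z. ?c z * g z * (1 / ?c z)) f 
      - ?s *\<^sub>C abs_L2 (\<lambda>z. ?c z * g z * (1 / (z - a)))"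
    unfolding T mult_L2_diff[OF cg] mult_L2_scaleC[OF cg] mult_L2_mult[OF cg c']
      mult_abs_L2[OF cg square_integrable_continuous[OF d]] ..
  also have "mult_L2 (\<lambda>z. ?c z * g z * (1 / ?c z)) = mult_L2 g"
    using factor_nonzero[OF a] by (intro mult_L2_cong continuous_on_mult cg c') simp
  also have "abs_L2 (\<lambda>z. ?c z * g z * (1 / (z - a))) = abs_L2 (\<lambda>z. ?Q z + g 0 * (1 / z))"
  proof (rule abs_L2_cong)
    show "square_integrable (\<lambda>z. ?c z * g z * (1 / (z - a)))"
      by (intro square_integrable_continuous continuous_on_mult cg d)
    fix z :: complex assume "cmod z = 1"
    then have "z \<noteq> 0" "z \<noteq> a" using a by auto
    then show "?c z * g z * (1 / (z - a)) = ?Q z + g 0 * (1 / z)"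
      by (simp add: difference_quotient_def field_simps)
  qed
  also have "\<dots> = abs_L2 ?Q + g 0 *\<^sub>C abs_L2 (\<lambda>z. 1 / z)"
    unfolding scaleC_abs_L2[OF square_integrable_continuous[OF d0]]
    by (intro plus_abs_L2[symmetric] square_integrable_continuous continuous_on_mult d0 
       continuous_on_sphere_analytic[OF Q] continuous_on_const)
  finally have eq: "mult_L2 ?c (mult_L2 g (toeplitz (\<lambda>z. 1 / ?c z) f)) 
    = mult_L2 g f - ?s *\<^sub>C (abs_L2 ?Q + g 0 *\<^sub>C abs_L2 (\<lambda>z. 1 / z))" .
  show "is_proj (mult_L2 ?c (mult_L2 g (toeplitz (\<lambda>z. 1 / ?c z) f))) (mult_L2 g f - ?s *\<^sub>C abs_L2 ?Q)"
    unfolding is_proj_def eq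
  proof (intro conjI ballI)
    show "mult_L2 g f - ?s *\<^sub>C abs_L2 ?Q \<in> hardy"
      by (intro hardy_diff hardy_scaleC mult_analytic_in_hardy g f analytic_in_hardy Q)
    fix h assume "h \<in> hardy"
    then show "cinner (mult_L2 g f - ?s *\<^sub>C (abs_L2 ?Q + g 0 *\<^sub>C abs_L2 (\<lambda>z. 1 / z)) 
       - (mult_L2 g f - ?s *\<^sub>C abs_L2 ?Q)) h = 0"
      using cauchy_kernel_orthogonal[of 0 h]
      by (simp add: cinner_diff_left cinner_add_left cinner_minus_left cinner_scaleC_left scaleC_add_right)
  qed
qed

definition analytic_unit :: "(complex \<Rightarrow> complex) \<Rightarrow> bool" where
  "analytic_unit g \<longleftrightarrow> g analytic_on cball 0 1 \<and> (\<forall>z\<in>cball 0 1. g z \<noteq> 0)"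

lemma analytic_unit_inverse: "analytic_unit g \<Longrightarrow> analytic_unit (\<lambda>z. 1 / g z)"
  unfolding analytic_unit_def by (auto intro!: analytic_intros)

lemma mult_L2_inverse:
  assumes "analytic_unit g"
  shows "mult_L2 g (mult_L2 (\<lambda>z. 1 / g z) f) = f" "mult_L2 (\<lambda>z. 1 / g z) (mult_L2 g f) = f"
proof -
  have g: "g analytic_on cball 0 1" "(\<lambda>z. 1 / g z) analytic_on cball 0 1" "\<And>z. cmod z = 1 \<Longrightarrow> g z \<noteq> 0"
    using assms analytic_unit_inverse[OF assms] by (auto simp: analytic_unit_def)
  show "mult_L2 g (mult_L2 (\<lambda>z. 1 / g z) f) = f" "mult_L2 (\<lambda>z. 1 / g z) (mult_L2 g f) = f"
    using g by (auto simp: mult_L2_mult continuous_on_sphere_analytic intro!: mult_L2_one)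
qed

lemma mult_unit_in_hardy: "analytic_unit g \<Longrightarrow> f \<in> hardy \<Longrightarrow> mult_L2 g f \<in> hardy"
  by (simp add: analytic_unit_def mult_analytic_in_hardy)

definition coanalytic_unit :: "(complex \<Rightarrow> complex) \<Rightarrow> bool" where
  "coanalytic_unit u \<longleftrightarrow> coanalytic u \<and> coanalytic (\<lambda>z. 1 / u z) \<and> (\<forall>z\<in>sphere 0 1. u z \<noteq> 0)"

lemma coanalytic_unit_inverse: "coanalytic_unit u \<Longrightarrow> coanalytic_unit (\<lambda>z. 1 / u z)"
  by (simp add: coanalytic_unit_def)

lemma toeplitz_inverse:
  assumes "coanalytic_unit u" "f \<in> hardy"
  shows "toeplitz u (toeplitz (\<lambda>z. 1 / u z) f) = f" "toeplitz (\<lambda>z. 1 / u z) (toeplitz u f) = f"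
  using assms by (auto simp: coanalytic_unit_def toeplitz_one simp flip: toeplitz_mult)

text \<open>The determinants of the multiplicative commutator of the Toeplitz operators of \<open>u\<close> and \<open>g\<close> in both orders.
  Keeping both makes the statement stable under passing from \<open>u\<close> to its inverse.\<close>

definition comm_det :: "(complex \<Rightarrow> complex) \<Rightarrow> (complex \<Rightarrow> complex) \<Rightarrow> complex \<Rightarrow> bool" where
  "comm_det u g d \<longleftrightarrow> coanalytic_unit u \<and> analytic_unit g \<and>
     has_det (\<lambda>f. toeplitz u (mult_L2 g (toeplitz (\<lambda>z. 1 / u z) (mult_L2 (\<lambda>z. 1 / g z) f)))) d \<and>
     has_det (\<lambda>f. mult_L2 g (toeplitz u (mult_L2 (\<lambda>z. 1 / g z) (toeplitz (\<lambda>z. 1 / u z) f)))) (1 / d)"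

lemma has_det_conjugate_toeplitz:
  assumes "has_det T d" "coanalytic_unit u"
  shows "has_det (\<lambda>f. toeplitz u (T (toeplitz (\<lambda>z. 1 / u z) f))) d"
  using assms(2)
  by (intro has_det_conjugate[OF assms(1)])
    (auto simp: coanalytic_unit_def hardy_op_toeplitz toeplitz_inverse[OF assms(2)])

text \<open>\<open>u\<^sup>-\<^sup>1 g u g\<^sup>-\<^sup>1\<close> is the conjugate by \<open>u\<^sup>-\<^sup>1\<close> of \<open>g u g\<^sup>-\<^sup>1 u\<^sup>-\<^sup>1\<close>.\<close>

lemma comm_det_inverse:
  assumes "comm_det u g d"
  shows "comm_det (\<lambda>z. 1 / u z) g (1 / d)"
proof -
  have u: "coanalytic_unit u" and g: "analytic_unit g" using assms by (auto simp: comm_det_def)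
  note g' = analytic_unit_inverse[OF g] and u' = coanalytic_unit_inverse[OF u]
  have H: "toeplitz u f \<in> hardy" "toeplitz (\<lambda>z. 1 / u z) f \<in> hardy" 
     "mult_L2 g f \<in> hardy" "mult_L2 (\<lambda>z. 1 / g z) f \<in> hardy" if "f \<in> hardy" for f
    using u that mult_unit_in_hardy g g' by (auto simp: coanalytic_unit_def toeplitz_in_hardy)
  have 1: "has_det (\<lambda>f. toeplitz u (mult_L2 g (toeplitz (\<lambda>z. 1 / u z) (mult_L2 (\<lambda>z. 1 / g z) f)))) d"
    and 2: "has_det (\<lambda>f. mult_L2 g (toeplitz u (mult_L2 (\<lambda>z. 1 / g z) (toeplitz (\<lambda>z. 1 / u z) f)))) (1 / d)"
    using assms by (auto simp: comm_det_def)
  have 3: "has_det (\<lambda>f. toeplitz (\<lambda>z. 1 / u z) (mult_L2 g (toeplitz u (mult_L2 (\<lambda>z. 1 / g z) f)))) (1 / d)"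
    using has_det_conjugate_toeplitz[OF 2 u'] 
    by (rule has_det_cong) (simp add: H toeplitz_inverse[OF u])
  have 4: "has_det (\<lambda>f. mult_L2 g (toeplitz (\<lambda>z. 1 / u z) (mult_L2 (\<lambda>z. 1 / g z) (toeplitz u f)))) d"
    using has_det_conjugate_toeplitz[OF 1 u'] 
    by (rule has_det_cong) (simp add: H toeplitz_inverse[OF u])
  show ?thesis using 3 4 u' g by (simp add: comm_det_def)
qed

lemma coanalytic_unit_mult:
  "coanalytic_unit u \<Longrightarrow> coanalytic_unit v \<Longrightarrow> coanalytic_unit (\<lambda>z. u z * v z)"
  using coanalytic_mult[of u v] coanalytic_mult[of "\<lambda>z. 1 / u z" "\<lambda>z. 1 / v z"]
  by (auto simp: coanalytic_unit_def)

text \<open>With \<open>[u, g] = u g u\<^sup>-\<^sup>1 g\<^sup>-\<^sup>1\<close> one has \<open>[u v, g] = u [v, g] u\<^sup>-\<^sup>1 [u, g]\<close> and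
  \<open>[g, u v] = [g, u] u [g, v] u\<^sup>-\<^sup>1\<close>. The conjugations are by coanalytic operators, whose adjoints are
  multiplications by analytic functions.\<close>

lemma comm_det_mult:
  assumes "comm_det u g d" "comm_det v g e"
  shows "comm_det (\<lambda>z. u z * v z) g (d * e)"
proof -
  have u: "coanalytic_unit u" and v: "coanalytic_unit v" and g: "analytic_unit g" 
    using assms by (auto simp: comm_det_def)
  note g' = analytic_unit_inverse[OF g] and uv = coanalytic_unit_mult[OF u v]
  have uc: "coanalytic u" "coanalytic (\<lambda>z. 1 / u z)" "coanalytic v" "coanalytic (\<lambda>z. 1 / v z)"
    using u v by (auto simp: coanalytic_unit_def)
  note gi = mult_L2_inverse[OF g]
  have H: "toeplitz u f \<in> hardy" "toeplitz (\<lambda>z. 1 / u z) f \<in> hardy" 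
     "toeplitz v f \<in> hardy" "toeplitz (\<lambda>z. 1 / v z) f \<in> hardy" 
     "mult_L2 g f \<in> hardy" "mult_L2 (\<lambda>z. 1 / g z) f \<in> hardy" if "f \<in> hardy" for f
    using u v that mult_unit_in_hardy g g' by (auto simp: coanalytic_unit_def toeplitz_in_hardy)
  have T: "toeplitz (\<lambda>z. u z * v z) f = toeplitz u (toeplitz v f)"
    "toeplitz (\<lambda>z. 1 / (u z * v z)) f = toeplitz (\<lambda>z. 1 / v z) (toeplitz (\<lambda>z. 1 / u z) f)"
    if "f \<in> hardy" for f
    using toeplitz_mult[OF uc(1,3) that] toeplitz_mult[OF uc(4,2) that] 
    by (simp_all add: mult.commute)
  have 1: "has_det (\<lambda>f. toeplitz u (mult_L2 g (toeplitz (\<lambda>z. 1 / u z) (mult_L2 (\<lambda>z. 1 / g z) f)))) d"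
    and 2: "has_det (\<lambda>f. mult_L2 g (toeplitz u (mult_L2 (\<lambda>z. 1 / g z) (toeplitz (\<lambda>z. 1 / u z) f)))) (1 / d)"
    and 3: "has_det (\<lambda>f. toeplitz v (mult_L2 g (toeplitz (\<lambda>z. 1 / v z) (mult_L2 (\<lambda>z. 1 / g z) f)))) e"
    and 4: "has_det (\<lambda>f. mult_L2 g (toeplitz v (mult_L2 (\<lambda>z. 1 / g z) (toeplitz (\<lambda>z. 1 / v z) f)))) (1 / e)"
    using assms by (auto simp: comm_det_def)
  have 5: "has_det (\<lambda>f. toeplitz (\<lambda>z. u z * v z) (mult_L2 g (toeplitz (\<lambda>z. 1 / (u z * v z)) 
      (mult_L2 (\<lambda>z. 1 / g z) f)))) (e * d)"
    using has_det_compose[OF has_det_conjugate_toeplitz[OF 3 u] 1]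
    by (rule has_det_cong) (simp add: H T toeplitz_inverse[OF u] gi)
  have 6: "has_det (\<lambda>f. mult_L2 g (toeplitz (\<lambda>z. u z * v z) (mult_L2 (\<lambda>z. 1 / g z) 
      (toeplitz (\<lambda>z. 1 / (u z * v z)) f)))) (1 / d * (1 / e))"
    using has_det_compose[OF 2 has_det_conjugate_toeplitz[OF 4 u]]
    by (rule has_det_cong) (simp add: H T toeplitz_inverse[OF u] gi)
  show ?thesis using 5 6 uv g by (simp add: comm_det_def mult.commute)
qed

lemma comm_det_one:
  assumes g: "analytic_unit g"
  shows "comm_det (\<lambda>_. 1) g 1"
  unfolding comm_det_def
  using g mult_unit_in_hardy[OF analytic_unit_inverse[OF g]] mult_unit_in_hardy[OF g]
  by (auto intro!: has_det_cong[OF has_det_id] simp: coanalytic_unit_def coanalytic_one toeplitz_one mult_L2_inverse[OF g])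

text \<open>The commutator is \<open>1 - (a / g(a)) \<langle>-, k\<^sub>a\<rangle> q\<close>, where \<open>k\<^sub>a\<close> is the kernel at \<open>a\<close> and \<open>q = (g - g(0)) / z\<close>. Its determinant is
  \<open>1 - a q(a) / g(a) = g(0) / g(a)\<close>.\<close>

lemma comm_det_factor:
  assumes g: "analytic_unit g" and a: "cmod a < 1"
  shows "comm_det (\<lambda>z. 1 - a / z) g (g 0 / g a)"
proof -
  note g' = analytic_unit_inverse[OF g]
  have ga: "g analytic_on cball 0 1" "(\<lambda>z. 1 / g z) analytic_on cball 0 1" 
    using g g' by (auto simp: analytic_unit_def)
  have gz: "g a \<noteq> 0" "g 0 \<noteq> 0" using g a by (auto simp: analytic_unit_def)
  let ?q = "abs_L2 (difference_quotient g)" and ?q' = "abs_L2 (difference_quotient (\<lambda>z. 1 / g z))"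
  have q: "?q \<in> hardy" "?q' \<in> hardy" 
    by (intro analytic_in_hardy analytic_difference_quotient ga)+
  have "has_det (\<lambda>f. toeplitz (\<lambda>z. 1 - a / z) (mult_L2 g (toeplitz (\<lambda>z. 1 / (1 - a / z)) (mult_L2 (\<lambda>z. 1 / g z) f))))
     (1 + cinner ?q (cnj (- a / g a) *\<^sub>C szego_kernel a))"
  proof (rule has_det_rank_one)
    fix f assume f: "f \<in> hardy"
    show "toeplitz (\<lambda>z. 1 - a / z) (mult_L2 g (toeplitz (\<lambda>z. 1 / (1 - a / z)) (mult_L2 (\<lambda>z. 1 / g z) f)))
      = f + cinner f (cnj (- a / g a) *\<^sub>C szego_kernel a) *\<^sub>C ?q"
      by (simp add: conjugate_mult_by_factor[OF a ga(1) mult_unit_in_hardy[OF g' f]] mult_L2_inverse[OF g]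
         cinner_mult_kernel[OF ga(2) f a] cinner_scaleC_right cinner_minus_right scaleC_minus_left)
  qed (intro q hardy_scaleC szego_kernel_in_hardy a)+
  moreover have "1 + cinner ?q (cnj (- a / g a) *\<^sub>C szego_kernel a) = g 0 / g a"
    using gz by (simp add: cinner_scaleC_right cinner_kernel[OF analytic_difference_quotient[OF ga(1)] a]
       difference_quotient_def field_simps)
  moreover have "has_det (\<lambda>f. mult_L2 g (toeplitz (\<lambda>z. 1 - a / z) (mult_L2 (\<lambda>z. 1 / g z) (toeplitz (\<lambda>z. 1 / (1 - a / z)) f))))
     (1 + cinner (mult_L2 g ?q') (cnj (- a) *\<^sub>C szego_kernel a))"
  proof (rule has_det_rank_one)
    fix f assume f: "f \<in> hardy"
    note gc = continuous_on_sphere_analytic[OF ga(1)]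
    show "mult_L2 g (toeplitz (\<lambda>z. 1 - a / z) (mult_L2 (\<lambda>z. 1 / g z) (toeplitz (\<lambda>z. 1 / (1 - a / z)) f)))
      = f + cinner f (cnj (- a) *\<^sub>C szego_kernel a) *\<^sub>C mult_L2 g ?q'"
      by (simp add: conjugate_mult_by_factor[OF a ga(2) f] mult_L2_inverse[OF g] mult_L2_diff[OF gc]
         mult_L2_scaleC[OF gc] cinner_scaleC_right cinner_minus_right scaleC_minus_left)
  qed (intro q hardy_scaleC szego_kernel_in_hardy a mult_unit_in_hardy[OF g])+
  moreover have "1 + cinner (mult_L2 g ?q') (cnj (- a) *\<^sub>C szego_kernel a) = 1 / (g 0 / g a)"
    using gz by (simp add: cinner_scaleC_right cinner_mult_kernel[OF ga(1) q(2) a]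
       cinner_kernel[OF analytic_difference_quotient[OF ga(2)] a] difference_quotient_def field_simps)
  ultimately show ?thesis
    using coanalytic_factor[OF a] coanalytic_inverse_factor[OF a] g a
    by (auto simp: comm_det_def coanalytic_unit_def dest: factor_nonzero)
qed

lemma comm_det_powi:
  assumes "comm_det u g d"
  shows "comm_det (\<lambda>z. u z powi m) g (d powi m)"
proof -
  have g: "analytic_unit g" using assms by (simp add: comm_det_def)
  have pow: "comm_det (\<lambda>z. u z ^ n) g (d ^ n)" for n
    by (induction n) (simp_all add: comm_det_one[OF g] comm_det_mult[OF assms])
  show ?thesis
  proof (cases "m \<ge> 0")
    case True
    then show ?thesis using pow[of "nat m"] by (simp add: power_int_def)
  next
    case False
    then show ?thesis using comm_det_inverse[OF pow[of "nat (- m)"]] 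
      by (simp add: power_int_def field_simps)
  qed
qed

lemma comm_det_prod:
  assumes "finite Z" "analytic_unit g" "\<And>a. a \<in> Z \<Longrightarrow> comm_det (u a) g (d a)"
  shows "comm_det (\<lambda>z. \<Prod>a\<in>Z. u a z) g (\<Prod>a\<in>Z. d a)"
  using assms(1,3)
  by (induction Z rule: finite_induct) (simp_all add: comm_det_one[OF assms(2)] comm_det_mult)

lemma toeplitz_unit_mult:
  assumes u: "coanalytic_unit u" and g: "analytic_unit g" and f: "f \<in> hardy"
    and eq: "\<And>z. cmod z = 1 \<Longrightarrow> \<phi> z = u z * g z"
  shows "toeplitz \<phi> f = toeplitz u (mult_L2 g f)"
proof -
  have "toeplitz \<phi> f = toeplitz (\<lambda>z. u z * g z) f"
  proof (rule toeplitz_cong[symmetric])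
    have "continuous_on (sphere 0 1) u" "continuous_on (sphere 0 1) g"
      using u g continuous_on_sphere_analytic by (auto simp: coanalytic_unit_def coanalytic_def analytic_unit_def)
    then show "continuous_on (sphere 0 1) (\<lambda>z. u z * g z)" by (rule continuous_on_mult)
  qed (simp add: eq)
  also have "\<dots> = toeplitz u (mult_L2 g f)"
    using u g f by (intro toeplitz_mult_analytic) (auto simp: coanalytic_unit_def analytic_unit_def)
  finally show ?thesis .
qed

lemma toeplitz_bij_betw:
  assumes u: "coanalytic_unit u" and g: "analytic_unit g" 
    and eq: "\<And>z. cmod z = 1 \<Longrightarrow> \<phi> z = u z * g z"
  shows "bij_betw (toeplitz \<phi>) hardy hardy" (is ?bij)
    and "f \<in> hardy \<Longrightarrow> inv_into hardy (toeplitz \<phi>) f = mult_L2 (\<lambda>z. 1 / g z) (toeplitz (\<lambda>z. 1 / u z) f)"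
proof -
  let ?inv = "\<lambda>f. mult_L2 (\<lambda>z. 1 / g z) (toeplitz (\<lambda>z. 1 / u z) f)"
  note g' = analytic_unit_inverse[OF g]
  note T = toeplitz_unit_mult[OF u g _ eq]
  have H: "toeplitz u f \<in> hardy" "toeplitz (\<lambda>z. 1 / u z) f \<in> hardy" 
     "mult_L2 g f \<in> hardy" "mult_L2 (\<lambda>z. 1 / g z) f \<in> hardy" if "f \<in> hardy" for f
    using u that mult_unit_in_hardy g g' by (auto simp: coanalytic_unit_def toeplitz_in_hardy)
  note inv = toeplitz_inverse[OF u] mult_L2_inverse[OF g]
  show bij: ?bij
    by (rule bij_betwI[where g = ?inv]) (auto simp: T H inv)
  show "inv_into hardy (toeplitz \<phi>) f = ?inv f" if f: "f \<in> hardy"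
    using bij f by (intro inv_into_f_eq) (auto simp: T H inv bij_betw_def)
qed

text \<open>With \<open>a\<close>, \<open>A\<close>, \<open>b\<close>, \<open>B\<close> also denoting the operators, the commutator is
  \<open>a A b B A\<^sup>-\<^sup>1 a\<^sup>-\<^sup>1 B\<^sup>-\<^sup>1 b\<^sup>-\<^sup>1 = a [A, b] a\<^sup>-\<^sup>1 \<cdot> b [a, B] b\<^sup>-\<^sup>1\<close>,
  because \<open>a\<close> commutes with \<open>b\<close> and \<open>A\<close> with \<open>B\<close>.\<close>

theorem toeplitz_commutator_det:
  assumes \<phi>: "\<And>z. cmod z = 1 \<Longrightarrow> \<phi> z = a z * A z" and \<psi>: "\<And>z. cmod z = 1 \<Longrightarrow> \<psi> z = b z * B z"
    and aB: "comm_det a B d" and bA: "comm_det b A e"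
  shows "has_det (toeplitz \<phi> \<circ> toeplitz \<psi> \<circ>
     inv_into hardy (toeplitz \<phi>) \<circ> inv_into hardy (toeplitz \<psi>)) (d / e)"
proof -
  have a: "coanalytic_unit a" and b: "coanalytic_unit b" and A: "analytic_unit A" and B: "analytic_unit B"
    using aB bA by (auto simp: comm_det_def)
  note H = toeplitz_in_hardy mult_unit_in_hardy
  note A' = analytic_unit_inverse[OF A] and B' = analytic_unit_inverse[OF B]
  have ac: "coanalytic a" "coanalytic (\<lambda>z. 1 / a z)" "coanalytic b" "coanalytic (\<lambda>z. 1 / b z)"
    using a b by (auto simp: coanalytic_unit_def)
  have H: "toeplitz a f \<in> hardy" "toeplitz (\<lambda>z. 1 / a z) f \<in> hardy" 
     "toeplitz b f \<in> hardy" "toeplitz (\<lambda>z. 1 / b z) f \<in> hardy" 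
     "mult_L2 A f \<in> hardy" "mult_L2 (\<lambda>z. 1 / A z) f \<in> hardy"
     "mult_L2 B f \<in> hardy" "mult_L2 (\<lambda>z. 1 / B z) f \<in> hardy" if "f \<in> hardy" for f
    using ac that mult_unit_in_hardy[OF _ that] A B A' B' by (auto simp: toeplitz_in_hardy)
  note inv = toeplitz_inverse[OF a] toeplitz_inverse[OF b] mult_L2_inverse[OF A] mult_L2_inverse[OF B]
  have 1: "has_det (\<lambda>f. toeplitz a (mult_L2 B (toeplitz (\<lambda>z. 1 / a z) (mult_L2 (\<lambda>z. 1 / B z) f)))) d"
    using aB by (simp add: comm_det_def)
  have 2: "has_det (\<lambda>f. mult_L2 A (toeplitz b (mult_L2 (\<lambda>z. 1 / A z) (toeplitz (\<lambda>z. 1 / b z) f)))) (1 / e)"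
    using bA by (simp add: comm_det_def)
  have comm: "toeplitz b (toeplitz a f) = toeplitz a (toeplitz b f)" if "f \<in> hardy" for f
    using toeplitz_mult[OF ac(1,3) that] toeplitz_mult[OF ac(3,1) that] by (simp add: mult.commute)
  have comm': "mult_L2 (\<lambda>z. 1 / A z) (mult_L2 B f) = mult_L2 B (mult_L2 (\<lambda>z. 1 / A z) f)" for f
    using A' B by (simp add: mult_L2_mult analytic_unit_def continuous_on_sphere_analytic mult.commute)
  have "has_det (\<lambda>f. toeplitz a (mult_L2 A (toeplitz b (mult_L2 (\<lambda>z. 1 / A z) (toeplitz (\<lambda>z. 1 / b z) 
     (toeplitz (\<lambda>z. 1 / a z)
     (toeplitz b (toeplitz a (mult_L2 B (toeplitz (\<lambda>z. 1 / a z) (mult_L2 (\<lambda>z. 1 / B z) 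
       (toeplitz (\<lambda>z. 1 / b z) f)))))))))))) (1 / e * d)"
    by (rule has_det_compose[OF has_det_conjugate_toeplitz[OF 2 a] has_det_conjugate_toeplitz[OF 1 b]])
  then have "has_det (toeplitz \<phi> \<circ> toeplitz \<psi> \<circ>
     inv_into hardy (toeplitz \<phi>) \<circ> inv_into hardy (toeplitz \<psi>)) (1 / e * d)"
  proof (rule has_det_cong)
    fix f assume f: "f \<in> hardy"
    show "(toeplitz \<phi> \<circ> toeplitz \<psi> \<circ>
     inv_into hardy (toeplitz \<phi>) \<circ> inv_into hardy (toeplitz \<psi>)) f
     = toeplitz a (mult_L2 A (toeplitz b (mult_L2 (\<lambda>z. 1 / A z) (toeplitz (\<lambda>z. 1 / b z) 
     (toeplitz (\<lambda>z. 1 / a z)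
     (toeplitz b (toeplitz a (mult_L2 B (toeplitz (\<lambda>z. 1 / a z) (mult_L2 (\<lambda>z. 1 / B z) 
       (toeplitz (\<lambda>z. 1 / b z) f)))))))))))"
      using f
      by (simp add: toeplitz_bij_betw(2)[OF a A \<phi>] toeplitz_bij_betw(2)[OF b B \<psi>]
          toeplitz_unit_mult[OF a A _ \<phi>] toeplitz_unit_mult[OF b B _ \<psi>] H inv comm comm')
  qed
  then show ?thesis by simp
qed

section \<open>Factorization of meromorphic symbols\<close>

text \<open>Dividing out the finitely many zeros and poles in the open disc leaves a function with removable
  singularities and without zeros in the closed disc. The orders add up to the winding number by the argument
  principle.\<close>

theorem meromorphic_factorization:
  fixes \<phi> :: "complex \<Rightarrow> complex"
  assumes U: "open U" "cball 0 1 \<subseteq> U" and mero: "\<phi> nicely_meromorphic_on U"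
    and nz: "\<forall>z\<in>sphere 0 1. \<phi> z \<noteq> 0 \<and> \<not> is_pole \<phi> z"
    and wind: "winding_number (\<phi> \<circ> circlepath 0 1) 0 = 0"
  obtains Z g where "finite Z" "Z \<subseteq> ball 0 1" "analytic_unit g"
    "\<And>z. z \<in> cball 0 1 - Z \<Longrightarrow> \<phi> z = g z * (\<Prod>a\<in>Z. (z - a) powi zorder \<phi> a)"
    "\<And>z. z \<in> ball 0 1 - Z \<Longrightarrow> zorder \<phi> z = 0"
    "(\<Sum>a\<in>Z. zorder \<phi> a) = 0"
proof -
  obtain R where R: "R > 1" "ball 0 R \<subseteq> U" by (rule open_contains_larger_disc[OF U])
  define r where "r = (1 + R) / 2"
  have r: "1 < r" "r < R" using R by (auto simp: r_def)
  \<comment> \<open>a nicely meromorphic function has the value \<open>0\<close> at its poles, so these sets contain the poles too\<close>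
  define P where "P = {w \<in> ball 0 r. \<phi> w = 0}"
  define Z where "Z = {w \<in> ball 0 1. \<phi> w = 0}"
  have mR: "\<phi> nicely_meromorphic_on ball 0 R" using mero R(2) by (rule nicely_meromorphic_on_subset)
  have mer: "\<phi> meromorphic_on ball 0 R" using mR by (simp add: nicely_meromorphic_on_def)
  have "\<forall>\<^sub>\<approx>x\<in>ball 0 R. \<phi> x \<noteq> 0"
  proof -
    have "(\<forall>x\<in>ball 0 R. \<phi> x = 0) \<or> (\<forall>\<^sub>\<approx>x\<in>ball 0 R. \<phi> x \<noteq> 0)"
      by (rule nicely_meromorphic_imp_constant_or_avoid[OF mR]) auto
    moreover have "(1::complex) \<in> ball 0 R" "\<phi> 1 \<noteq> 0" using R nz by auto
    ultimately show ?thesis by blast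
  qed
  then have sparse: "{x. \<phi> x = 0} sparse_in ball 0 R" and
    ev: "\<And>z. z \<in> ball 0 R \<Longrightarrow> \<forall>\<^sub>F w in at z. \<phi> w \<noteq> 0"
    by (auto simp: eventually_cosparse intro: eventually_cosparse_imp_eventually_at)
  have "finite (cball 0 r \<inter> {x. \<phi> x = 0})"
    by (rule sparse_in_compact_finite[OF sparse_in_subset[OF sparse]]) (use r in auto)
  then have finP: "finite P" unfolding P_def by (rule finite_subset[rotated]) auto
  then have finZ: "finite Z" unfolding P_def Z_def by (rule finite_subset[rotated]) (use r in auto)
  have pole0: "\<phi> z = 0" if "is_pole \<phi> z" "z \<in> ball 0 R" for z
  proof (rule ccontr)
    assume "\<phi> z \<noteq> 0"
    then have "\<phi> \<midarrow>z\<rightarrow> \<phi> z" using mR that(2) by (auto simp: nicely_meromorphic_on_def)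
    then show False using that(1) not_tendsto_and_filterlim_at_infinity[of "at z" \<phi>]
      by (simp add: is_pole_def)
  qed
  have ana: "\<phi> analytic_on {z}" if "z \<in> ball 0 R" "\<phi> z \<noteq> 0" for z
    using nicely_meromorphic_on_imp_analytic_at[OF mR that(1)] pole0[OF _ that(1)] that(2) by blast
  have sing: "isolated_singularity_at \<phi> z" "not_essential \<phi> z" "\<exists>\<^sub>F w in at z. \<phi> w \<noteq> 0"
    if "z \<in> ball 0 R" for z
  proof -
    have "\<phi> meromorphic_on {z}" using mer by (rule meromorphic_on_subset) (use that in auto)
    then show "isolated_singularity_at \<phi> z" "not_essential \<phi> z" by (auto simp: meromorphic_at_iff)
    show "\<exists>\<^sub>F w in at z. \<phi> w \<noteq> 0" by (intro eventually_frequently ev[OF that]) auto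
  qed
  \<comment> \<open>at the points of \<open>Z\<close> the default values of \<open>h\<close> are wrong and are repaired by \<^const>\<open>remove_sings\<close>\<close>
  define h where "h z = \<phi> z * (\<Prod>a\<in>Z. (z - a) powi (- zorder \<phi> a))" for z
  have h_iso: "isolated_singularity_at h z" if "z \<in> cball 0 1" for z
  proof -
    have "\<phi> meromorphic_on {z}" using mer by (rule meromorphic_on_subset) (use that R in auto)
    then have "h meromorphic_on {z}" unfolding h_def by (intro meromorphic_intros)
    then show ?thesis by (simp add: meromorphic_at_iff)
  qed
  have h_lim: "\<exists>c. c \<noteq> 0 \<and> h \<midarrow>z\<rightarrow> c" if z: "z \<in> cball 0 1" for z
  proof (cases "z \<in> Z")
    case True
    have zR: "z \<in> ball 0 R" using z R by auto
    define q where "q = zor_poly \<phi> z"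
    from zorder_exist[OF sing[OF zR]] obtain e where q: "q z \<noteq> 0" "e > 0" "q holomorphic_on cball z e"
      "\<forall>w\<in>cball z e - {z}. \<phi> w = q w * (w - z) powi zorder \<phi> z \<and> q w \<noteq> 0"
      unfolding q_def by blast
    let ?k = "\<lambda>w. q w * (\<Prod>a\<in>Z - {z}. (w - a) powi (- zorder \<phi> a))"
    have "\<forall>\<^sub>F w in at z. w \<in> ball z e - {z}"
      using q(2) by (intro eventually_at_in_open) auto
    then have "\<forall>\<^sub>F w in at z. ?k w = h w"
    proof eventually_elim
      case (elim w)
      then have "\<phi> w = q w * (w - z) powi zorder \<phi> z" and "w \<noteq> z" using q(4) by auto
      moreover have "(\<Prod>a\<in>Z. (w - a) powi (- zorder \<phi> a)) 
          = (w - z) powi (- zorder \<phi> z) * (\<Prod>a\<in>Z - {z}. (w - a) powi (- zorder \<phi> a))"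
        by (rule prod.remove[OF finZ True])
      ultimately show ?case by (simp add: h_def power_int_minus)
    qed
    moreover have "isCont q z"
      by (rule continuous_on_interior[OF holomorphic_on_imp_continuous_on[OF q(3)]]) (use q(2) in simp)
    then have "?k \<midarrow>z\<rightarrow> ?k z"
      by (intro tendsto_intros) (auto simp: isCont_def)
    ultimately have "h \<midarrow>z\<rightarrow> ?k z" by (rule Lim_transform_eventually[rotated])
    moreover have "?k z \<noteq> 0" using q(1) finZ by auto
    ultimately show ?thesis by blast
  next
    case False
    have zR: "z \<in> ball 0 R" using z R by auto
    have "\<phi> z \<noteq> 0" using False z nz by (cases "cmod z = 1") (auto simp: Z_def)
    then have "\<phi> \<midarrow>z\<rightarrow> \<phi> z" using analytic_at_imp_isCont[OF ana[OF zR]] by (simp add: isCont_def)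
    then have "h \<midarrow>z\<rightarrow> h z" unfolding h_def using False by (intro tendsto_intros) auto
    moreover have "h z \<noteq> 0" using \<open>\<phi> z \<noteq> 0\<close> False finZ by (auto simp: h_def)
    ultimately show ?thesis by blast
  qed
  define g where "g = remove_sings h"
  have g: "analytic_unit g"
    unfolding analytic_unit_def
  proof
    have "g analytic_on {z}" if "z \<in> cball 0 1" for z
      unfolding g_def using h_lim[OF that] remove_sings_analytic_at[OF h_iso[OF that]] by blast
    then show "g analytic_on cball 0 1" using analytic_on_analytic_at by blast
    show "\<forall>z\<in>cball 0 1. g z \<noteq> 0"
      unfolding g_def using h_lim remove_sings_eqI by metis
  qed
  have nzZ: "\<phi> z \<noteq> 0" if "z \<in> cball 0 1 - Z" for z
    using that nz by (cases "cmod z = 1") (auto simp: Z_def)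
  have fact: "\<phi> z = g z * (\<Prod>a\<in>Z. (z - a) powi zorder \<phi> a)" if z: "z \<in> cball 0 1 - Z" for z
  proof -
    have "z \<in> ball 0 R" using z R by auto
    from analytic_at_imp_isCont[OF ana[OF this nzZ[OF z]]] have "\<phi> \<midarrow>z\<rightarrow> \<phi> z" by (simp add: isCont_def)
    then have "h \<midarrow>z\<rightarrow> h z" unfolding h_def using z by (intro tendsto_intros) auto
    then have "g z = h z" unfolding g_def by (rule remove_sings_eqI)
    moreover have "(\<Prod>a\<in>Z. (z - a) powi (- zorder \<phi> a)) * (\<Prod>a\<in>Z. (z - a) powi zorder \<phi> a) = 1"
      unfolding prod.distrib[symmetric] using z by (intro prod.neutral) (auto simp: power_int_minus intro!: left_inverse)
    ultimately show ?thesis by (simp add: h_def mult.assoc)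
  qed
  have ord0: "zorder \<phi> z = 0" if z: "z \<in> ball 0 1 - Z" for z
  proof -
    have zR: "z \<in> ball 0 R" using z R by auto
    have nz': "\<phi> z \<noteq> 0" using nzZ z by auto
    from ana[OF zR nz'] obtain S where S: "open S" "z \<in> S" "\<phi> holomorphic_on S"
      by (auto simp: analytic_at)
    show ?thesis by (rule zorder_eqI[OF S nz']) simp
  qed
  have sum0: "(\<Sum>a\<in>Z. zorder \<phi> a) = 0"
  proof -
    let ?\<gamma> = "circlepath 0 (1::real)"
    define poles where "poles = {z. is_pole \<phi> z}"
    have pz: "{w \<in> ball 0 r. \<phi> w = 0 \<or> w \<in> poles} = P"
      using pole0 r by (auto simp: P_def poles_def)
    have img: "path_image ?\<gamma> = sphere 0 1" by simp
    have "contour_integral ?\<gamma> (\<lambda>x. deriv \<phi> x * 1 / \<phi> x) = 2 * pi * \<i> *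
          (\<Sum>p\<in>{w \<in> ball 0 r. \<phi> w = 0 \<or> w \<in> poles}. winding_number ?\<gamma> p * 1 * zorder \<phi> p)"
    proof (rule argument_principle)
      show "\<phi> holomorphic_on ball 0 r - poles"
      proof -
        have "\<phi> analytic_on {z}" if "z \<in> ball 0 r - poles" for z
          using nicely_meromorphic_on_imp_analytic_at[OF mR] that r by (auto simp: poles_def)
        then show ?thesis by (meson analytic_imp_holomorphic analytic_on_analytic_at)
      qed
      show "path_image ?\<gamma> \<subseteq> ball 0 r - {w \<in> ball 0 r. \<phi> w = 0 \<or> w \<in> poles}"
        unfolding img using nz r by (auto simp: poles_def)
      show "\<forall>z. z \<notin> ball 0 r \<longrightarrow> winding_number ?\<gamma> z = 0"
      proof (intro allI impI)
        fix z :: complex assume "z \<notin> ball 0 r"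
        then show "winding_number ?\<gamma> z = 0"
          using r by (intro winding_number_zero_outside[of _ "ball 0 r"]) auto
      qed
      show "finite {w \<in> ball 0 r. \<phi> w = 0 \<or> w \<in> poles}" unfolding pz by (rule finP)
    qed (auto simp: poles_def)
    moreover have "contour_integral ?\<gamma> (\<lambda>x. deriv \<phi> x * 1 / \<phi> x) = 0"
    proof -
      have an: "\<phi> analytic_on sphere 0 1"
        using ana nz R by (subst analytic_on_analytic_at) auto
      have vp: "valid_path (\<phi> \<circ> ?\<gamma>)"
        by (rule valid_path_compose_analytic[OF _ an]) (auto simp: img)
      have "0 \<notin> path_image (\<phi> \<circ> ?\<gamma>)"
        unfolding path_image_compose img using nz by auto
      from winding_number_valid_path[OF vp this] wind
      have "contour_integral (\<phi> \<circ> ?\<gamma>) (\<lambda>w. 1 / w) = 0" by simp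
      then show ?thesis
        by (subst (asm) contour_integral_comp_analyticW[OF an]) (auto simp: img)
    qed
    ultimately have "(\<Sum>p\<in>P. winding_number ?\<gamma> p * of_int (zorder \<phi> p)) = 0"
      unfolding pz by simp
    also have "(\<Sum>p\<in>P. winding_number ?\<gamma> p * of_int (zorder \<phi> p)) = (\<Sum>p\<in>Z. of_int (zorder \<phi> p))"
    proof (rule sum.mono_neutral_cong_right[OF finP])
      show "Z \<subseteq> P" using r by (auto simp: Z_def P_def)
      show "\<forall>p\<in>P - Z. winding_number ?\<gamma> p * of_int (zorder \<phi> p) = 0"
      proof
        fix p assume p: "p \<in> P - Z"
        then have "p \<notin> cball 0 1" using nzZ[of p] by (auto simp: P_def Z_def)
        then have "winding_number ?\<gamma> p = 0"
          by (intro winding_number_zero_outside[of _ "cball 0 1"]) auto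
        then show "winding_number ?\<gamma> p * of_int (zorder \<phi> p) = 0" by simp
      qed
      fix p assume "p \<in> Z"
      then show "winding_number ?\<gamma> p * of_int (zorder \<phi> p) = of_int (zorder \<phi> p)"
        by (subst winding_number_circlepath) (auto simp: Z_def)
    qed
    finally have "complex_of_int (\<Sum>a\<in>Z. zorder \<phi> a) = 0" by simp
    then show ?thesis unfolding of_int_eq_0_iff .
  qed
  show ?thesis
    by (rule that[OF finZ _ g fact ord0 sum0]) (auto simp: Z_def)
qed

section \<open>Reciprocity and the tame symbol\<close>

lemma prod_power_int: "x \<noteq> 0 \<Longrightarrow> (\<Prod>a\<in>A. x powi f a) = (x :: complex) powi (\<Sum>a\<in>A. f a)"
  by (induction A rule: infinite_finite_induct) (auto simp: power_int_add)

lemma prod_powi: "(\<Prod>a\<in>A. f a) powi k = (\<Prod>a\<in>A. (f a :: complex) powi k)"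
  by (induction A rule: infinite_finite_induct) (auto simp: power_int_mult_distrib)

text \<open>The contribution of the point \<open>b\<close> to the tame symbol at \<open>a\<close> of the rational functions with orders \<open>m\<close> and \<open>n\<close>.\<close>

definition reciprocity_factor :: "(complex \<Rightarrow> int) \<Rightarrow> (complex \<Rightarrow> int) \<Rightarrow> complex \<Rightarrow> complex \<Rightarrow> complex" where
  "reciprocity_factor m n a b = (if b = a then (-1) powi (m a * n a) else (a - b) powi (n b * m a - m b * n a))"

text \<open>Weil reciprocity for the rational functions \<open>\<Prod>(z - a)\<^sup>m\<^sup>(\<^sup>a\<^sup>)\<close> and \<open>\<Prod>(z - a)\<^sup>n\<^sup>(\<^sup>a\<^sup>)\<close>. Interchanging \<open>a\<close> and \<open>b\<close> cancels all
  differences up to the sign \<open>(-1)\<^sup>k\<close>, where \<open>k\<close> is \<open>\<Sum>m\<close> times \<open>\<Sum>n\<close>, which is zero.\<close>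

lemma prod_reciprocity_factor:
  assumes "(\<Sum>a\<in>Z. m a) = 0"
  shows "(\<Prod>a\<in>Z. \<Prod>b\<in>Z. reciprocity_factor m n a b) = 1"
proof -
  define F where "F a b = (if a = b then 1 else (a - b) powi (m a * n b))" for a b :: complex
  have F: "F a b \<noteq> 0" for a b by (simp add: F_def)
  have "reciprocity_factor m n a b = (-1) powi (m b * n a) * (F a b / F b a)" for a b
  proof (cases "a = b")
    case False
    let ?s = "(-1) powi (m b * n a) :: complex"
    have s: "1 / ?s = ?s" by (cases "even (m b * n a)") auto
    have "(a - b) powi (m b * n a) = ?s * (b - a) powi (m b * n a)"
      unfolding power_int_mult_distrib[symmetric] by simp
    then have "(a - b) powi (n b * m a - m b * n a) 
       = 1 / ?s * ((a - b) powi (m a * n b) / (b - a) powi (m b * n a))"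
      using False by (subst power_int_diff) (auto simp: mult.commute[of "n b"])
    then show ?thesis
      unfolding s using False by (simp add: reciprocity_factor_def F_def)
  qed (simp add: reciprocity_factor_def F_def)
  then have "(\<Prod>a\<in>Z. \<Prod>b\<in>Z. reciprocity_factor m n a b) 
      = (\<Prod>a\<in>Z. \<Prod>b\<in>Z. (-1) powi (m b * n a)) * ((\<Prod>a\<in>Z. \<Prod>b\<in>Z. F a b) / (\<Prod>a\<in>Z. \<Prod>b\<in>Z. F b a))"
    by (simp add: prod.distrib prod_dividef)
  also have "(\<Prod>a\<in>Z. \<Prod>b\<in>Z. F b a) = (\<Prod>a\<in>Z. \<Prod>b\<in>Z. F a b)"
    by (rule prod.swap)
  also have "(\<Prod>a\<in>Z. \<Prod>b\<in>Z. F a b) / (\<Prod>a\<in>Z. \<Prod>b\<in>Z. F a b) = 1"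
  proof -
    have "(\<Prod>a\<in>Z. \<Prod>b\<in>Z. F a b) \<noteq> 0"
      by (induction Z rule: infinite_finite_induct) (auto simp: F prod_zero_iff)
    then show ?thesis by simp
  qed
  also have "(\<Prod>a\<in>Z. \<Prod>b\<in>Z. (-1) powi (m b * n a)) = (1 :: complex)"
    by (simp add: prod_power_int assms flip: sum_distrib_right)
  finally show ?thesis by simp
qed

text \<open>The factors \<open>w - a\<close> cancel in \<open>\<psi>\<^sup>m / \<phi>\<^sup>n\<close>, so what remains is continuous at \<open>a\<close>.\<close>

lemma tame_symbol_eq:
  assumes Z: "finite Z" "a \<in> Z" and a: "a \<in> ball 0 1"
    and g: "isCont g a" "g a \<noteq> 0" and h: "isCont h a" "h a \<noteq> 0"
    and \<phi>: "\<And>z. z \<in> cball 0 1 - Z \<Longrightarrow> \<phi> z = g z * (\<Prod>b\<in>Z. (z - b) powi zorder \<phi> b)"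
    and \<psi>: "\<And>z. z \<in> cball 0 1 - Z \<Longrightarrow> \<psi> z = h z * (\<Prod>b\<in>Z. (z - b) powi zorder \<psi> b)"
  shows "tame_symbol \<phi> \<psi> a = h a powi zorder \<phi> a / g a powi zorder \<psi> a 
           * (\<Prod>b\<in>Z. reciprocity_factor (zorder \<phi>) (zorder \<psi>) a b)"
proof -
  define m where "m = zorder \<phi>"
  define n where "n = zorder \<psi>"
  let ?L = "h a powi m a / g a powi n a * (\<Prod>b\<in>Z. reciprocity_factor m n a b)"
  let ?f = "\<lambda>w. (-1) powi (m a * n a) * (h w powi m a / g w powi n a 
       * (\<Prod>b\<in>Z - {a}. (w - b) powi (n b * m a - m b * n a)))"
  have "\<forall>\<^sub>F w in at a. w \<in> (ball 0 1 - (Z - {a})) - {a}"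
    using Z a by (intro eventually_at_in_open open_Diff finite_imp_closed) auto
  then have "\<forall>\<^sub>F w in at a. ?f w = (-1) powi (m a * n a) * (\<psi> w powi m a / \<phi> w powi n a)"
  proof eventually_elim
    case (elim w)
    then have w: "w \<in> cball 0 1 - Z" using Z by auto
    have wb: "w - b \<noteq> 0" if "b \<in> Z" for b using w that by auto
    have pw: "(\<Prod>b\<in>Z. (w - b) powi k b) powi l = (\<Prod>b\<in>Z. (w - b) powi (k b * l))" for k l
      by (simp add: power_int_mult prod_powi)
    have "(\<Prod>b\<in>Z. (w - b) powi n b) powi m a / (\<Prod>b\<in>Z. (w - b) powi m b) powi n a
       = (\<Prod>b\<in>Z. (w - b) powi (n b * m a - m b * n a))"
      unfolding pw prod_dividef[symmetric]
      by (intro prod.cong refl) (subst power_int_diff, use wb in auto)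
    also have "\<dots> = (\<Prod>b\<in>Z - {a}. (w - b) powi (n b * m a - m b * n a))"
      by (subst prod.remove[OF Z]) (simp add: mult.commute)
    finally have "(\<Prod>b\<in>Z - {a}. (w - b) powi (n b * m a - m b * n a)) 
       = (\<Prod>b\<in>Z. (w - b) powi n b) powi m a / (\<Prod>b\<in>Z. (w - b) powi m b) powi n a" ..
    then show ?case
      unfolding \<phi>[OF w] \<psi>[OF w] m_def[symmetric] n_def[symmetric]
      by (simp add: power_int_mult_distrib)
  qed
  moreover have "?f \<midarrow>a\<rightarrow> ?f a"
    using g h by (intro tendsto_intros) (auto simp: isCont_def)
  ultimately have "(\<lambda>w. (-1) powi (m a * n a) * (\<psi> w powi m a / \<phi> w powi n a)) \<midarrow>a\<rightarrow> ?f a"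
    by (rule Lim_transform_eventually[rotated])
  then have "tame_symbol \<phi> \<psi> a = ?f a"
    unfolding tame_symbol_def m_def n_def by (intro tendsto_Lim) auto
  also have "(\<Prod>b\<in>Z - {a}. (a - b) powi (n b * m a - m b * n a)) = (\<Prod>b\<in>Z - {a}. reciprocity_factor m n a b)"
    by (intro prod.cong) (auto simp: reciprocity_factor_def)
  also have "(-1) powi (m a * n a) * (h a powi m a / g a powi n a * (\<Prod>b\<in>Z - {a}. reciprocity_factor m n a b)) = ?L"
    by (subst prod.remove[OF Z]) (simp add: reciprocity_factor_def)
  finally show ?thesis by (simp add: m_def n_def)
qed

lemma tame_symbol_eq_1: "zorder \<phi> z = 0 \<Longrightarrow> zorder \<psi> z = 0 \<Longrightarrow> tame_symbol \<phi> \<psi> z = 1"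
  by (simp add: tame_symbol_def tendsto_Lim)

text \<open>The values \<open>g(0)\<close> that come from the single factors cancel since the exponents add up to zero.\<close>

lemma comm_det_circle_factors:
  assumes Z: "finite Z" "Z \<subseteq> ball 0 1" and sum: "(\<Sum>a\<in>Z. m a) = 0" and g: "analytic_unit g"
  shows "comm_det (\<lambda>z. \<Prod>a\<in>Z. (1 - a / z) powi m a) g (\<Prod>a\<in>Z. g a powi (- m a))"
proof -
  have "comm_det (\<lambda>z. \<Prod>a\<in>Z. (1 - a / z) powi m a) g (\<Prod>a\<in>Z. (g 0 / g a) powi m a)"
    using Z(2) by (intro comm_det_prod[OF Z(1) g] comm_det_powi comm_det_factor[OF g]) auto
  moreover have "(\<Prod>a\<in>Z. (g 0 / g a) powi m a) = (\<Prod>a\<in>Z. g a powi (- m a))"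
  proof -
    have g0: "g 0 \<noteq> 0" using g by (simp add: analytic_unit_def)
    have "(\<Prod>a\<in>Z. (g 0 / g a) powi m a) = (\<Prod>a\<in>Z. g 0 powi m a) * (\<Prod>a\<in>Z. g a powi (- m a))"
      unfolding prod.distrib[symmetric]
      by (intro prod.cong refl) (simp add: power_int_divide_distrib power_int_minus field_simps)
    then show ?thesis using g0 by (simp add: prod_power_int sum)
  qed
  ultimately show ?thesis by simp
qed

text \<open>The orders add up to zero, so the powers of \<open>z\<close> split off from the factors \<open>z - a\<close> cancel.\<close>

lemma symbol_on_circle:
  assumes "cmod z = 1" and sum: "(\<Sum>a\<in>Z. m a) = 0"
  shows "(\<Prod>a\<in>Z. (z - a) powi m a) = (\<Prod>a\<in>Z. (1 - a / z) powi m a)"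
proof -
  have z: "z \<noteq> 0" using assms(1) by auto
  have "(\<Prod>a\<in>Z. (z - a) powi m a) = (\<Prod>a\<in>Z. z powi m a * (1 - a / z) powi m a)"
    unfolding power_int_mult_distrib[symmetric] using z by (simp add: right_diff_distrib)
  also have "\<dots> = (\<Prod>a\<in>Z. (1 - a / z) powi m a)"
    using z by (simp add: prod.distrib prod_power_int sum)
  finally show ?thesis .
qed

theorem mainTheorem1:
  fixes \<phi> \<psi> :: "complex \<Rightarrow> complex" and U :: "complex set"
  assumes "open U" and "cball 0 1 \<subseteq> U"
    and "\<phi> nicely_meromorphic_on U" and "\<psi> nicely_meromorphic_on U"
    and "\<forall>z\<in>sphere 0 1. \<phi> z \<noteq> 0 \<and> \<not> is_pole \<phi> z"
    and "\<forall>z\<in>sphere 0 1. \<psi> z \<noteq> 0 \<and> \<not> is_pole \<psi> z"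
    and "winding_number (\<phi> \<circ> circlepath 0 1) 0 = 0"
    and "winding_number (\<psi> \<circ> circlepath 0 1) 0 = 0"
  defines "X \<equiv> toeplitz \<phi> \<circ> toeplitz \<psi> \<circ>
                 inv_into hardy (toeplitz \<phi>) \<circ> inv_into hardy (toeplitz \<psi>)"
  shows "bij_betw (toeplitz \<phi>) hardy hardy \<and> bij_betw (toeplitz \<psi>) hardy hardy
    \<and> trace_class_on hardy (\<lambda>f. X f - f)
    \<and> finite {z \<in> ball 0 1. tame_symbol \<phi> \<psi> z \<noteq> 1}
    \<and> fredholm_det X =
        (\<Prod>z | z \<in> ball 0 1 \<and> tame_symbol \<phi> \<psi> z \<noteq> 1. inverse (tame_symbol \<phi> \<psi> z))"
proof -
  define m where "m = zorder \<phi>"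
  define n where "n = zorder \<psi>"
  obtain Z1 g where 1: "finite Z1" "Z1 \<subseteq> ball 0 1" "analytic_unit g"
    "\<And>z. z \<in> cball 0 1 - Z1 \<Longrightarrow> \<phi> z = g z * (\<Prod>a\<in>Z1. (z - a) powi m a)"
    "\<And>z. z \<in> ball 0 1 - Z1 \<Longrightarrow> m z = 0" "(\<Sum>a\<in>Z1. m a) = 0"
    unfolding m_def using meromorphic_factorization[OF assms(1,2,3,5,7)] by blast
  obtain Z2 h where 2: "finite Z2" "Z2 \<subseteq> ball 0 1" "analytic_unit h"
    "\<And>z. z \<in> cball 0 1 - Z2 \<Longrightarrow> \<psi> z = h z * (\<Prod>a\<in>Z2. (z - a) powi n a)"
    "\<And>z. z \<in> ball 0 1 - Z2 \<Longrightarrow> n z = 0" "(\<Sum>a\<in>Z2. n a) = 0"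
    unfolding n_def using meromorphic_factorization[OF assms(1,2,4,6,8)] by blast
  define Z where "Z = Z1 \<union> Z2"
  have Z: "finite Z" "Z \<subseteq> ball 0 1" using 1 2 by (auto simp: Z_def)
  have \<phi>: "\<phi> z = g z * (\<Prod>a\<in>Z. (z - a) powi m a)" if "z \<in> cball 0 1 - Z" for z
  proof -
    have "(\<Prod>a\<in>Z1. (z - a) powi m a) = (\<Prod>a\<in>Z. (z - a) powi m a)"
      using 1(5) 2(2) Z by (intro prod.mono_neutral_left) (auto simp: Z_def)
    then show ?thesis using 1(4)[of z] that by (simp add: Z_def)
  qed
  have \<psi>: "\<psi> z = h z * (\<Prod>a\<in>Z. (z - a) powi n a)" if "z \<in> cball 0 1 - Z" for z
  proof -
    have "(\<Prod>a\<in>Z2. (z - a) powi n a) = (\<Prod>a\<in>Z. (z - a) powi n a)"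
      using 2(5) 1(2) Z by (intro prod.mono_neutral_left) (auto simp: Z_def)
    then show ?thesis using 2(4)[of z] that by (simp add: Z_def)
  qed
  have m0: "(\<Sum>a\<in>Z. m a) = 0"
    unfolding 1(6)[symmetric] using 1(5) 2(2) Z by (intro sum.mono_neutral_right) (auto simp: Z_def)
  have n0: "(\<Sum>a\<in>Z. n a) = 0"
    unfolding 2(6)[symmetric] using 2(5) 1(2) Z by (intro sum.mono_neutral_right) (auto simp: Z_def)
  note g = 1(3) and h = 2(3)
  let ?a = "\<lambda>z. \<Prod>a\<in>Z. (1 - a / z) powi m a" and ?b = "\<lambda>z. \<Prod>a\<in>Z. (1 - a / z) powi n a"
  have aB: "comm_det ?a h (\<Prod>a\<in>Z. h a powi (- m a))" by (rule comm_det_circle_factors[OF Z m0 h])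
  have bA: "comm_det ?b g (\<Prod>a\<in>Z. g a powi (- n a))" by (rule comm_det_circle_factors[OF Z n0 g])
  have \<phi>': "\<phi> z = ?a z * g z" if "cmod z = 1" for z
  proof -
    have "z \<in> cball 0 1 - Z" using that Z(2) by auto
    then show ?thesis unfolding symbol_on_circle[OF that m0, symmetric] using \<phi> by (simp add: mult.commute)
  qed
  have \<psi>': "\<psi> z = ?b z * h z" if "cmod z = 1" for z
  proof -
    have "z \<in> cball 0 1 - Z" using that Z(2) by auto
    then show ?thesis unfolding symbol_on_circle[OF that n0, symmetric] using \<psi> by (simp add: mult.commute)
  qed
  \<comment> \<open>the factorizations \<open>\<phi> = a g\<close>, \<open>\<psi> = b h\<close> into coanalytic and analytic units invert the Toeplitz operators\<close>
  have bij: "bij_betw (toeplitz \<phi>) hardy hardy" "bij_betw (toeplitz \<psi>) hardy hardy"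
    using aB bA by (auto intro!: toeplitz_bij_betw(1)[OF _ g \<phi>'] toeplitz_bij_betw(1)[OF _ h \<psi>'] simp: comm_det_def)
  have det: "has_det X ((\<Prod>a\<in>Z. h a powi (- m a)) / (\<Prod>a\<in>Z. g a powi (- n a)))"
    unfolding X_def by (rule toeplitz_commutator_det[OF \<phi>' \<psi>' aB bA])
  let ?T = "{z \<in> ball 0 1. tame_symbol \<phi> \<psi> z \<noteq> 1}"
  have sub: "?T \<subseteq> Z"
  proof (rule subsetI, rule ccontr)
    fix z assume "z \<in> ?T" "z \<notin> Z"
    then show False
      using tame_symbol_eq_1[of \<phi> z \<psi>] 1(5)[of z] 2(5)[of z] by (auto simp: Z_def m_def n_def)
  qed
  have fin: "finite ?T" using sub Z(1) by (rule finite_subset)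
  have tame: "tame_symbol \<phi> \<psi> a = h a powi m a / g a powi n a * (\<Prod>b\<in>Z. reciprocity_factor m n a b)"
    if a: "a \<in> Z" for a
  proof -
    have a1: "a \<in> ball 0 1" "a \<in> cball 0 1" using a Z(2) by auto
    then have "isCont g a" "isCont h a" "g a \<noteq> 0" "h a \<noteq> 0"
      using g h unfolding analytic_unit_def 
      by (blast intro: analytic_at_imp_isCont analytic_on_subset)+
    then show ?thesis
      using tame_symbol_eq[OF Z(1) a a1(1), of g h \<phi> \<psi>] \<phi> \<psi> by (simp add: m_def n_def)
  qed
  have "(\<Prod>z\<in>?T. inverse (tame_symbol \<phi> \<psi> z)) = (\<Prod>z\<in>Z. inverse (tame_symbol \<phi> \<psi> z))"
    using sub Z by (intro prod.mono_neutral_left) auto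
  also have "\<dots> = inverse (\<Prod>a\<in>Z. h a powi m a / g a powi n a * (\<Prod>b\<in>Z. reciprocity_factor m n a b))"
    unfolding prod_inversef[symmetric] o_def by (intro prod.cong) (auto simp: tame)
  also have "\<dots> = inverse (\<Prod>a\<in>Z. h a powi m a / g a powi n a)"
    unfolding prod.distrib prod_reciprocity_factor[OF m0] by simp
  also have "\<dots> = (\<Prod>a\<in>Z. h a powi (- m a)) / (\<Prod>a\<in>Z. g a powi (- n a))"
    unfolding prod_dividef power_int_minus prod_inversef[unfolded o_def] by (simp add: field_simps)
  finally have "fredholm_det X = (\<Prod>z\<in>?T. inverse (tame_symbol \<phi> \<psi> z))"
    using fredholm_det_eqI[OF det] by simp
  then show ?thesis
    using bij has_det_imp_trace_class[OF det] fin by simp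
qed

end
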